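(* Let $K\subseteq\mathbb{R}^n$ be a centrally symmetric convex body in John's position and let $(c_j,v_j)_{j=1}^m\subseteq(0,1]\times(\partial K\cap S^{n-1})$ be its associated decomposition of the identity. Let $H$ be a $k$-dimensional linear subspace of $\mathbb{R}^n$, let $J=\{1\le j\le m:P_Hv_j\neq0\}$ and let $m_0$ be the cardinality of $J$. Assume that $\tilde c_j=c_j\|P_Hv_j\|_2^2\ge\frac12$ for every $j\in J$ and that $m_0>n$. Then $$\mathrm{vol}_k(K\cap H)\le2^{\frac{m_0-k}{2}}\,\mathrm{vol}_k(B_\infty^k)\prod_{j\in J}c_j^{\frac{c_j\|P_Hv_j\|_2^2}{2}}\le\left(\frac{m_0+n-2k}{m_0-k}\right)^{\frac{m_0-k}{2}}\mathrm{vol}_k(B_\infty^k).$$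
   Context: A convex body $K\subseteq\mathbb{R}^n$ is in John's position if the maximal volume ellipsoid contained in $K$ is the Euclidean unit ball $B_2^n$. A centrally symmetric convex body $K$ is in John's position if and only if $B_2^n\subseteq K$ and there exist contact points $v_1,\dots,v_m\in\partial K\cap S^{n-1}$ and $c_1,\dots,c_m\in(0,1]$ with $\mathrm{Id}_n=\sum_{j=1}^mc_j\,v_j\otimes v_j$; such a family $(c_j,v_j)_{j=1}^m$ is called an associated decomposition of the identity. $P_H$ is the orthogonal projection onto $H$, and $B_\infty^k=[-1,1]^k$. *)

theory Defs
  imports "HOL-Analysis.Analysis"
begin

definition convex_body :: "'a::euclidean_space set \<Rightarrow> bool" where
  "convex_body K \<longleftrightarrow> convex K \<and> compact K \<and> interior K \<noteq> {}"

definition centrally_symmetric :: "'a::real_vector set \<Rightarrow> bool" where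
  "centrally_symmetric K \<longleftrightarrow> uminus ` K = K"

definition ellipsoid :: "(real^'n) set \<Rightarrow> bool" where
  "ellipsoid E \<longleftrightarrow>
     (\<exists>(A :: real^'n^'n) a. invertible A \<and> E = (\<lambda>x. a + A *v x) ` cball 0 1)"

definition max_volume_ellipsoid :: "(real^'n) set \<Rightarrow> (real^'n) set \<Rightarrow> bool" where
  "max_volume_ellipsoid K E \<longleftrightarrow>
     ellipsoid E \<and> E \<subseteq> K \<and>
     (\<forall>E'. ellipsoid E' \<and> E' \<subseteq> K \<longrightarrow> measure lborel E' \<le> measure lborel E)"

(* A convex body has exactly one ellipsoid of maximal volume (John), so it is enough
   to ask that the unit ball is such an ellipsoid. *)
definition john_position :: "(real^'n) set \<Rightarrow> bool" where
  "john_position K \<longleftrightarrow> max_volume_ellipsoid K (cball 0 1)"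

definition tensor :: "real^'n \<Rightarrow> real^'n \<Rightarrow> real^'n^'n" where
  "tensor u v = (\<chi> a b. u $ a * v $ b)"

definition identity_decomposition ::
    "(real^'n) set \<Rightarrow> nat \<Rightarrow> (nat \<Rightarrow> real) \<Rightarrow> (nat \<Rightarrow> real^'n) \<Rightarrow> bool" where
  "identity_decomposition K m c v \<longleftrightarrow>
     (\<forall>j\<in>{1..m}. 0 < c j \<and> c j \<le> 1 \<and> v j \<in> frontier K \<inter> sphere 0 1) \<and>
     mat 1 = (\<Sum>j=1..m. c j *\<^sub>R tensor (v j) (v j))"

definition orth_proj :: "'a::euclidean_space set \<Rightarrow> 'a \<Rightarrow> 'a" where
  "orth_proj H x = (THE y. y \<in> H \<and> (\<forall>h\<in>H. orthogonal (x - y) h))"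

lemma orth_proj_unique:
  fixes H :: "'a::euclidean_space set"
  assumes "subspace H"
  shows "\<exists>!y. y \<in> H \<and> (\<forall>h\<in>H. orthogonal (x - y) h)"
proof -
  obtain y z where yz: "y \<in> span H" "\<And>w. w \<in> span H \<Longrightarrow> orthogonal z w" "x = y + z"
    using orthogonal_subspace_decomp_exists by metis
  have sp: "span H = H" using assms by (simp add: span_eq_iff)
  show ?thesis
  proof (rule ex1I[of _ y])
    show "y \<in> H \<and> (\<forall>h\<in>H. orthogonal (x - y) h)" using yz sp by auto
  next
    fix y' assume y': "y' \<in> H \<and> (\<forall>h\<in>H. orthogonal (x - y') h)"
    have d: "y' - y \<in> H" using y' yz(1) sp assms subspace_diff by metis
    have "orthogonal (x - y') (y' - y)" "orthogonal (x - y) (y' - y)"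
      using d y' yz sp by auto
    then have "(y' - y) \<bullet> (y' - y) = 0"
      by (simp add: orthogonal_def inner_diff_left)
    then show "y' = y" by simp
  qed
qed

lemma orth_proj:
  assumes "subspace H"
  shows "orth_proj H x \<in> H" and "h \<in> H \<Longrightarrow> orthogonal (x - orth_proj H x) h"
  using theI'[OF orth_proj_unique[OF assms, of x]] unfolding orth_proj_def by auto

definition orthonormal_basis :: "'a::euclidean_space set \<Rightarrow> 'a set \<Rightarrow> bool" where
  "orthonormal_basis H B \<longleftrightarrow>
     B \<subseteq> H \<and> pairwise orthogonal B \<and> (\<forall>b\<in>B. norm b = 1) \<and> span B = H"

definition some_orthonormal_basis :: "'a::euclidean_space set \<Rightarrow> 'a set" where
  "some_orthonormal_basis H = (SOME B. orthonormal_basis H B)"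

lemma some_orthonormal_basis:
  assumes "subspace H"
  shows "orthonormal_basis H (some_orthonormal_basis H)"
proof -
  have "\<exists>B. orthonormal_basis H B"
    using orthonormal_basis_subspace[OF assms] unfolding orthonormal_basis_def by metis
  then show ?thesis unfolding some_orthonormal_basis_def by (rule someI_ex)
qed

(* Lebesgue measure of dimension dim H on a linear subspace H, as a measure on the ambient
   space: lborel_def with an orthonormal basis of H in place of Basis. By the rotation
   invariance of Lebesgue measure the choice of the basis is irrelevant. *)
definition subspace_lborel :: "'a::euclidean_space set \<Rightarrow> 'a measure" where
  "subspace_lborel H =
     (let B = some_orthonormal_basis H
      in distr (\<Pi>\<^sub>M b\<in>B. lborel) borel (\<lambda>f. \<Sum>b\<in>B. f b *\<^sub>R b))"

definition subspace_vol :: "'a::euclidean_space set \<Rightarrow> 'a set \<Rightarrow> real" where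
  "subspace_vol H A = measure (subspace_lborel H) A"

(* R^k for a number k: the functions on {..<k} that are undefined elsewhere, with the
   product measure. *)
definition cube :: "nat \<Rightarrow> (nat \<Rightarrow> real) set" where
  "cube k = (\<Pi>\<^sub>E i\<in>{..<k}. {-1..1})"

definition vol :: "nat \<Rightarrow> (nat \<Rightarrow> real) set \<Rightarrow> real" where
  "vol k A = measure (\<Pi>\<^sub>M i\<in>{..<k}. lborel) A"

end

theory Submission
  imports Defs "HOL-Probability.Probability"
begin

text \<open>The contact points put \<open>K \<inter> H\<close> into a slab \<open>{x \<in> H. \<forall>j. \<bar>x \<bullet> w j\<bar> \<le> sqrt (c j)}\<close> with
  \<open>w j = sqrt (c j) P v j\<close>, and the \<open>w j\<close> form a Parseval frame of \<open>H\<close> with \<open>(norm (w j))\<^sup>2 \<ge> 1/2\<close>.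
  The slab is a central section of a box, and Fourier inversion on the orthogonal complement of
  the section bounds its volume by the integral of a product of functions \<open>sin (a t) / t\<close> of the
  coordinates. As the squared norms of the projections onto the complement are at most \<open>1/2\<close>, the
  geometric Brascamp-Lieb inequality and Ball's inequality for the \<open>L\<^sup>p\<close> norm of \<open>sin t / t\<close>, which
  needs \<open>p \<ge> 2\<close>, finish the first estimate. The second one is Jensen's inequality for weights
  obtained from the concavity of the logarithm.\<close>

section \<open>Ball's integral inequality\<close>

text \<open>The lower bound 1/2 on the squared norms acts twice. A factor whose complementary vector
  has norm \<open>s\<close> enters the Brascamp-Lieb inequality with the power
  \<open>1 / s^2\<close>, and s^2 \<le> 1/2 puts this power into the range of Ball's inequality. It
  also bounds the number of vectors by twice the dimension, because the squared norms of a Parseval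
  frame sum to the dimension. The second fact meets the main obstacle: the dimension of a space is a
  type here, while the dimensions of \<open>H\<close> and of the complement of the section are mere
  numbers. So the slab in \<open>H\<close> is multiplied by a cube in the orthogonal complement of
  \<open>H\<close>, and the index set is padded to exactly twice the dimension, which gives section
  and complement the same type. The factor 2 powr ((m0 - k) / 2) collects the factors
  \<open>sqrt 2\<close> of Ball's inequality, as the complementary squared norms sum to m0 -
  k.\<close>

text \<open>For \<open>p \<in> {2..3}\<close> the inequality follows from the cases \<open>p = 2\<close> and \<open>p = 3\<close> by log-convexity, as
  \<open>- (p - 2) / 4\<close> is a tangent of \<open>ln (sqrt (2 / p))\<close>. For \<open>p \<ge> 3\<close> a comparison with the Gaussian
  \<open>exp (- x\<^sup>2 / 6)\<close> on \<open>{0..pi}\<close> is good enough.\<close>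

lemma FTC_Ioi_nonneg:
  fixes f F :: "real \<Rightarrow> real"
  assumes "\<And>x. a < x \<Longrightarrow> (F has_real_derivative f x) (at x)"
    and "\<And>x. a < x \<Longrightarrow> isCont f x" and "\<And>x. a < x \<Longrightarrow> 0 \<le> f x"
    and "(F \<longlongrightarrow> A) (at_right a)" and "(F \<longlongrightarrow> B) at_top"
  shows "set_integrable lborel {a<..} f" and "(LBINT x:{a<..}. f x) = B - A"
  using interval_integral_FTC_nonneg[of "ereal a" \<infinity> F f A B] assms
  by (auto simp: ereal_tendsto_simps interval_integral_to_infinity_eq)

text \<open>For integrands that change sign, such as the cube below, integrability is a separate
  premise. The half-line is open because at 0 the quotient sin x / x only has the default value
  0.\<close>

lemma FTC_Ioi_integrable:
  fixes f F :: "real \<Rightarrow> real"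
  assumes "\<And>x. a < x \<Longrightarrow> (F has_real_derivative f x) (at x)"
    and "\<And>x. a < x \<Longrightarrow> isCont f x" and "set_integrable lborel {a<..} f"
    and "(F \<longlongrightarrow> A) (at_right a)" and "(F \<longlongrightarrow> B) at_top"
  shows "(LBINT x:{a<..}. f x) = B - A"
  using interval_integral_FTC_integrable[of "ereal a" \<infinity> F f A B] assms
  by (auto simp: ereal_tendsto_simps interval_integral_to_infinity_eq
      has_real_derivative_iff_has_vector_derivative)

text \<open>One integration by parts reduces the square to sin (2 x) / x, whose antiderivative is
  \<open>Si (2 * x)\<close>. The boundary terms vanish at both ends, and \<open>Si\<close> tends to
  pi / 2.\<close>

lemma sinc_sq_Ioi:
  "set_integrable lborel {0<..} (\<lambda>x::real. (sin x / x)\<^sup>2)"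
  "(LBINT x:{0<..}. (sin x / x)\<^sup>2) = pi / 2"
proof -
  let ?F = "\<lambda>x. Si (2 * x) - (sin x)\<^sup>2 / x"
  have D: "(?F has_real_derivative (sin x / x)\<^sup>2) (at x)" if "0 < x" for x
    using that
    by (auto intro!: derivative_eq_intros DERIV_chain2[OF DERIV_Si] simp: sin_double)
       (simp add: field_simps power2_eq_square)
  have C: "isCont (\<lambda>x. (sin x / x)\<^sup>2) x" if "0 < x" for x :: real
    using that by (auto intro!: continuous_intros)
  have "((\<lambda>x::real. sin x * (sin x / x)) \<longlongrightarrow> sin 0 * 1) (at 0)"
    by (intro tendsto_intros sinc_at_0)
  then have l: "((\<lambda>x::real. (sin x)\<^sup>2 / x) \<longlongrightarrow> 0) (at_right 0)"
    using filterlim_at_split by (fastforce simp: power2_eq_square)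
  have "((\<lambda>x. Si (2 * x)) \<longlongrightarrow> Si (2 * 0)) (at_right 0)"
    using isCont_Si by (intro isCont_tendsto_compose[of _ Si] tendsto_intros) auto
  moreover have "Si 0 = 0" using Si_neg[of 0] by simp
  ultimately have A: "(?F \<longlongrightarrow> 0 - 0) (at_right 0)"
    by (intro tendsto_diff l) simp
  have 1: "((\<lambda>x. Si (2 * x)) \<longlongrightarrow> pi/2) at_top"
    by (rule filterlim_compose[OF Si_at_top]) real_asymp
  have 2: "((\<lambda>x::real. (sin x)\<^sup>2 / x) \<longlongrightarrow> 0) at_top"
  proof (rule Lim_null_comparison)
    show "\<forall>\<^sub>F x in at_top. norm ((sin x)\<^sup>2 / x) \<le> 1 / (x::real)"
      using eventually_gt_at_top[of 0]
      by eventually_elim (auto simp: abs_square_le_1 intro!: divide_right_mono)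
    show "((\<lambda>x::real. 1 / x) \<longlongrightarrow> 0) at_top" by real_asymp
  qed
  have B: "(?F \<longlongrightarrow> pi/2 - 0) at_top" by (intro tendsto_diff 1 2)
  show "set_integrable lborel {0<..} (\<lambda>x::real. (sin x / x)\<^sup>2)"
    using FTC_Ioi_nonneg(1)[OF D C _ A B] by simp
  show "(LBINT x:{0<..}. (sin x / x)\<^sup>2) = pi / 2"
    using FTC_Ioi_nonneg(2)[OF D C _ A B] by simp
qed

lemma abs_sinc_le_1: "\<bar>sin x / x\<bar> \<le> (1::real)"
  using abs_sin_x_le_abs_x[of x] by (cases "x = 0") (auto simp: abs_divide divide_le_eq_1)

lemma sin_triple: "sin (3 * x) = 3 * sin x - 4 * (sin x)^3" for x :: real
proof -
  have c: "(cos x)\<^sup>2 = 1 - (sin x)\<^sup>2" by (simp add: cos_squared_eq)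
  have "sin (3 * x) = sin (2 * x + x)" by simp
  also have "\<dots> = 2 * sin x * (cos x)\<^sup>2 + ((cos x)\<^sup>2 - (sin x)\<^sup>2) * sin x"
    unfolding sin_add sin_double cos_double by (simp add: power2_eq_square)
  also have "\<dots> = 3 * sin x - 4 * (sin x)^3"
    unfolding c by (simp add: field_simps eval_nat_numeral)
  finally show ?thesis .
qed

text \<open>Two integrations by parts reduce sin^3 / x^3 to half of the second derivative of sin^3,
  divided by x. That derivative is (9 sin (3 x) - 3 sin x) / 4, which is the origin of the factors
  9/8 and -3/8. The result is left in raw form, with \<open>u\<close> for the inverse, so that its
  simplification is pure algebra.\<close>

lemma DERIV_sinc_cube_aux: fixes x u :: real assumes "u = inverse x" "0 < x" shows  "((\<lambda>x. - ((sin x)^3) * (inverse x)\<^sup>2 / 2 - 3 * (sin x)\<^sup>2 * cos x * inverse x / 2 - 3/8 * Si x + 9/8 * Si (3 * x)) has_real_derivative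
        (- (3 * (sin x)\<^sup>2 * cos x) * u^2 / 2 - (sin x)^3 * (2 * u * (- (u * u))) / 2
        - (3 * (2 * sin x * cos x * cos x + (sin x)\<^sup>2 * (- sin x)) * u + 3 * (sin x)\<^sup>2 * cos x * (- (u * u))) / 2
        - 3/8 * sinc x + 9/8 * (sinc (3 * x) * 3))) (at x)"
proof -
  have 1: "((\<lambda>x. - ((sin x)^3) * (inverse x)\<^sup>2 / 2) has_real_derivative - (3 * (sin x)\<^sup>2 * cos x) * u^2 / 2 - (sin x)^3 * (2 * u * (- (u * u))) / 2) (at x)"
    unfolding assms(1) using assms(2) by (auto intro!: derivative_eq_intros) (simp add: algebra_simps power2_eq_square diff_divide_distrib)
  have 2: "((\<lambda>x. 3 * (sin x)\<^sup>2 * cos x * inverse x / 2) has_real_derivative (3 * (2 * sin x * cos x * cos x + (sin x)\<^sup>2 * (- sin x)) * u + 3 * (sin x)\<^sup>2 * cos x * (- (u * u))) / 2) (at x)"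
    unfolding assms(1) using assms(2) by (auto intro!: derivative_eq_intros)
  have 3: "((\<lambda>x. Si (3 * x)) has_real_derivative sinc (3 * x) * 3) (at x)"
    by (rule DERIV_chain2[OF DERIV_Si]) (auto intro!: derivative_eq_intros)
  show ?thesis by (intro DERIV_diff DERIV_add DERIV_cmult 1 2 3 DERIV_Si)
qed
text \<open>With sine, cosine and inverse as free variables this is a polynomial identity modulo s^2
  + c^2 = 1; \<open>3 * s - 4 * s^3\<close> stands for the sine of the tripled argument.\<close>

lemma sinc_cube_identity:
  fixes s c u :: real
  assumes "c\<^sup>2 = 1 - s\<^sup>2"
  shows "- (3 * s\<^sup>2 * c) * u^2 / 2 - s^3 * (2 * u * (- (u * u))) / 2
        - (3 * (2 * s * c * c + s\<^sup>2 * (- s)) * u + 3 * s\<^sup>2 * c * (- (u * u))) / 2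
        - 3/8 * (s * u) + 9/8 * ((3 * s - 4 * s^3) * u / 3 * 3) = (s * u)^3"
proof -
  have a: "2 * s * c * c = 2 * s * (1 - s\<^sup>2)"
    using assms by (simp add: power2_eq_square mult.assoc)
  show ?thesis unfolding a
    by (simp add: algebra_simps eval_nat_numeral diff_divide_distrib add_divide_distrib)
qed

lemma sinc_cube_Ioi:
  "set_integrable lborel {0<..} (\<lambda>x::real. (sin x / x) ^ 3)"
  "(LBINT x:{0<..}. (sin x / x) ^ 3) = 3 * pi / 8"
proof -
  let ?F = "\<lambda>x. - ((sin x)^3) * (inverse x)\<^sup>2 / 2 - 3 * (sin x)\<^sup>2 * cos x * inverse x / 2 - 3/8 * Si x + 9/8 * Si (3 * x)"
  have cs: "(cos x)\<^sup>2 = 1 - (sin x)\<^sup>2" for x :: real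
    by (simp add: cos_squared_eq)
  have D: "(?F has_real_derivative (sin x / x)^3) (at x)" if "0 < x" for x
  proof -
    define u where "u = inverse x"
    have su: "sin x / x = sin x * u" by (simp add: u_def divide_inverse)
    have s1: "sinc x = sin x * u" using that by (simp add: u_def divide_inverse)
    have s2: "sinc (3 * x) = sin (3 * x) * u / 3" using that by (simp add: u_def field_simps)
    show ?thesis unfolding su sinc_cube_identity[OF cs[of x], of u, symmetric]
      using DERIV_sinc_cube_aux[OF u_def that] 
      unfolding s1 s2 unfolding sin_triple .
  qed
  have C: "isCont (\<lambda>x. (sin x / x)^3) x" if "0 < x" for x :: real
    using that by (auto intro!: continuous_intros)
  \<comment> \<open>The square dominates the cube, since the quotient is at most 1 in absolute
    value.\<close>
  have I: "set_integrable lborel {0<..} (\<lambda>x::real. (sin x / x) ^ 3)"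
    using sinc_sq_Ioi(1) unfolding set_integrable_def
  proof (rule Bochner_Integration.integrable_bound)
    have *: "\<bar>i * y ^ 3\<bar> \<le> \<bar>i * y\<^sup>2\<bar>" if "\<bar>y\<bar> \<le> 1" for i y :: real
      using power_decreasing[of 2 3 "\<bar>y\<bar>"] that
      by (auto simp: abs_mult power_abs intro!: mult_left_mono)
    have "norm (indicat_real {0<..} x *\<^sub>R (sin x / x) ^ 3) \<le> norm (indicat_real {0<..} x *\<^sub>R (sin x / x)\<^sup>2)" for x :: real
      using *[OF abs_sinc_le_1, of "indicator {0<..} x" x] by (simp only: real_norm_def real_scaleR_def)
    then show "AE x in lborel. norm (indicat_real {0<..} (x::real) *\<^sub>R (sin x / x) ^ 3) \<le> norm (indicat_real {0<..} x *\<^sub>R (sin x / x)\<^sup>2)"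
      by (intro AE_I2)
    show "(\<lambda>x::real. indicat_real {0<..} x *\<^sub>R (sin x / x) ^ 3) \<in> borel_measurable lborel"
      by measurable
  qed
  have sl: "((\<lambda>x::real. sin x / x) \<longlongrightarrow> 1) (at_right 0)"
    by (rule tendsto_within_subset[OF sinc_at_0]) simp
  \<comment> \<open>Near 0 every negative power of x is paired with a sine, so that the
    antiderivative becomes an expression in sin x / x and continuous functions.\<close>
  have "((\<lambda>x. - (1/2) * sin x * (sin x / x)^2 - 3/2 * sin x * cos x * (sin x / x) - 3/8 * Si x + 9/8 * Si (3 * x))
    \<longlongrightarrow> - (1/2) * sin 0 * 1^2 - 3/2 * sin 0 * cos 0 * 1 - 3/8 * Si 0 + 9/8 * Si (3 * 0)) (at_right 0)"
  proof -
    have 1: "((\<lambda>x. Si (3 * x)) \<longlongrightarrow> Si (3 * 0)) (at_right 0)"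
      by (rule isCont_tendsto_compose[OF isCont_Si]) (intro tendsto_intros)
    have 2: "(Si \<longlongrightarrow> Si 0) (at_right 0)"
      by (rule isCont_tendsto_compose[OF isCont_Si]) (rule tendsto_ident_at)
    show ?thesis by (intro tendsto_diff tendsto_add tendsto_mult tendsto_power tendsto_const tendsto_sin tendsto_cos
      tendsto_ident_at sl 1 2)
  qed
  moreover have "Si 0 = 0" using Si_neg[of 0] by simp
  moreover have "- (1/2) * sin x * (sin x / x)^2 - 3/2 * sin x * cos x * (sin x / x) - 3/8 * Si x + 9/8 * Si (3 * x) = ?F x" for x
    by (cases "x = 0") (simp_all add: divide_simps, simp_all add: eval_nat_numeral)
  ultimately have A: "(?F \<longlongrightarrow> 0) (at_right 0)" by simp
  have 1: "((\<lambda>x. Si (3 * x)) \<longlongrightarrow> pi/2) at_top"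
    by (rule filterlim_compose[OF Si_at_top]) real_asymp
  have b: "((\<lambda>x::real. g x * h x / 2) \<longlongrightarrow> 0) at_top"
    if "\<And>x. \<bar>g x\<bar> \<le> 3" "((\<lambda>x::real. 3 * \<bar>h x\<bar>) \<longlongrightarrow> 0) at_top" for g h :: "real \<Rightarrow> real"
  proof (rule Lim_null_comparison[OF always_eventually that(2)], rule allI)
    fix x have "\<bar>g x\<bar> * \<bar>h x\<bar> \<le> 3 * \<bar>h x\<bar>" by (intro mult_right_mono that(1)) auto
    then show "norm (g x * h x / 2) \<le> 3 * \<bar>h x\<bar>" by (simp add: abs_mult)
  qed
  have a3: "\<bar>(sin x)^3\<bar> \<le> 1" for x :: real
    by (simp add: power_abs power_le_one)
  have a2: "\<bar>(sin x)\<^sup>2 * cos x\<bar> \<le> 1" for x :: real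
    unfolding abs_mult by (intro mult_le_one) (auto simp: abs_square_le_1)
  have 2: "((\<lambda>x::real. - ((sin x)^3) * (inverse x)\<^sup>2 / 2) \<longlongrightarrow> 0) at_top"
  proof (rule b)
    show "\<bar>- (sin x ^ 3)\<bar> \<le> 3" for x :: real using a3[of x] by simp
  qed real_asymp
  have 3: "((\<lambda>x::real. 3 * (sin x)\<^sup>2 * cos x * inverse x / 2) \<longlongrightarrow> 0) at_top"
  proof (rule b)
    show "\<bar>3 * (sin x)\<^sup>2 * cos x\<bar> \<le> 3" for x :: real using a2[of x] by (simp add: abs_mult)
  qed real_asymp
  have B: "(?F \<longlongrightarrow> 0 - 0 - 3/8 * (pi/2) + 9/8 * (pi/2)) at_top"
    by (intro tendsto_intros 1 2 3 Si_at_top)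
  show "set_integrable lborel {0<..} (\<lambda>x::real. (sin x / x) ^ 3)" by (fact I)
  show "(LBINT x:{0<..}. (sin x / x) ^ 3) = 3 * pi / 8"
    using FTC_Ioi_integrable[OF D C I A B] by simp
qed

text \<open>\<open>Psi\<close> comes from integrating \<open>(sin x)\<^sup>2 / x ^ 3 = (1 - cos (2 * x)) / (2 * x ^ 3)\<close> twice by parts and
  bounding the remaining integral; its oscillating terms vanish at the multiples of \<open>pi\<close>.\<close>

definition Psi :: "real \<Rightarrow> real" where
  "Psi x = - sin (2 * x) * inverse x ^ 3 / 4 + 3/8 * (cos (2 * x) - 1) * inverse x ^ 4 - inverse x ^ 2 / 4"

text \<open>Replacing the cosine by 1 in the last remaining integral costs exactly the second
  summand; being nonnegative, it makes \<open>psi\<close> a majorant of sin^2 / x^3.\<close>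

definition psi :: "real \<Rightarrow> real" where
  "psi x = (sin x)\<^sup>2 * inverse x ^ 3 + 3/2 * (1 - cos (2 * x)) * inverse x ^ 5"

lemma DERIV_Psi:
  assumes "x > 0"
  shows "(Psi has_real_derivative psi x) (at x)"
proof -
  define u where "u = inverse x"
  define s where "s = sin (2 * x)"
  define c where "c = cos (2 * x)"
  have "(Psi has_real_derivative - (c * 2) * u^3 / 4 + - s * (3 * u^2 * (- (u * u))) / 4
     + (3/8 * (- s * 2) * u^4 + 3/8 * (c - 1) * (4 * u^3 * (- (u * u)))) - 2 * u * (- (u * u)) / 4) (at x)"
    unfolding Psi_def[abs_def] using assms
    by (auto intro!: derivative_eq_intros simp flip: u_def s_def c_def)
       (simp add: field_simps eval_nat_numeral)
  moreover have "(sin x)\<^sup>2 = (1 - c) / 2" unfolding c_def by (simp add: cos_double_sin)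
  then have "- (c * 2) * u^3 / 4 + - s * (3 * u^2 * (- (u * u))) / 4
     + (3/8 * (- s * 2) * u^4 + 3/8 * (c - 1) * (4 * u^3 * (- (u * u)))) - 2 * u * (- (u * u)) / 4 = psi x"
    unfolding psi_def u_def[symmetric] c_def[symmetric]
    by (simp only:) (simp add: field_simps eval_nat_numeral)
  ultimately show ?thesis by simp
qed

lemma psi_ge:
  assumes "x > 0"
  shows "(sin x)\<^sup>2 / x^3 \<le> psi x"
proof -
  have "0 \<le> 3/2 * (1 - cos (2 * x)) * inverse x ^ 5"
    using assms by (intro mult_nonneg_nonneg) auto
  moreover have "(sin x)\<^sup>2 / x^3 = (sin x)\<^sup>2 * inverse x ^ 3"
    by (simp add: divide_inverse power_inverse)
  ultimately show ?thesis unfolding psi_def by linarith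
qed

lemma Psi_at_pi_mult: "Psi (of_nat m * pi) = - 1 / (4 * (of_nat m * pi)\<^sup>2)"
proof -
  have "sin (2 * (real m * pi)) = 0" "cos (2 * (real m * pi)) = 1"
    using sin_npi[of "2*m"] cos_npi[of "2*m"] by (simp_all add: mult.assoc)
  then show ?thesis unfolding Psi_def by (simp add: field_simps)
qed

lemma Psi_at_top: "(Psi \<longlongrightarrow> 0) at_top"
proof -
  have "\<forall>\<^sub>F x in at_top. norm (Psi x) \<le> 1/4 * inverse x ^ 3 + 3/4 * inverse x ^ 4 + inverse x ^ 2 / 4"
    using eventually_gt_at_top[of 0]
  proof eventually_elim
    case (elim x)
    have "\<bar>- sin (2 * x) * inverse x ^ 3 / 4\<bar> \<le> 1/4 * inverse x ^ 3"
      using elim abs_sin_le_one[of "2*x"] by (simp add: abs_mult mult_left_le_one_le)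
    moreover have "\<bar>3/8 * (cos (2 * x) - 1) * inverse x ^ 4\<bar> \<le> 3/4 * inverse x ^ 4"
      using elim cos_ge_minus_one[of "2*x"] cos_le_one[of "2*x"] unfolding abs_mult
      by (intro mult_mono) (auto simp del: cos_ge_minus_one cos_le_one)
    moreover have "\<bar>inverse x ^ 2 / 4\<bar> = inverse x ^ 2 / 4" by simp
    ultimately show ?case unfolding Psi_def real_norm_def by linarith
  qed
  then show ?thesis
    by (rule Lim_null_comparison) real_asymp
qed

text \<open>Serves the region beyond pi for exponents from 3 on, and the region beyond 3 pi for the
  exponent 3 itself.\<close>

lemma nn_integral_sin_sq_Ici:
  assumes "0 < m"
  shows "(\<integral>\<^sup>+x. ennreal ((sin x)\<^sup>2 / x^3) * indicator {real m * pi..} x \<partial>lborel) \<le> ennreal (1 / (4 * (real m * pi)\<^sup>2))"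
proof -
  have p: "0 < real m * pi" using assms by simp
  have "(\<integral>\<^sup>+x. ennreal ((sin x)\<^sup>2 / x^3) * indicator {real m * pi..} x \<partial>lborel)
      \<le> (\<integral>\<^sup>+x. ennreal (psi x) * indicator {real m * pi..} x \<partial>lborel)"
    using p by (intro nn_integral_mono) (auto split: split_indicator intro!: ennreal_leI psi_ge)
  also have "\<dots> = ennreal (0 - Psi (real m * pi))"
  proof (rule nn_integral_FTC_atLeast)
    show "psi \<in> borel_measurable borel" unfolding psi_def[abs_def] by measurable
    show "\<And>x. real m * pi \<le> x \<Longrightarrow> (Psi has_real_derivative psi x) (at x)"
      using p by (intro DERIV_Psi) linarith
    show "0 \<le> psi x" if "real m * pi \<le> x" for x
    proof -
      have "0 < x" using p that by linarith
      then show ?thesis using psi_ge[of x] by (intro order_trans[OF _ psi_ge]) auto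
    qed
  qed (fact Psi_at_top)
  finally show ?thesis unfolding Psi_at_pi_mult by simp
qed

lemma nn_integral_sin_sq_Icc:
  assumes "0 < m" "m \<le> n"
  shows "(\<integral>\<^sup>+x. ennreal ((sin x)\<^sup>2 / x^3) * indicator {real m * pi..real n * pi} x \<partial>lborel)
    \<le> ennreal (1 / (4 * (real m * pi)\<^sup>2) - 1 / (4 * (real n * pi)\<^sup>2))"
proof -
  have p: "0 < real m * pi" and mn: "real m * pi \<le> real n * pi" using assms by simp_all
  have "(\<integral>\<^sup>+x. ennreal ((sin x)\<^sup>2 / x^3) * indicator {real m * pi..real n * pi} x \<partial>lborel)
      \<le> (\<integral>\<^sup>+x. ennreal (psi x) * indicator {real m * pi..real n * pi} x \<partial>lborel)"
    using p by (intro nn_integral_mono) (auto split: split_indicator intro!: ennreal_leI psi_ge)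
  also have "\<dots> = ennreal (Psi (real n * pi) - Psi (real m * pi))"
  proof (rule nn_integral_FTC_Icc)
    show "psi \<in> borel_measurable borel" unfolding psi_def[abs_def] by measurable
    show "(Psi has_real_derivative psi x) (at x)" if "x \<in> {real m * pi..real n * pi}" for x
      using p that by (intro DERIV_Psi) auto
    show "0 \<le> psi x" if "x \<in> {real m * pi..real n * pi}" for x
    proof -
      have "0 < x" using p that by auto
      then show ?thesis using psi_ge[of x] by (intro order_trans[OF _ psi_ge]) auto
    qed
  qed (use mn in auto)
  finally show ?thesis unfolding Psi_at_pi_mult by simp
qed

section \<open>Numerical bounds and elementary inequalities\<close>

lemma ennreal_two_plus: "0 \<le> a \<Longrightarrow> 0 \<le> b \<Longrightarrow> 2 * (ennreal a + ennreal b) = ennreal (2 * (a + b))"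
  by (simp add: ennreal_mult')

lemma ennreal_mult_plus:
  "0 \<le> a \<Longrightarrow> 0 \<le> b \<Longrightarrow> 0 \<le> c \<Longrightarrow> 0 \<le> d \<Longrightarrow> ennreal a * ennreal b + ennreal c * ennreal d = ennreal (a * b + c * d)"
  by (simp add: ennreal_mult)

text \<open>Machin's formula with two terms of the arctangent series at 1/5 and one at 1/239. The
  numerical estimates below use \<open>pi\<close> only from below.\<close>

lemma pi_lower_bound: "313/100 \<le> pi"
proof -
  have "(1/5::real) - (1/5)^3/3 \<le> arctan (1/5)"
  proof -
    have "arctan 0 - (0 - 0^3/3) \<le> arctan (1/5) - (1/5 - (1/5)^3/3 :: real)"
    proof (rule DERIV_nonneg_imp_nondecreasing[of 0 "1/5" "\<lambda>x. arctan x - (x - x^3/3)"])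
      fix x :: real
      have "1 - x\<^sup>2 \<le> inverse (1 + x\<^sup>2)"
      proof -
        have "(1 - x\<^sup>2) * (1 + x\<^sup>2) \<le> 1" by (simp add: algebra_simps)
        moreover have "0 < 1 + x\<^sup>2" by (simp add: add_pos_nonneg)
        ultimately show ?thesis by (simp add: field_simps)
      qed
      then show "\<exists>y. ((\<lambda>x. arctan x - (x - x^3/3)) has_real_derivative y) (at x) \<and> 0 \<le> y"
        by (intro exI[of _ "inverse (1 + x\<^sup>2) - (1 - x\<^sup>2)"]) (auto intro!: derivative_eq_intros)
    qed simp
    then show ?thesis by simp
  qed
  moreover have "arctan (1/239) \<le> 1/239" by (rule arctan_le_self) simp
  ultimately show ?thesis using machin by (simp add: power3_eq_cube)
qed

text \<open>The weighted mean inequality for x and 1. It is the pointwise substitute for Hoelder's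
  inequality between the exponents 2 and 3.\<close>

lemma powr_minus_bernoulli:
  fixes x a :: real
  assumes "0 \<le> x" "0 \<le> a" "a \<le> 1"
  shows "x powr a \<le> (1 - a) + a * x"
  using Youngs_inequality_0[of a "1 - a" x 1] assms by (cases "x = 0") auto

text \<open>Where the sine is negative the cube differs from its absolute value. The first negative
  arch is kept separate, and everything beyond 3 pi is covered by one half-line, whose tail bound is
  already small enough.\<close>

lemma sin_neg_location:
  assumes "0 < x" "sin x < 0"
  shows "x \<in> {pi..2 * pi} \<or> 3 * pi \<le> x"
proof (rule ccontr)
  assume n: "\<not> ?thesis"
  then have "x < pi \<or> (2 * pi < x \<and> x < 3 * pi)" by auto
  then show False
  proof
    assume "x < pi" then show False using sin_gt_zero[of x] assms by simp
  next
    assume "2 * pi < x \<and> x < 3 * pi"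
    then have "0 < sin (x - 2 * pi)" by (intro sin_gt_zero) auto
    then show False using assms by (simp add: sin_diff)
  qed
qed

text \<open>The constant 0.7785 lies between 3/4 + 31 / (36 * 3.13^3), about 0.7781, and exp (-1/4),
  about 0.7788.\<close>

lemma exp_minus_quarter_ge: "7785/10000 \<le> exp (-1/4 :: real)"
proof -
  have "exp (1/4::real) ^ 4 = exp 1"
    by (simp flip: exp_of_nat_mult)
  also have "\<dots> < 272/100" by (rule e_less_272)
  also have "272/100 < (10000/7785::real) ^ 4" by (simp add: power_divide)
  finally have "exp (1/4::real) < 10000/7785"
    by (rule power_less_imp_less_base) simp
  then show ?thesis by (simp add: exp_minus field_simps)
qed

section \<open>Exponents between 2 and 3\<close>

lemma nn_integral_sinc_sq:
  "(\<integral>\<^sup>+x. ennreal ((sin x / x)\<^sup>2) * indicator {0<..} x \<partial>lborel) = ennreal (pi / 2)"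
proof -
  have "(\<integral>\<^sup>+x. ennreal (indicator {0<..} x *\<^sub>R (sin x / x)\<^sup>2) \<partial>lborel) = ennreal (LBINT x:{0<..}. (sin x / x)\<^sup>2)"
    unfolding set_lebesgue_integral_def
    using sinc_sq_Ioi(1) by (intro nn_integral_eq_integral) (auto simp: set_integrable_def)
  then show ?thesis unfolding sinc_sq_Ioi(2)
    by (simp add: indicator_mult_ennreal mult.commute)
qed

text \<open>Ball's own bound at exponent 3 would be too weak: ln (sqrt (2 / p)) is convex in p, so
  the logarithmic chord from 2 to 3 has to stay below the tangent at 2. This asks for exp (-1/4),
  which is less than sqrt (2/3). The exact integral of the signed cube is corrected by twice its
  negative part.\<close>

lemma nn_integral_abs_sinc_cube:
  "(\<integral>\<^sup>+x. ennreal (\<bar>sin x / x\<bar> ^ 3) * indicator {0<..} x \<partial>lborel) \<le> ennreal (pi / 2 * exp (-1/4))"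
proof -
  define E where "E x = \<bar>sin x / x\<bar> ^ 3 - (sin x / x) ^ 3" for x :: real
  have E0: "0 \<le> E x" for x
    unfolding E_def using abs_ge_self[of "(sin x / x)^3"] by (simp add: power_abs del: abs_divide)
  have I3: "set_integrable lborel {0<..} (\<lambda>x::real. \<bar>sin x / x\<bar> ^ 3)"
    using set_integrable_abs[OF sinc_cube_Ioi(1)] by (simp add: power_abs del: abs_divide power_divide)
  have IE: "set_integrable lborel {0<..} E"
    unfolding E_def[abs_def] using I3 sinc_cube_Ioi(1) by (rule set_integral_diff)
  let ?g = "\<lambda>x. ennreal ((sin x)\<^sup>2 / x^3)"
  \<comment> \<open>The tail bounds for the arch between pi and 2 pi and for the half-line beyond 3
    pi.\<close>
  let ?b = "3 / (16 * pi\<^sup>2) + 1 / (36 * pi\<^sup>2)"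
  let ?s = "\<lambda>x. ?g x * indicator {real 1 * pi..real 2 * pi} x + ?g x * indicator {real 3 * pi..} x"
  let ?e = "LBINT x:{0<..}. E x" and ?c = "LBINT x:{0<..}. \<bar>sin x / x\<bar> ^ 3"
  have Ele: "ennreal (indicator {0<..} x *\<^sub>R E x)
      \<le> 2 * ?s x" for x
  proof (cases "0 < x \<and> sin x < 0")
    case True
    then have x: "0 < x" and s: "sin x < 0" by auto
    have "E x = 2 * (\<bar>sin x\<bar>^3 / x^3)"
      using x s by (simp add: E_def power_divide power3_eq_cube)
    \<comment> \<open>One factor of the sine is given away to reach the integrand that
      \<open>psi\<close> dominates.\<close>
    also have "\<dots> \<le> 2 * ((sin x)\<^sup>2 / x^3)"
      using x power_decreasing[of 2 3 "\<bar>sin x\<bar>"] by (intro mult_left_mono divide_right_mono) auto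
    finally have "ennreal (E x) \<le> ennreal (2 * ((sin x)\<^sup>2 / x^3))" by (rule ennreal_leI)
    also have "\<dots> = 2 * ?g x" using x by (subst ennreal_mult) auto
    also have "\<dots> \<le> 2 * ?s x"
      using sin_neg_location[OF x s] by (intro mult_left_mono) (auto simp: indicator_def)
    finally show ?thesis using x by simp
  next
    case False
    then have "indicator {0<..} x *\<^sub>R E x = 0"
      by (auto simp: indicator_def E_def)
    then show ?thesis by (simp only: ennreal_0 zero_le)
  qed
  have "ennreal ?e = (\<integral>\<^sup>+x. ennreal (indicator {0<..} x *\<^sub>R E x) \<partial>lborel)"
    unfolding set_lebesgue_integral_def using IE E0
    by (intro nn_integral_eq_integral[symmetric]) (auto simp: set_integrable_def)
  also have "\<dots> \<le> (\<integral>\<^sup>+x. 2 * ?s x \<partial>lborel)"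
    by (intro nn_integral_mono Ele)
  also have "\<dots> = 2 * ((\<integral>\<^sup>+x. ?g x * indicator {real 1 * pi..real 2 * pi} x \<partial>lborel) + (\<integral>\<^sup>+x. ?g x * indicator {real 3 * pi..} x \<partial>lborel))"
    by (subst nn_integral_cmult, measurable) (subst nn_integral_add, measurable)
  also have "\<dots> \<le> 2 * (ennreal (1 / (4 * (real 1 * pi)\<^sup>2) - 1 / (4 * (real 2 * pi)\<^sup>2)) + ennreal (1 / (4 * (real 3 * pi)\<^sup>2)))"
    by (intro mult_left_mono add_mono nn_integral_sin_sq_Icc nn_integral_sin_sq_Ici) auto
  also have "\<dots> = 2 * (ennreal (3 / (16 * pi\<^sup>2)) + ennreal (1 / (36 * pi\<^sup>2)))"
    by (simp add: power_mult_distrib field_simps)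
  also have "\<dots> = ennreal (2 * ?b)"
    by (rule ennreal_two_plus) auto
  finally have "?e \<le> 2 * ?b"
    by (subst (asm) ennreal_le_iff) auto
  moreover have "?c = ?e + (LBINT x:{0<..}. (sin x / x) ^ 3)"
    unfolding E_def[abs_def] using I3 sinc_cube_Ioi(1) by (subst set_integral_diff(2)) auto
  ultimately have "?c \<le> 2 * ?b + 3 * pi / 8"
    unfolding sinc_cube_Ioi(2) by simp
  also have "\<dots> \<le> pi / 2 * exp (-1/4)"
  proof -
    have p3: "(313/100)^3 \<le> pi^3" using pi_lower_bound by (intro power_mono) auto
    have "2 * ?b + 3 * pi / 8 = pi / 2 * (3/4 + (31/36) / pi^3)"
      by (simp add: field_simps eval_nat_numeral)
    also have "\<dots> \<le> pi / 2 * (7785/10000)"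
      using p3 by (intro mult_left_mono) (auto simp: field_simps eval_nat_numeral)
    also have "\<dots> \<le> pi / 2 * exp (-1/4)"
      by (intro mult_left_mono exp_minus_quarter_ge) auto
    finally show ?thesis .
  qed
  finally have "ennreal ?c \<le> ennreal (pi / 2 * exp (-1/4))"
    by (rule ennreal_leI)
  moreover have "(\<integral>\<^sup>+x. ennreal (indicator {0<..} x *\<^sub>R \<bar>sin x / x\<bar> ^ 3) \<partial>lborel) = ennreal ?c"
    unfolding set_lebesgue_integral_def
    using I3 by (intro nn_integral_eq_integral) (auto simp: set_integrable_def)
  ultimately show ?thesis
    by (simp add: indicator_mult_ennreal mult.commute)
qed

lemma nn_integral_sinc_powr_small:
  assumes p: "2 \<le> p" "p \<le> 3"
  shows "(\<integral>\<^sup>+x. ennreal (\<bar>sin x / x\<bar> powr p) * indicator {0<..} x \<partial>lborel) \<le> ennreal (pi / 2 * sqrt (2 / p))"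
proof -
  define \<alpha> where "\<alpha> = exp (-1/4 :: real)"
  have a: "0 < \<alpha>" by (simp add: \<alpha>_def)
  \<comment> \<open>Scaling by \<alpha> before linearising balances the two integrals, bounded by pi
    / 2 and pi / 2 * \<alpha>. The weights 3 - p and p - 2 then combine to exactly pi / 2 * \<alpha>
    powr (p - 2).\<close>
  have pt: "ennreal (\<bar>y\<bar> powr p) \<le> ennreal (\<alpha> powr (p - 2) * (3 - p)) * ennreal (y\<^sup>2)
      + ennreal (\<alpha> powr (p - 2) * (p - 2) / \<alpha>) * ennreal (\<bar>y\<bar> ^ 3)" for y :: real
  proof -
    have "\<bar>y\<bar> powr p = y\<^sup>2 * \<bar>y\<bar> powr (p - 2)"
    proof (cases "y = 0")
      case False
      have "\<bar>y\<bar> powr p = \<bar>y\<bar> powr (2 + (p - 2))" by simp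
      also have "\<dots> = \<bar>y\<bar> powr 2 * \<bar>y\<bar> powr (p - 2)" by (rule powr_add)
      finally show ?thesis using False by simp
    qed simp
    also have "\<bar>y\<bar> powr (p - 2) = \<alpha> powr (p - 2) * (\<bar>y\<bar> / \<alpha>) powr (p - 2)"
      using a by (simp add: powr_divide)
    also have "y\<^sup>2 * (\<alpha> powr (p - 2) * (\<bar>y\<bar> / \<alpha>) powr (p - 2))
        \<le> y\<^sup>2 * (\<alpha> powr (p - 2) * ((1 - (p - 2)) + (p - 2) * (\<bar>y\<bar> / \<alpha>)))"
      using a p by (intro mult_left_mono powr_minus_bernoulli) auto
    also have "\<dots> = \<alpha> powr (p - 2) * (3 - p) * y\<^sup>2 + \<alpha> powr (p - 2) * (p - 2) / \<alpha> * \<bar>y\<bar> ^ 3"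
      by (simp add: field_simps power3_eq_cube power2_eq_square)
    finally have "ennreal (\<bar>y\<bar> powr p) \<le> ennreal (\<alpha> powr (p - 2) * (3 - p) * y\<^sup>2 + \<alpha> powr (p - 2) * (p - 2) / \<alpha> * \<bar>y\<bar> ^ 3)"
      by (rule ennreal_leI)
    also have "\<dots> = ennreal (\<alpha> powr (p - 2) * (3 - p)) * ennreal (y\<^sup>2)
      + ennreal (\<alpha> powr (p - 2) * (p - 2) / \<alpha>) * ennreal (\<bar>y\<bar> ^ 3)"
      using a p by (subst (1 2) ennreal_mult[symmetric]) auto
    finally show ?thesis .
  qed
  have "(\<integral>\<^sup>+x. ennreal (\<bar>sin x / x\<bar> powr p) * indicator {0<..} x \<partial>lborel)
    \<le> (\<integral>\<^sup>+x. ennreal (\<alpha> powr (p - 2) * (3 - p)) * (ennreal ((sin x / x)\<^sup>2) * indicator {0<..} x)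
      + ennreal (\<alpha> powr (p - 2) * (p - 2) / \<alpha>) * (ennreal (\<bar>sin x / x\<bar> ^ 3) * indicator {0<..} x) \<partial>lborel)"
    by (intro nn_integral_mono) (auto simp: indicator_def intro!: pt simp del: abs_divide power_divide)
  also have "\<dots> = ennreal (\<alpha> powr (p - 2) * (3 - p)) * (\<integral>\<^sup>+x. ennreal ((sin x / x)\<^sup>2) * indicator {0<..} x \<partial>lborel)
      + ennreal (\<alpha> powr (p - 2) * (p - 2) / \<alpha>) * (\<integral>\<^sup>+x. ennreal (\<bar>sin x / x\<bar> ^ 3) * indicator {0<..} x \<partial>lborel)"
    by (simp add: nn_integral_add nn_integral_cmult del: abs_divide power_divide)
  also have "\<dots> \<le> ennreal (\<alpha> powr (p - 2) * (3 - p)) * ennreal (pi / 2)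
      + ennreal (\<alpha> powr (p - 2) * (p - 2) / \<alpha>) * ennreal (pi / 2 * \<alpha>)"
    unfolding \<alpha>_def nn_integral_sinc_sq by (intro add_mono mult_left_mono nn_integral_abs_sinc_cube order_refl) auto
  also have "\<dots> = ennreal (\<alpha> powr (p - 2) * (3 - p) * (pi / 2) + \<alpha> powr (p - 2) * (p - 2) / \<alpha> * (pi / 2 * \<alpha>))"
    using a p by (intro ennreal_mult_plus) auto
  also have "\<alpha> powr (p - 2) * (3 - p) * (pi / 2) + \<alpha> powr (p - 2) * (p - 2) / \<alpha> * (pi / 2 * \<alpha>) = pi / 2 * \<alpha> powr (p - 2)"
    using a by (simp add: field_simps)
  also have "\<alpha> powr (p - 2) \<le> sqrt (2 / p)"
  proof -
    have "ln (p / 2) \<le> p / 2 - 1" using p by (intro ln_le_minus_one) auto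
    moreover have "ln (sqrt (2 / p)) = - ln (p / 2) / 2"
      using p by (simp add: ln_sqrt ln_div)
    moreover have "ln (\<alpha> powr (p - 2)) = - (p - 2) / 4" by (simp add: ln_powr \<alpha>_def field_simps)
    ultimately have "ln (\<alpha> powr (p - 2)) \<le> ln (sqrt (2 / p))" by simp
    then show ?thesis using a p by (subst (asm) ln_le_cancel_iff) auto
  qed
  finally show ?thesis by (simp add: ennreal_leI mult_left_mono)
qed

section \<open>Exponents from 3 on\<close>

lemma sinc_le_gauss:
  fixes x :: real
  assumes "0 < x" "x \<le> pi"
  shows "sin x / x \<le> exp (- x\<^sup>2 / 6)"
proof -
  have 1: "0 \<le> sin t - t * cos t" if "0 \<le> t" "t \<le> pi" for t :: real
  proof -
    have "sin 0 - 0 * cos 0 \<le> sin t - t * cos t"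
    proof (rule DERIV_nonneg_imp_nondecreasing[of 0 t "\<lambda>t. sin t - t * cos t"])
      fix s assume s: "0 \<le> s" "s \<le> t"
      then have "0 \<le> s * sin s" using that by (intro mult_nonneg_nonneg sin_ge_zero) auto
      then show "\<exists>y. ((\<lambda>t. sin t - t * cos t) has_real_derivative y) (at s) \<and> 0 \<le> y"
        by (intro exI[of _ "s * sin s"]) (auto intro!: derivative_eq_intros)
    qed (use that in auto)
    then show ?thesis by simp
  qed
  have 2: "t * cos t - sin t \<le> - (t\<^sup>2 * sin t / 3)" if "0 \<le> t" "t \<le> pi" for t :: real
  proof -
    have "sin 0 - 0 * cos 0 - 0\<^sup>2 * sin 0 / 3 \<le> sin t - t * cos t - t\<^sup>2 * sin t / 3"
    proof (rule DERIV_nonneg_imp_nondecreasing[of 0 t "\<lambda>t. sin t - t * cos t - t\<^sup>2 * sin t / 3"])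
      fix s assume s: "0 \<le> s" "s \<le> t"
      then have "0 \<le> s / 3 * (sin s - s * cos s)" using that by (intro mult_nonneg_nonneg 1) auto
      moreover have "((\<lambda>t. sin t - t * cos t - t\<^sup>2 * sin t / 3) has_real_derivative s / 3 * (sin s - s * cos s)) (at s)"
        by (auto intro!: derivative_eq_intros simp: field_simps power2_eq_square)
      ultimately show "\<exists>y. ((\<lambda>t. sin t - t * cos t - t\<^sup>2 * sin t / 3) has_real_derivative y) (at s) \<and> 0 \<le> y"
        by blast
    qed (use that in auto)
    then show ?thesis by simp
  qed
  \<comment> \<open>This product has the value 1 at 0 and decreases up to pi by the preceding
    inequality. The constant 1/6 is the quadratic Taylor coefficient of sinc up to sign, so no
    narrower Gaussian would do near 0.\<close>
  let ?h = "\<lambda>t::real. sinc t * exp (t\<^sup>2 / 6)"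
  have "?h x \<le> ?h 0"
  proof (rule DERIV_nonpos_imp_decreasing_open[of 0 x ?h])
    fix t :: real assume t: "0 < t" "t < x"
    let ?d = "exp (t\<^sup>2 / 6) * ((t * cos t - sin t) + t\<^sup>2 * sin t / 3) / t\<^sup>2"
    have "((\<lambda>t. sin t / t * exp (t\<^sup>2 / 6)) has_real_derivative ?d) (at t)"
      using t by (auto intro!: derivative_eq_intros simp: field_simps power2_eq_square)
    then have "(?h has_real_derivative ?d) (at t)"
      by (rule DERIV_cong_ev[THEN iffD1, rotated -1])
         (use t eventually_nhds_in_open[of "{0<..}" t] in \<open>auto elim!: eventually_mono\<close>)
    moreover have "?d \<le> 0"
      using 2[of t] t assms by (intro divide_nonpos_nonneg mult_nonneg_nonpos) auto
    ultimately show "\<exists>y. (?h has_real_derivative y) (at t) \<and> y \<le> 0" by blast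
  next
    show "continuous_on {0..x} ?h" by (intro continuous_intros) auto
  qed (use assms in auto)
  then have "sin x / x * exp (x\<^sup>2 / 6) \<le> 1" using assms by simp
  then have "sin x / x \<le> inverse (exp (x\<^sup>2 / 6))"
    by (simp add: field_simps del: divide_le_eq_1_pos)
  then show ?thesis by (simp add: exp_minus)
qed

lemma nn_integral_gauss_Ici:
  assumes "0 < (b::real)"
  shows "(\<integral>\<^sup>+x. ennreal (exp (- b * x\<^sup>2)) * indicator {0..} x \<partial>lborel) = ennreal (sqrt (pi / b) / 2)"
proof -
  have "(\<integral>\<^sup>+x. ennreal (exp (- x\<^sup>2)) * indicator {0..} x \<partial>lborel) = ennreal (sqrt pi / 2)"
  proof -
    note g = has_bochner_integral_iff[THEN iffD1, OF gaussian_moment_0]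
    have "(\<integral>\<^sup>+x. ennreal (indicator {0..} x *\<^sub>R exp (- x\<^sup>2)) \<partial>lborel) = ennreal (sqrt pi / 2)"
      unfolding g[THEN conjunct2, symmetric] by (rule nn_integral_eq_integral) (use g in auto)
    then show ?thesis by (simp add: indicator_mult_ennreal mult.commute)
  qed
  also have "(\<integral>\<^sup>+x. ennreal (exp (- x\<^sup>2)) * indicator {0..} x \<partial>lborel)
    = ennreal (sqrt b) * (\<integral>\<^sup>+x. ennreal (exp (- b * x\<^sup>2)) * indicator {0..} x \<partial>lborel)"
    using assms by (subst nn_integral_real_affine[where c="sqrt b" and t=0])
      (auto simp: power_mult_distrib indicator_def zero_le_mult_iff intro!: arg_cong[where f="\<lambda>x. _ * x"] nn_integral_cong)
  finally have "ennreal (sqrt b) * (\<integral>\<^sup>+x. ennreal (exp (- b * x\<^sup>2)) * indicator {0..} x \<partial>lborel) = ennreal (sqrt pi / 2)" .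
  then have "ennreal (1 / sqrt b) * (ennreal (sqrt b) * (\<integral>\<^sup>+x. ennreal (exp (- b * x\<^sup>2)) * indicator {0..} x \<partial>lborel))
     = ennreal (1 / sqrt b) * ennreal (sqrt pi / 2)" by simp
  then show ?thesis
    using assms by (simp add: mult.assoc[symmetric] real_sqrt_divide flip: ennreal_mult')
qed

lemma nn_integral_sinc_powr_large:
  assumes p: "3 \<le> p"
  shows "(\<integral>\<^sup>+x. ennreal (\<bar>sin x / x\<bar> powr p) * indicator {0<..} x \<partial>lborel) \<le> ennreal (pi / 2 * sqrt (2 / p))"
proof -
  let ?K = "pi powr (3 - p)"
  \<comment> \<open>Beyond pi the quotient is at most 1 / pi in absolute value, so the power p - 3
    of it gives pi powr (3 - p), and the remaining third power is at most sin^2 / x^3.\<close>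
  have pt: "ennreal (\<bar>sin x / x\<bar> powr p) * indicator {0<..} x
     \<le> ennreal (exp (- (p / 6) * x\<^sup>2)) * indicator {0..} x
      + ennreal ?K * (ennreal ((sin x)\<^sup>2 / x^3) * indicator {real 1 * pi..} x)" for x
  proof -
    consider "x \<le> 0" | "0 < x" "x < pi" | "pi \<le> x" by linarith
    then show ?thesis
    proof cases
      case 2
      have "\<bar>sin x / x\<bar> powr p \<le> exp (- x\<^sup>2 / 6) powr p"
        using 2 p sinc_le_gauss[of x] sin_ge_zero[of x] by (intro powr_mono2) auto
      also have "\<dots> = exp (- (p / 6) * x\<^sup>2)" by (simp add: powr_def)
      finally show ?thesis using 2 by (simp add: ennreal_leI)
    next
      case 3
      have x: "0 < x" using 3 pi_gt_zero by linarith
      have "\<bar>sin x / x\<bar> powr p = \<bar>sin x / x\<bar> powr (3 + (p - 3))" by simp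
      also have "\<dots> = \<bar>sin x / x\<bar> powr 3 * \<bar>sin x / x\<bar> powr (p - 3)" by (rule powr_add)
      also have "\<dots> \<le> (\<bar>sin x\<bar>^2 / x ^ 3) * (1 / pi) powr (p - 3)"
      proof (rule mult_mono)
        have "\<bar>sin x / x\<bar> powr 3 = \<bar>sin x\<bar> ^ 3 / x ^ 3"
          using x by (cases "sin x = 0") (simp_all add: power_divide)
        also have "\<dots> \<le> \<bar>sin x\<bar>^2 / x ^ 3"
          using x by (intro divide_right_mono power_decreasing) auto
        finally show "\<bar>sin x / x\<bar> powr 3 \<le> \<bar>sin x\<bar>^2 / x ^ 3" .
        have "\<bar>sin x\<bar> / x \<le> 1 / pi" using 3 x by (intro frac_le) auto
        then show "\<bar>sin x / x\<bar> powr (p - 3) \<le> (1 / pi) powr (p - 3)"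
          using p x by (intro powr_mono2) auto
      qed (use x in auto)
      also have "(1 / pi) powr (p - 3) = ?K"
        by (simp add: powr_divide powr_minus_divide[symmetric])
      finally have "ennreal (\<bar>sin x / x\<bar> powr p) \<le> ennreal (?K * ((sin x)\<^sup>2 / x^3))"
        by (simp add: mult.commute ennreal_leI)
      also have "\<dots> = ennreal ?K * ennreal ((sin x)\<^sup>2 / x^3)" by (rule ennreal_mult') simp
      finally show ?thesis using 3 x by (simp add: add_increasing)
    qed simp
  qed
  have "(\<integral>\<^sup>+x. ennreal (\<bar>sin x / x\<bar> powr p) * indicator {0<..} x \<partial>lborel)
    \<le> (\<integral>\<^sup>+x. ennreal (exp (- (p / 6) * x\<^sup>2)) * indicator {0..} x
      + ennreal ?K * (ennreal ((sin x)\<^sup>2 / x^3) * indicator {real 1 * pi..} x) \<partial>lborel)"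
    by (intro nn_integral_mono pt)
  also have "\<dots> = (\<integral>\<^sup>+x. ennreal (exp (- (p / 6) * x\<^sup>2)) * indicator {0..} x \<partial>lborel)
      + ennreal ?K * (\<integral>\<^sup>+x. ennreal ((sin x)\<^sup>2 / x^3) * indicator {real 1 * pi..} x \<partial>lborel)"
    by (subst nn_integral_add, measurable) (subst nn_integral_cmult, measurable)
  also have "\<dots> \<le> ennreal (sqrt (pi / (p / 6)) / 2) + ennreal ?K * ennreal (1 / (4 * (real 1 * pi)\<^sup>2))"
    using p by (intro add_mono mult_left_mono nn_integral_sin_sq_Ici) (simp_all only: nn_integral_gauss_Ici, auto)
  also have "\<dots> = ennreal (sqrt (pi / (p / 6)) / 2 + ?K * (1 / (4 * pi\<^sup>2)))"
    using p by (simp flip: ennreal_mult ennreal_plus)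
  also have "\<dots> \<le> ennreal (pi / 2 * sqrt (2 / p))"
  proof (rule ennreal_leI)
    \<comment> \<open>Relative to pi / 2 / sqrt p the tail term is proportional to this product,
      which decreases in p; the exponent 3 is the worst case.\<close>
    have "sqrt p * ?K \<le> sqrt 3"
    proof -
      have "ln (p / 3) \<le> p / 3 - 1" using p by (intro ln_le_minus_one) auto
      moreover have "ln (sqrt p * ?K) = ln p / 2 + (3 - p) * ln pi"
        using p by (simp add: ln_mult ln_sqrt ln_powr)
      moreover have "1 \<le> ln pi"
        using exp_le pi_lower_bound by (subst ln_ge_iff) auto
      then have "(3 - p) * ln pi \<le> (3 - p) * 1" using p by (intro mult_left_mono_neg) auto
      ultimately have "ln (sqrt p * ?K) \<le> ln (sqrt 3)"
        using p by (simp add: ln_sqrt ln_div)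
      then show ?thesis using p by (subst (asm) ln_le_cancel_iff) auto
    qed
    also have "sqrt 3 \<le> 1733/1000" by (rule real_le_lsqrt) (auto simp: power2_eq_square)
    finally have K: "sqrt p * ?K \<le> 1733/1000" .
    have p3: "(313/100)^3 \<le> pi^3" using pi_lower_bound by (intro power_mono) auto
    have "sqrt (6 / pi) \<le> 1385/1000"
      using pi_lower_bound by (intro real_le_lsqrt) (auto simp: power2_eq_square field_simps)
    moreover have "sqrt p * ?K / (2 * pi^3) \<le> (1733/1000) / (2 * (313/100)^3)"
      using K p3 by (intro frac_le) auto
    moreover have "14142/10000 \<le> sqrt 2" by (rule real_le_rsqrt) (auto simp: power2_eq_square)
    \<comment> \<open>The margin is thin: 1.385 + 0.0283 against 1.4142.\<close>
    ultimately have m: "sqrt (6 / pi) + sqrt p * ?K / (2 * pi^3) \<le> sqrt 2"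
      by (simp add: power3_eq_cube)
    have "sqrt (pi / (p / 6)) / 2 = pi / 2 / sqrt p * sqrt (6 / pi)"
      using p by (simp add: real_sqrt_divide real_sqrt_mult field_simps)
    moreover have "?K * (1 / (4 * pi\<^sup>2)) = pi / 2 / sqrt p * (sqrt p * ?K / (2 * pi^3))"
      using p by (simp add: field_simps eval_nat_numeral)
    ultimately have "sqrt (pi / (p / 6)) / 2 + ?K * (1 / (4 * pi\<^sup>2))
       = pi / 2 / sqrt p * (sqrt (6 / pi) + sqrt p * ?K / (2 * pi^3))"
      by (simp only: distrib_left)
    also have "\<dots> \<le> pi / 2 / sqrt p * sqrt 2" using p by (intro mult_left_mono m) auto
    also have "\<dots> = pi / 2 * sqrt (2 / p)" by (simp add: real_sqrt_divide)
    finally show "sqrt (pi / (p / 6)) / 2 + ?K * (1 / (4 * pi\<^sup>2)) \<le> pi / 2 * sqrt (2 / p)" .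
  qed
  finally show ?thesis .
qed

text \<open>The continuous extension to 0. The transport argument needs continuous densities,
  whereas the integrals over the open half-line can use the plain quotient.\<close>

definition sincr :: "real \<Rightarrow> real" where
  "sincr x = (if x = 0 then 1 else sin x / x)"

lemma isCont_sincr: "isCont sincr x"
  unfolding sincr_def[abs_def] by (rule isCont_sinc)

lemma borel_measurable_sincr [measurable]: "sincr \<in> borel_measurable borel"
  unfolding sincr_def[abs_def] by (rule borel_measurable_sinc)

theorem Ball_integral_inequality:
  assumes p: "2 \<le> p"
  shows "(\<integral>\<^sup>+x. ennreal (\<bar>sincr x\<bar> powr p) \<partial>lborel) \<le> ennreal (pi * sqrt (2 / p))"
proof -
  let ?f = "\<lambda>x::real. ennreal (\<bar>sin x / x\<bar> powr p) * indicator {0<..} x"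
  have h: "(\<integral>\<^sup>+x. ?f x \<partial>lborel) \<le> ennreal (pi / 2 * sqrt (2 / p))"
    using nn_integral_sinc_powr_small[of p] nn_integral_sinc_powr_large[of p] p by linarith
  have "(\<integral>\<^sup>+x. ennreal (\<bar>sincr x\<bar> powr p) \<partial>lborel) = (\<integral>\<^sup>+x. ?f x + ?f (- x) \<partial>lborel)"
    using AE_lborel_singleton[of 0]
    by (intro nn_integral_cong_AE) (auto elim!: eventually_mono simp: indicator_def sincr_def)
  also have "\<dots> = (\<integral>\<^sup>+x. ?f x \<partial>lborel) + (\<integral>\<^sup>+x. ?f (- x) \<partial>lborel)"
    by (rule nn_integral_add) measurable
  also have "(\<integral>\<^sup>+x. ?f (- x) \<partial>lborel) = (\<integral>\<^sup>+x. ?f x \<partial>lborel)"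
    by (subst (2) nn_integral_real_affine[where c="-1" and t=0]) auto
  also have "(\<integral>\<^sup>+x. ?f x \<partial>lborel) + (\<integral>\<^sup>+x. ?f x \<partial>lborel) \<le> ennreal (pi / 2 * sqrt (2 / p)) + ennreal (pi / 2 * sqrt (2 / p))"
    by (intro add_mono h)
  also have "\<dots> = ennreal (pi * sqrt (2 / p))"
    using p by (simp flip: ennreal_plus)
  finally show ?thesis .
qed

section \<open>A determinant inequality for Parseval frames\<close>

text \<open>A maximiser of the Rayleigh quotient on the unit sphere of \<open>S\<close> is an
  eigenvector: the first-order condition makes f x orthogonal to every vector of \<open>S\<close>
  that is orthogonal to x.\<close>

lemma selfadjoint_rayleigh_eigenvector:
  fixes f :: "'a::euclidean_space \<Rightarrow> 'a"
  assumes "linear f" and sa: "\<And>x y. f x \<bullet> y = x \<bullet> f y"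
    and S: "subspace S" "f ` S \<subseteq> S" "S \<noteq> {0}"
  obtains x l where "x \<in> S" "norm x = 1" "f x = l *\<^sub>R x"
proof -
  interpret linear f by fact
  let ?K = "S \<inter> sphere 0 1"
  have "compact ?K" using S(1) by (intro closed_Int_compact closed_subspace) auto
  moreover have "?K \<noteq> {}"
  proof -
    obtain z where z: "z \<in> S" "z \<noteq> 0" using S(3) subspace_0[OF S(1)] by auto
    have "(1 / norm z) *\<^sub>R z \<in> S" by (rule subspace_scale[OF S(1) z(1)])
    moreover have "norm ((1 / norm z) *\<^sub>R z) = 1" using z(2) by simp
    ultimately show ?thesis by auto
  qed
  moreover have "continuous_on ?K (\<lambda>x. f x \<bullet> x)"
    by (intro continuous_on_inner linear_continuous_on continuous_on_id) (simp add: linear_linear \<open>linear f\<close>)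
  ultimately have "\<exists>x\<in>?K. \<forall>y\<in>?K. f y \<bullet> y \<le> f x \<bullet> x" by (rule continuous_attains_sup)
  then obtain x where x: "x \<in> ?K" and max: "\<And>y. y \<in> ?K \<Longrightarrow> f y \<bullet> y \<le> f x \<bullet> x"
    by blast
  define l where "l = f x \<bullet> x"
  have xx: "x \<bullet> x = 1" using x by (simp add: norm_eq_1)
  have bound: "f v \<bullet> v \<le> l * (v \<bullet> v)" if "v \<in> S" for v
  proof (cases "v = 0")
    case False
    have "(1 / norm v) *\<^sub>R v \<in> ?K" using subspace_scale[OF S(1) that] False by simp
    from max[OF this] have "(f v \<bullet> v) / (norm v)\<^sup>2 \<le> l"
      by (simp add: scale l_def power2_eq_square)
    then show ?thesis using False by (simp add: divide_le_eq power2_norm_eq_inner)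
  qed (simp add: zero)
  have orth: "f x \<bullet> y = 0" if y: "y \<in> S" "x \<bullet> y = 0" for y
  proof (rule ccontr)
    define a where "a = f x \<bullet> y"
    define b where "b = l * (y \<bullet> y) - f y \<bullet> y"
    assume "f x \<bullet> y \<noteq> 0" then have a: "a \<noteq> 0" by (simp add: a_def)
    have q: "2 * s * a \<le> s\<^sup>2 * b" for s
    proof -
      have "x + s *\<^sub>R y \<in> S" using x y S(1) by (auto intro: subspace_add subspace_scale)
      from bound[OF this] have "l + 2 * s * a + s\<^sup>2 * (f y \<bullet> y) \<le> l * (1 + s\<^sup>2 * (y \<bullet> y))"
        using y xx sa[of y x]
        by (simp add: add scale inner_add_left inner_add_right l_def a_def inner_commute power2_eq_square algebra_simps)
      then show ?thesis by (simp add: b_def algebra_simps)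
    qed
    have "0 \<le> b" using q[of 1] q[of "-1"] by simp
    \<comment> \<open>A small multiple of \<open>a\<close> lets the linear term
      \<open>2 * s * a\<close> win over the quadratic one; \<open>b + 1\<close> keeps the
      denominator positive even for \<open>b = 0\<close>.\<close>
    define s where "s = a / (b + 1)"
    have "2 * s * a = 2 * a\<^sup>2 / (b + 1)" by (simp add: s_def power2_eq_square)
    moreover have "s\<^sup>2 * b \<le> a\<^sup>2 / (b + 1)"
    proof -
      have "s\<^sup>2 * b = a\<^sup>2 / (b + 1) * (b / (b + 1))" by (simp add: s_def power2_eq_square)
      also have "\<dots> \<le> a\<^sup>2 / (b + 1) * 1" using \<open>0 \<le> b\<close> by (intro mult_left_mono) auto
      finally show ?thesis by simp
    qed
    moreover have "0 < a\<^sup>2 / (b + 1)" using \<open>0 \<le> b\<close> a by simp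
    ultimately show False using q[of s] by linarith
  qed
  have "f x = l *\<^sub>R x"
  proof -
    let ?w = "f x - l *\<^sub>R x"
    have w: "?w \<in> S" using x S by (auto intro!: subspace_diff subspace_scale)
    have xw: "x \<bullet> ?w = 0" by (simp add: inner_diff_right xx l_def inner_commute)
    from orth[OF w xw] xw have "?w \<bullet> ?w = 0"
      by (simp add: inner_diff_left inner_diff_right inner_commute algebra_simps)
    then show ?thesis by simp
  qed
  then show thesis using that[of x l] x by auto
qed

text \<open>Stated for invariant subspaces because the induction passes to the orthogonal complement
  of an eigenvector inside \<open>S\<close>, which self-adjointness keeps invariant.\<close>

lemma selfadjoint_orthonormal_eigenbasis:
  fixes f :: "'a::euclidean_space \<Rightarrow> 'a"
  assumes "linear f" and sa: "\<And>x y. f x \<bullet> y = x \<bullet> f y"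
    and "subspace S" "f ` S \<subseteq> S"
  shows "\<exists>B. B \<subseteq> S \<and> pairwise orthogonal B \<and> (\<forall>b\<in>B. norm b = 1) \<and> (\<forall>b\<in>B. \<exists>l. f b = l *\<^sub>R b) \<and> span B = S"
  using assms(3,4)
proof (induction "dim S" arbitrary: S rule: less_induct)
  case less
  interpret linear f by fact
  show ?case
  proof (cases "S = {0}")
    case True
    then show ?thesis by (intro exI[of _ "{}"]) auto
  next
    case False
    obtain x l where x: "x \<in> S" "norm x = 1" "f x = l *\<^sub>R x"
      using selfadjoint_rayleigh_eigenvector[OF assms(1) sa less.prems False] by blast
    let ?S = "S \<inter> {y. x \<bullet> y = 0}"
    have S': "subspace ?S" by (intro subspace_inter less.prems subspace_hyperplane)
    have "x \<notin> ?S" using x by (auto simp: norm_eq_1)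
    then have "?S \<subset> S" using x by blast
    then have d: "dim ?S < dim S"
      using S' less.prems(1) by (metis dim_psubset span_eq_iff)
    have "f ` ?S \<subseteq> ?S"
    proof (intro image_subsetI IntI CollectI)
      fix y assume y: "y \<in> ?S"
      show "f y \<in> S" using y less.prems by auto
      show "x \<bullet> f y = 0" using y by (simp add: sa[symmetric] x)
    qed
    then obtain B where B: "B \<subseteq> ?S" "pairwise orthogonal B" "\<forall>b\<in>B. norm b = 1"
      "\<forall>b\<in>B. \<exists>l. f b = l *\<^sub>R b" "span B = ?S"
      using less.hyps[OF d S'] by blast
    have "span (insert x B) = S"
    proof
      show "span (insert x B) \<subseteq> S" using B x less.prems by (intro span_minimal) auto
      show "S \<subseteq> span (insert x B)"
      proof
        fix y assume y: "y \<in> S"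
        have "y - (x \<bullet> y) *\<^sub>R x \<in> ?S"
          using y x less.prems by (auto intro!: subspace_diff subspace_scale simp: inner_diff_right norm_eq_1)
        then have "y - (x \<bullet> y) *\<^sub>R x \<in> span (insert x B)"
          using B(5) span_mono[of B "insert x B"] by blast
        moreover have "(x \<bullet> y) *\<^sub>R x \<in> span (insert x B)" by (intro span_scale span_base) auto
        ultimately have "(y - (x \<bullet> y) *\<^sub>R x) + (x \<bullet> y) *\<^sub>R x \<in> span (insert x B)" by (rule span_add)
        then show "y \<in> span (insert x B)" by simp
      qed
    qed
    moreover have "pairwise orthogonal (insert x B)"
      using B by (auto simp: pairwise_insert orthogonal_def inner_commute)
    ultimately show ?thesis
      using B x by (intro exI[of _ "insert x B"]) auto
  qed
qed

lemma orthonormal_norm_sq: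
  fixes B :: "'a::euclidean_space set"
  assumes "pairwise orthogonal B" "\<And>b. b \<in> B \<Longrightarrow> norm b = 1" "x \<in> span B"
  shows "x = (\<Sum>b\<in>B. (x \<bullet> b) *\<^sub>R b)" and "(norm x)\<^sup>2 = (\<Sum>b\<in>B. (x \<bullet> b)\<^sup>2)"
proof -
  have fin: "finite B" using assms(1) by (rule pairwise_orthogonal_imp_finite)
  show e: "x = (\<Sum>b\<in>B. (x \<bullet> b) *\<^sub>R b)"
    using orthonormal_basis_expand[OF assms(1,2) assms(3) fin] by (simp add: inner_commute)
  have "(norm x)\<^sup>2 = x \<bullet> (\<Sum>b\<in>B. (x \<bullet> b) *\<^sub>R b)"
    using e by (simp add: power2_norm_eq_inner)
  also have "\<dots> = (\<Sum>b\<in>B. (x \<bullet> b)\<^sup>2)" by (simp add: inner_sum_right power2_eq_square)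
  finally show "(norm x)\<^sup>2 = (\<Sum>b\<in>B. (x \<bullet> b)\<^sup>2)" .
qed

lemma orthonormal_card:
  fixes B :: "'a::euclidean_space set"
  assumes "pairwise orthogonal B" "\<And>b. b \<in> B \<Longrightarrow> norm b = 1"
  shows "card B = dim (span B)"
proof -
  have "0 \<notin> B" using assms(2) by force
  then have "independent B" using assms(1) by (intro pairwise_orthogonal_independent)
  then show ?thesis by (simp add: dim_eq_card_independent)
qed

lemma det_eq_prod_eigenvalues:
  fixes f :: "real^'n \<Rightarrow> real^'n"
  assumes "linear f" "pairwise orthogonal B" "\<And>b. b \<in> B \<Longrightarrow> norm b = 1" "span B = UNIV"
    and eig: "\<And>b. b \<in> B \<Longrightarrow> f b = l b *\<^sub>R b"
  shows "det (matrix f) = (\<Prod>b\<in>B. l b)"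
proof -
  have fin: "finite B" using assms(2) by (rule pairwise_orthogonal_imp_finite)
  have "card B = CARD('n)" using orthonormal_card[OF assms(2,3)] assms(4) by simp
  then obtain e where e: "bij_betw e (UNIV :: 'n set) B"
    using fin by (metis finite_same_card_bij finite_class.finite_UNIV)
  have eB: "e j \<in> B" for j using e by (auto simp: bij_betw_def)
  define Q :: "real^'n^'n" where "Q = (\<chi> i j. e j $ i)"
  define D :: "real^'n^'n" where "D = (\<chi> i j. if i = j then l (e j) else 0)"
  \<comment> \<open>The columns of \<open>Q\<close> are the eigenvectors. Taking determinants on
    both sides and cancelling det Q avoids forming an inverse.\<close>
  have "matrix f ** Q = Q ** D"
  proof -
    have "(matrix f ** Q) $ i $ j = (Q ** D) $ i $ j" for i j
    proof -
      have "(matrix f ** Q) $ i $ j = (matrix f *v e j) $ i"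
        by (simp add: matrix_matrix_mult_def matrix_vector_mult_def Q_def)
      also have "\<dots> = l (e j) * e j $ i"
        using assms(1) eig[OF eB] by (simp add: matrix_works)
      also have "\<dots> = (Q ** D) $ i $ j"
        by (simp add: matrix_matrix_mult_def Q_def D_def if_distrib sum.delta mult.commute cong: if_cong)
      finally show ?thesis .
    qed
    then show ?thesis by (simp add: vec_eq_iff)
  qed
  then have "det (matrix f) * det Q = det Q * det D" by (metis det_mul)
  moreover have "orthogonal_matrix Q"
  proof -
    have "(transpose Q ** Q) $ i $ j = mat 1 $ i $ j" for i j
    proof -
      have "(transpose Q ** Q) $ i $ j = e i \<bullet> e j"
        by (simp add: matrix_matrix_mult_def transpose_def Q_def inner_vec_def)
      also have "\<dots> = mat 1 $ i $ j"
      proof (cases "i = j")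
        case True
        then show ?thesis using assms(3)[OF eB] by (simp add: mat_def norm_eq_1)
      next
        case False
        then have "e i \<noteq> e j" using e by (auto simp: bij_betw_def inj_on_def)
        then have "orthogonal (e i) (e j)" using eB assms(2) by (meson pairwiseD)
        then show ?thesis using False by (simp add: mat_def orthogonal_def)
      qed
      finally show ?thesis .
    qed
    then show ?thesis by (simp add: orthogonal_matrix vec_eq_iff)
  qed
  then have "det Q \<noteq> 0" using det_orthogonal_matrix[of Q] by auto
  ultimately have "det (matrix f) = det D" by simp
  also have "\<dots> = (\<Prod>i\<in>UNIV. l (e i))" by (subst det_diagonal) (auto simp: D_def)
  also have "\<dots> = (\<Prod>b\<in>B. l b)" by (rule prod.reindex_bij_betw[OF e])
  finally show ?thesis .
qed

text \<open>For an orthonormal eigenbasis, each eigenvalue is the mean of the \<open>t i\<close> with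
  weights \<open>(b \<bullet> u i)\<^sup>2\<close>, so that concavity of \<open>ln\<close> bounds it from below.\<close>

lemma det_frame_ge:
  fixes u :: "'i \<Rightarrow> real^'n"
  assumes fin: "finite I" and pars: "\<And>x. (\<Sum>i\<in>I. (x \<bullet> u i)\<^sup>2) = (norm x)\<^sup>2"
    and t: "\<And>i. i \<in> I \<Longrightarrow> 0 < t i"
  shows "(\<Prod>i\<in>I. t i powr (norm (u i))\<^sup>2) \<le> det (matrix (\<lambda>x. \<Sum>i\<in>I. (t i * (x \<bullet> u i)) *\<^sub>R u i))"
proof -
  let ?f = "\<lambda>x. \<Sum>i\<in>I. (t i * (x \<bullet> u i)) *\<^sub>R u i"
  have lin: "linear ?f"
    by (rule linearI) (simp_all add: inner_add_left algebra_simps sum.distrib scaleR_sum_right)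
  have sa: "?f x \<bullet> y = x \<bullet> ?f y" for x y
    by (simp add: inner_sum_left inner_sum_right inner_commute mult_ac)
  obtain B where B: "pairwise orthogonal B" "\<forall>b\<in>B. norm b = 1" "\<forall>b\<in>B. \<exists>l. ?f b = l *\<^sub>R b" "span B = UNIV"
    using selfadjoint_orthonormal_eigenbasis[OF lin sa subspace_UNIV] by auto
  have finB: "finite B" using B(1) by (rule pairwise_orthogonal_imp_finite)
  obtain l where l: "\<And>b. b \<in> B \<Longrightarrow> ?f b = l b *\<^sub>R b" using B(3) by metis
  have lb: "l b = (\<Sum>i\<in>I. (b \<bullet> u i)\<^sup>2 * t i)" if "b \<in> B" for b
  proof -
    have "l b = ?f b \<bullet> b" using l[OF that] B(2) that by (simp add: norm_eq_1)
    also have "\<dots> = (\<Sum>i\<in>I. (b \<bullet> u i)\<^sup>2 * t i)"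
      by (simp only: inner_sum_left) (simp add: power2_eq_square inner_commute mult_ac)
    finally show ?thesis .
  qed
  have w1: "(\<Sum>i\<in>I. (b \<bullet> u i)\<^sup>2) = 1" if "b \<in> B" for b using pars[of b] B(2) that by simp
  have lpos: "0 < l b" if "b \<in> B" for b
  proof -
    have "\<exists>i\<in>I. (b \<bullet> u i)\<^sup>2 \<noteq> 0"
    proof (rule ccontr)
      assume "\<not> ?thesis"
      then have "(\<Sum>i\<in>I. (b \<bullet> u i)\<^sup>2) = 0" by (intro sum.neutral) auto
      then show False using w1[OF that] by simp
    qed
    then obtain i where i: "i \<in> I" "(b \<bullet> u i)\<^sup>2 \<noteq> 0" by blast
    then have "0 < (b \<bullet> u i)\<^sup>2 * t i" using t[of i] by simp
    then show ?thesis unfolding lb[OF that]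
      using t fin i by (intro sum_pos2[of I i]) (auto intro!: mult_nonneg_nonneg less_imp_le[OF t])
  qed
  have ineq: "(\<Sum>i\<in>I. (b \<bullet> u i)\<^sup>2 * ln (t i)) \<le> ln (l b)" if "b \<in> B" for b
  proof -
    \<comment> \<open>Jensen's inequality through the tangent of ln at the mean \<open>l b\<close>;
      the weights sum to 1.\<close>
    have "(\<Sum>i\<in>I. (b \<bullet> u i)\<^sup>2 * ln (t i)) \<le> (\<Sum>i\<in>I. (b \<bullet> u i)\<^sup>2 * (ln (l b) + (t i / l b - 1)))"
    proof (intro sum_mono mult_left_mono)
      fix i assume "i \<in> I"
      then have "ln (t i / l b) \<le> t i / l b - 1" using t lpos[OF that] by (intro ln_le_minus_one) auto
      then show "ln (t i) \<le> ln (l b) + (t i / l b - 1)"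
        using t[OF \<open>i \<in> I\<close>] lpos[OF that] by (simp add: ln_div)
    qed simp
    also have "\<dots> = (ln (l b) - 1) * (\<Sum>i\<in>I. (b \<bullet> u i)\<^sup>2) + (\<Sum>i\<in>I. (b \<bullet> u i)\<^sup>2 * t i) / l b"
      unfolding sum_distrib_left sum_divide_distrib sum.distrib[symmetric]
      by (intro sum.cong refl) (simp add: algebra_simps)
    also have "\<dots> = ln (l b)"
      using lpos[OF that] by (simp add: w1[OF that] flip: lb[OF that])
    finally show ?thesis .
  qed
  have "ln (\<Prod>i\<in>I. t i powr (norm (u i))\<^sup>2) = (\<Sum>i\<in>I. (norm (u i))\<^sup>2 * ln (t i))"
    using t by (subst ln_prod[OF fin]) (auto simp: ln_powr dest: order_less_imp_not_eq2)
  \<comment> \<open>Expanding each exponent in the eigenbasis and exchanging the sums regroups the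
    product over the frame by eigenvalues.\<close>
  also have "\<dots> = (\<Sum>i\<in>I. (\<Sum>b\<in>B. (b \<bullet> u i)\<^sup>2) * ln (t i))"
    using orthonormal_norm_sq(2)[OF B(1)] B(2,4) by (simp add: inner_commute)
  also have "\<dots> = (\<Sum>b\<in>B. \<Sum>i\<in>I. (b \<bullet> u i)\<^sup>2 * ln (t i))"
    unfolding sum_distrib_right by (rule sum.swap)
  also have "\<dots> \<le> (\<Sum>b\<in>B. ln (l b))" by (intro sum_mono ineq)
  also have "\<dots> = ln (\<Prod>b\<in>B. l b)" using lpos by (subst ln_prod[OF finB]) (auto dest: order_less_imp_not_eq2)
  finally have le: "ln (\<Prod>i\<in>I. t i powr (norm (u i))\<^sup>2) \<le> ln (\<Prod>b\<in>B. l b)" .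
  have "0 < t i powr (norm (u i))\<^sup>2" if "i \<in> I" for i using t[OF that] by simp
  then have "0 < (\<Prod>i\<in>I. t i powr (norm (u i))\<^sup>2)" by (intro prod_pos)
  moreover have "0 < (\<Prod>b\<in>B. l b)" using lpos by (intro prod_pos)
  ultimately have "(\<Prod>i\<in>I. t i powr (norm (u i))\<^sup>2) \<le> (\<Prod>b\<in>B. l b)"
    using le by (simp only: ln_le_cancel_iff)
  also have "\<dots> = det (matrix ?f)"
    using B l by (intro det_eq_prod_eigenvalues[OF lin, symmetric]) auto
  finally show ?thesis .
qed

section \<open>The geometric Brascamp-Lieb inequality\<close>

lemma cdf_density_has_derivative:
  fixes g :: "real \<Rightarrow> real"
  assumes cont: "\<And>x. isCont g x" and nn: "\<And>x. 0 \<le> g x" and prob: "prob_space (density lborel (\<lambda>x. ennreal (g x)))"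
  shows "(cdf (density lborel (\<lambda>x. ennreal (g x))) has_real_derivative g x) (at x)"
proof -
  let ?D = "density lborel (\<lambda>x. ennreal (g x))"
  interpret prob_space ?D by fact
  interpret real_distribution ?D by unfold_locales auto
  have [measurable]: "g \<in> borel_measurable borel"
    using cont by (intro borel_measurable_continuous_onI continuous_at_imp_continuous_on) auto
  have co: "continuous_on S g" for S using cont by (intro continuous_at_imp_continuous_on) auto
  \<comment> \<open>The distribution function integrates from minus infinity. Anchoring it at
    \<open>x - 1\<close> leaves a compact interval, to which the fundamental theorem
    applies.\<close>
  have eq: "cdf ?D y = cdf ?D (x - 1) + integral {x - 1..y} g" if "x - 1 < y" for y
  proof -
    have int: "set_integrable lborel {x - 1..y} g"
      using co by (intro borel_integrable_atLeastAtMost') auto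
    have "cdf ?D y - cdf ?D (x - 1) = measure ?D {x - 1<..y}"
      using that by (rule cdf_diff_eq)
    have "emeasure ?D {x - 1<..y} = (\<integral>\<^sup>+t. ennreal (g t) * indicator {x - 1<..y} t \<partial>lborel)"
      by (rule emeasure_density) auto
    then have "emeasure ?D {x - 1<..y} = (\<integral>\<^sup>+t. ennreal (indicator {x - 1..y} t *\<^sub>R g t) \<partial>lborel)"
      using AE_lborel_singleton[of "x - 1"]
      by (auto intro!: nn_integral_cong_AE elim!: eventually_mono simp: indicator_def)
    also have "\<dots> = ennreal (LBINT t:{x - 1..y}. g t)"
      unfolding set_lebesgue_integral_def using int nn
      by (intro nn_integral_eq_integral) (auto simp: set_integrable_def)
    finally have "measure ?D {x - 1<..y} = (LBINT t:{x - 1..y}. g t)"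
      using nn by (simp add: measure_def set_lebesgue_integral_def)
    also have "\<dots> = integral {x - 1..y} g"
      using int by (rule set_borel_integral_eq_integral)
    finally show ?thesis
      using cdf_diff_eq[OF that] by simp
  qed
  have "((\<lambda>u. integral {x - 1..u} g) has_real_derivative g x) (at x within {x - 1..x + 1})"
    using co by (intro integral_has_real_derivative) auto
  moreover have "at x within {x - 1..x + 1} = at x" by (rule at_within_interior) simp
  ultimately have d: "((\<lambda>u. integral {x - 1..u} g) has_real_derivative g x) (at x)" by simp
  have d2: "((\<lambda>u. cdf ?D (x - 1) + integral {x - 1..u} g) has_real_derivative g x) (at x)"
    using DERIV_add[OF DERIV_const[of "cdf ?D (x - 1)"] d] by simp
  have ev: "\<forall>\<^sub>F u in nhds x. cdf ?D (x - 1) + integral {x - 1..u} g = cdf ?D u"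
  proof -
    have "\<forall>\<^sub>F u in nhds x. u \<in> {x - 1<..}" by (rule eventually_nhds_in_open) auto
    then show ?thesis by (rule eventually_mono) (simp add: eq)
  qed
  show ?thesis by (rule iffD1[OF DERIV_cong_ev[OF refl ev refl] d2])
qed

text \<open>The derivative may vanish, as powers of \<open>sincr\<close> do at their zeros; a
  positive value somewhere in every interval suffices.\<close>

lemma mono_DERIV_strict_mono:
  fixes F g :: "real \<Rightarrow> real"
  assumes D: "\<And>x. (F has_real_derivative g x) (at x)" and nn: "\<And>x. 0 \<le> g x"
    and pos: "\<And>a b. a < b \<Longrightarrow> \<exists>x\<in>{a<..<b}. 0 < g x"
  shows "strict_mono F"
proof (rule strict_monoI)
  have mono: "F a \<le> F b" if "a \<le> b" for a b
    using that D nn by (intro DERIV_nonneg_imp_nondecreasing[of a b F]) blast+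
  fix a b :: real assume ab: "a < b"
  then obtain x where x: "x \<in> {a<..<b}" "0 < g x" using pos by blast
  obtain d where d: "0 < d" "\<And>h. 0 < h \<Longrightarrow> h < d \<Longrightarrow> F x < F (x + h)"
    using DERIV_pos_inc_right[OF D x(2)] by blast
  define h where "h = min (d / 2) (b - x)"
  have h: "0 < h" "h < d" "x + h \<le> b" using d x by (auto simp: h_def)
  have "F a \<le> F x" using x by (intro mono) auto
  also have "F x < F (x + h)" by (rule d(2)[OF h(1,2)])
  also have "F (x + h) \<le> F b" by (rule mono[OF h(3)])
  finally show "F a < F b" .
qed

lemma std_normal_cdf:
  defines "G \<equiv> cdf std_normal_distribution"
  shows "\<And>x. (G has_real_derivative std_normal_density x) (at x)" and "strict_mono G"
    and "\<And>p. 0 < p \<Longrightarrow> p < 1 \<Longrightarrow> \<exists>x. G x = p"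
proof -
  interpret real_distribution std_normal_distribution by (rule real_dist_normal_dist)
  show D: "(G has_real_derivative std_normal_density x) (at x)" for x
    unfolding G_def
    by (intro cdf_density_has_derivative prob_space_normal_density)
       (auto simp: normal_density_def intro!: continuous_intros)
  show "strict_mono G"
  proof (rule mono_DERIV_strict_mono[OF D])
    fix a b :: real assume "a < b"
    then obtain z where "a < z" "z < b" using dense by blast
    then show "\<exists>x\<in>{a<..<b}. 0 < std_normal_density x" by (intro bexI[of _ z] normal_density_pos) auto
  qed simp
  fix p :: real assume p: "0 < p" "p < 1"
  have "\<forall>\<^sub>F x in at_bot. G x < p"
    using order_tendstoD(2)[OF cdf_lim_at_bot p(1)] unfolding G_def .
  then obtain a where a: "G a < p" by (auto simp: eventually_at_bot_linorder)
  have "\<forall>\<^sub>F x in at_top. p < G x"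
    using order_tendstoD(1)[OF cdf_lim_at_top_prob p(2)] unfolding G_def .
  then obtain b where b: "p < G b" by (auto simp: eventually_at_top_linorder)
  have "a \<le> b" using a b strict_mono_less_eq[OF \<open>strict_mono G\<close>, of b a] by linarith
  then show "\<exists>x. G x = p"
    using IVT[of G a p b] a b D by (auto intro: DERIV_isCont)
qed

text \<open>The map is the inverse of the normal distribution function \<open>G\<close> composed
  with the distribution function \<open>F\<close> of \<open>g / M\<close>; differentiating
  \<open>G (T x) = F x\<close> gives the density equation. Only T' \<ge> 0 can be expected, since
  \<open>g\<close> may have zeros.\<close>

lemma monotone_transport_to_gauss:
  fixes g :: "real \<Rightarrow> real"
  assumes cont: "\<And>x. isCont g x" and nn: "\<And>x. 0 \<le> g x"
    and M: "(\<integral>\<^sup>+x. ennreal (g x) \<partial>lborel) = ennreal M" "0 < M"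
    and pos: "\<And>a b. a < b \<Longrightarrow> \<exists>x\<in>{a<..<b}. 0 < g x"
  obtains T T' where "\<And>x. (T has_real_derivative T' x) (at x)" "\<And>x. 0 \<le> T' x" "strict_mono T"
    "\<And>x. T' x * std_normal_density (T x) = g x / M"
proof -
  define f where "f x = g x / M" for x
  let ?D = "density lborel (\<lambda>x. ennreal (f x))"
  define F where "F = cdf (?D)"
  define G where "G = cdf std_normal_distribution"
  note G = std_normal_cdf[folded G_def]
  have [measurable]: "g \<in> borel_measurable borel"
    using cont by (intro borel_measurable_continuous_onI continuous_at_imp_continuous_on) auto
  have "(\<integral>\<^sup>+x. ennreal (f x) \<partial>lborel) = (\<integral>\<^sup>+x. ennreal (1 / M) * ennreal (g x) \<partial>lborel)"
    using M(2) nn by (intro nn_integral_cong) (simp add: f_def flip: ennreal_mult)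
  also have "\<dots> = 1" using M by (subst nn_integral_cmult) (auto simp flip: ennreal_mult)
  finally have f1: "(\<integral>\<^sup>+x. ennreal (f x) \<partial>lborel) = 1" .
  have prob: "prob_space (?D)"
    by (rule prob_spaceI) (simp add: emeasure_density f_def f1[unfolded f_def])
  interpret prob_space "?D" by fact
  interpret real_distribution "?D" by unfold_locales auto
  have DF: "(F has_real_derivative f x) (at x)" for x
    unfolding F_def using cont nn M(2) prob
    by (intro cdf_density_has_derivative) (auto simp: f_def intro!: continuous_intros)
  have smF: "strict_mono F"
  proof (rule mono_DERIV_strict_mono[OF DF])
    fix a b :: real assume "a < b"
    from pos[OF this] obtain z where "z \<in> {a<..<b}" "0 < g z" by blast
    then show "\<exists>x\<in>{a<..<b}. 0 < f x" using M(2) by (intro bexI[of _ z]) (auto simp: f_def)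
  qed (use nn M(2) in \<open>simp add: f_def\<close>)
  \<comment> \<open>The inverse of \<open>G\<close> is meaningful on the open unit interval only.
    Strictness comes from comparing with a neighbouring point.\<close>
  have F01: "0 < F x" "F x < 1" for x
  proof -
    have "0 \<le> F (x - 1)" unfolding F_def by (rule cdf_nonneg)
    also have "F (x - 1) < F x" using smF by (auto simp: strict_mono_def)
    finally show "0 < F x" .
    have "F x < F (x + 1)" using smF by (auto simp: strict_mono_def)
    also have "F (x + 1) \<le> 1" unfolding F_def by (rule cdf_bounded_prob)
    finally show "F x < 1" .
  qed
  have injG: "inj G" using G(2) by (rule strict_mono_imp_inj_on)
  define H where "H = inv G"
  have HG: "H (G z) = z" for z unfolding H_def using injG by simp
  have GH: "G (H p) = p" if "0 < p" "p < 1" for p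
    using G(3)[OF that] HG by metis
  have contH: "isCont H p" if p: "0 < p" "p < 1" for p
  proof -
    have "isCont H (G (H p))"
    proof (rule isCont_inverse_function[of 1 "H p" H G])
      show "isCont G z" for z by (rule DERIV_isCont[OF G(1)])
    qed (simp_all add: HG)
    then show ?thesis using GH[OF p] by simp
  qed
  have npos: "std_normal_density z \<noteq> 0" for z using normal_density_pos[of 1 0 z] by simp
  have DH: "(H has_real_derivative inverse (std_normal_density (H p))) (at p)" if p: "0 < p" "p < 1" for p
    by (rule DERIV_inverse_function[OF G(1) _ p]) (use GH contH p npos in auto)
  define T where "T x = H (F x)" for x
  have DT: "(T has_real_derivative inverse (std_normal_density (T x)) * f x) (at x)" for x
    unfolding T_def by (rule DERIV_chain2[OF DH DF]) (fact F01)+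
  show thesis
  proof (rule that[OF DT])
    show "0 \<le> inverse (std_normal_density (T x)) * f x" for x
      using nn M(2) by (simp add: f_def)
    show "strict_mono T"
    proof (rule strict_monoI)
      fix a b :: real assume "a < b"
      then have "G (T a) < G (T b)" using smF F01 by (simp add: T_def GH strict_mono_less)
      then show "T a < T b" using G(2) by (simp add: strict_mono_less)
    qed
    show "inverse (std_normal_density (T x)) * f x * std_normal_density (T x) = g x / M" for x
      using npos[of "T x"] by (simp add: f_def)
  qed
qed

section \<open>Gaussian density, Parseval frames and change of variables\<close>

definition gauss :: "'a::euclidean_space \<Rightarrow> real" where
  "gauss z = (1 / sqrt (2 * pi)) ^ DIM('a) * exp (- (norm z)\<^sup>2 / 2)"

lemma gauss_pos: "0 < gauss z"
  unfolding gauss_def by simp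

lemma gauss_nonneg [simp]: "0 \<le> gauss z"
  using gauss_pos[of z] by simp

lemma norm_sq_Basis: "(norm z)\<^sup>2 = (\<Sum>b\<in>Basis. (z \<bullet> b)\<^sup>2)" for z :: "'a::euclidean_space"
  unfolding power2_norm_eq_inner by (subst euclidean_inner) (simp only: power2_eq_square)

lemma gauss_eq_prod: "gauss z = (\<Prod>b\<in>Basis. std_normal_density (z \<bullet> b))" for z :: "'a::euclidean_space"
  unfolding gauss_def normal_density_def norm_sq_Basis
  by (simp add: prod.distrib prod_dividef power_divide exp_sum[symmetric] sum_negf sum_divide_distrib del: exp_sum)

lemma nn_integral_gauss: "(\<integral>\<^sup>+z. ennreal (gauss z) \<partial>(lborel :: 'a::euclidean_space measure)) = 1"
proof -
  have "(\<integral>\<^sup>+z. ennreal (gauss z) \<partial>(lborel :: 'a measure))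
    = (\<integral>\<^sup>+z. (\<Prod>b\<in>Basis. ennreal (std_normal_density ((z::'a) \<bullet> b))) \<partial>lborel)"
    unfolding gauss_eq_prod by (simp add: prod_ennreal)
  also have "\<dots> = (\<Prod>b\<in>(Basis :: 'a set). (\<integral>\<^sup>+x. ennreal (std_normal_density x) \<partial>lborel))"
    by (rule nn_integral_lborel_prod) auto
  also have "(\<integral>\<^sup>+x. ennreal (std_normal_density x) \<partial>lborel) = 1"
    using prob_space.emeasure_space_1[OF prob_space_normal_density[of 1 0]] by (simp add: emeasure_density)
  finally show ?thesis by simp
qed

lemma continuous_gauss: "continuous_on S (gauss :: 'a::euclidean_space \<Rightarrow> real)"
  unfolding gauss_def[abs_def] by (intro continuous_intros) auto

text \<open>The analysis map of a Parseval frame is an isometry, so its adjoint, the synthesis map,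
  is a contraction.\<close>

lemma frame_sum_norm_le:
  fixes u :: "'i \<Rightarrow> 'a::euclidean_space"
  assumes pars: "\<And>x. (\<Sum>i\<in>I. (x \<bullet> u i)\<^sup>2) = (norm x)\<^sup>2"
  shows "(norm (\<Sum>i\<in>I. c i *\<^sub>R u i))\<^sup>2 \<le> (\<Sum>i\<in>I. (c i)\<^sup>2)"
proof -
  let ?z = "\<Sum>i\<in>I. c i *\<^sub>R u i"
  have e: "(norm ?z)\<^sup>2 = (\<Sum>i\<in>I. c i * (?z \<bullet> u i))"
    unfolding power2_norm_eq_inner by (simp only: inner_sum_right inner_scaleR_right)
  have "(\<Sum>i\<in>I. c i * (?z \<bullet> u i))\<^sup>2 \<le> (\<Sum>i\<in>I. (c i)\<^sup>2) * (\<Sum>i\<in>I. (?z \<bullet> u i)\<^sup>2)"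
    by (rule Cauchy_Schwarz_ineq_sum)
  then have le: "(norm ?z)\<^sup>2 * (norm ?z)\<^sup>2 \<le> (\<Sum>i\<in>I. (c i)\<^sup>2) * (norm ?z)\<^sup>2"
    unfolding e[symmetric] pars by (simp only: power2_eq_square)
  show ?thesis
  proof (cases "?z = 0")
    case True
    then show ?thesis by (simp add: sum_nonneg)
  next
    case False
    then have "0 < (norm ?z)\<^sup>2" by simp
    with le show ?thesis by (rule mult_right_le_imp_le)
  qed
qed

text \<open>Both sides are the trace of the frame operator, which is the identity.\<close>

lemma frame_norm_sum:
  fixes u :: "'i \<Rightarrow> 'a::euclidean_space"
  assumes pars: "\<And>x. (\<Sum>i\<in>I. (x \<bullet> u i)\<^sup>2) = (norm x)\<^sup>2"
  shows "(\<Sum>i\<in>I. (norm (u i))\<^sup>2) = DIM('a)"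
proof -
  have "(\<Sum>i\<in>I. (norm (u i))\<^sup>2) = (\<Sum>i\<in>I. \<Sum>b\<in>Basis. (u i \<bullet> b)\<^sup>2)"
    by (simp only: norm_sq_Basis)
  also have "\<dots> = (\<Sum>b\<in>(Basis :: 'a set). \<Sum>i\<in>I. (b \<bullet> u i)\<^sup>2)"
    by (subst sum.swap) (simp add: inner_commute)
  also have "\<dots> = DIM('a)" by (simp add: pars)
  finally show ?thesis .
qed

text \<open>The image of \<Theta> is open but may be a proper subset, so the pulled-back Gaussian
  has mass at most 1. The constant \<open>P\<close> stays inside the integral, which is the form met
  in the application.\<close>

lemma gauss_change_of_variables_le:
  fixes \<Theta> :: "real^'m::{finite,wellorder} \<Rightarrow> real^'m::_"
  assumes der: "\<And>y. (\<Theta> has_derivative D y) (at y)" and inj: "inj \<Theta>" and P: "0 \<le> P"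
  shows "(\<integral>\<^sup>+y. ennreal (P * (\<bar>det (matrix (D y))\<bar> * gauss (\<Theta> y))) \<partial>lborel) \<le> ennreal P"
proof -
  have contT: "continuous_on UNIV \<Theta>"
    using der has_derivative_continuous by (intro continuous_at_imp_continuous_on) blast
  have op: "open (range \<Theta>)" by (rule invariance_of_domain[OF contT open_UNIV inj])
  let ?G = "gauss :: real^'m::_ \<Rightarrow> real"
  have meas: "?G \<in> borel_measurable borel"
    by (intro borel_measurable_continuous_onI continuous_gauss)
  have gi: "(?G has_integral 1) UNIV"
    by (rule nn_integral_has_integral[OF meas gauss_nonneg]) (simp_all add: nn_integral_gauss)
  have ai: "?G absolutely_integrable_on UNIV"
    by (rule nonnegative_absolutely_integrable_1[OF has_integral_integrable[OF gi] gauss_nonneg])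
  have ar: "?G absolutely_integrable_on range \<Theta>"
    by (rule set_integrable_subset[OF ai]) (use op in auto)
  \<comment> \<open>The change of variables formula is applied to vector-valued functions, hence the
    detour through \<open>real^1\<close>.\<close>
  have vi: "(\<lambda>z. vec (?G z) :: real^1) absolutely_integrable_on range \<Theta>"
    by (subst absolutely_integrable_componentwise_iff) (use ar in \<open>auto simp: Basis_vec_def inner_axis\<close>)
  have le1: "integral (range \<Theta>) ?G \<le> 1"
  proof -
    have "integral (range \<Theta>) ?G \<le> integral UNIV ?G"
      by (intro integral_subset_le has_integral_integrable[OF gi] set_lebesgue_integral_eq_integral(1)[OF ar])
         auto
    then show ?thesis using gi by (simp add: integral_unique)
  qed
  let ?h = "\<lambda>y. \<bar>det (matrix (D y))\<bar> * ?G (\<Theta> y)"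
  have cv: "(\<lambda>y. \<bar>det (matrix (D y))\<bar> *\<^sub>R (vec (?G (\<Theta> y)) :: real^1)) absolutely_integrable_on UNIV \<and>
     integral UNIV (\<lambda>y. \<bar>det (matrix (D y))\<bar> *\<^sub>R (vec (?G (\<Theta> y)) :: real^1)) = integral (range \<Theta>) (\<lambda>z. vec (?G z))"
    using vi der inj by (subst has_absolute_integral_change_of_variables) auto
  have "((\<lambda>y. \<bar>det (matrix (D y))\<bar> *\<^sub>R (vec (?G (\<Theta> y)) :: real^1)) has_integral integral (range \<Theta>) (\<lambda>z. vec (?G z))) UNIV"
    using integrable_integral[OF set_lebesgue_integral_eq_integral(1)[OF cv[THEN conjunct1]]]
    unfolding cv[THEN conjunct2] .
  from has_integral_linear[OF this bounded_linear_inner_left[of "axis 1 1"]]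
  have "(?h has_integral (integral (range \<Theta>) (\<lambda>z. vec (?G z) :: real^1) \<bullet> axis 1 1)) UNIV"
    by (simp add: o_def inner_axis)
  moreover have "integral (range \<Theta>) (\<lambda>z. vec (?G z) :: real^1) \<bullet> axis 1 1 = integral (range \<Theta>) ?G"
    using integral_component_eq[OF set_lebesgue_integral_eq_integral(1)[OF vi], of "axis 1 1"]
    by (simp add: inner_axis)
  ultimately have hi: "(?h has_integral integral (range \<Theta>) ?G) UNIV" by simp
  have "(\<integral>\<^sup>+y. ennreal (P * ?h y) \<partial>lborel) = ennreal (P * integral (range \<Theta>) ?G)"
    using nn_integral_has_integral_lebesgue[OF _ has_integral_mult_right[OF hi, of P]] P
    by simp
  also have "\<dots> \<le> ennreal (P * 1)"
    using P by (intro ennreal_leI mult_left_mono le1)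
  finally show ?thesis by simp
qed

text \<open>Barthe's proof: transport every \<open>g i\<close> monotonically to the Gaussian density by \<open>T i\<close>, combine
  the \<open>T i\<close> into one injective map \<open>\<Theta>\<close> of the whole space, and compare the Jacobian of \<open>\<Theta>\<close> with the
  product of the \<open>T i\<close> derivatives by \<open>det_frame_ge\<close>.\<close>

theorem geometric_Brascamp_Lieb:
  fixes u :: "'i \<Rightarrow> real^'m::{finite,wellorder}" and g :: "'i \<Rightarrow> real \<Rightarrow> real"
  assumes fin: "finite I" and pars: "\<And>x. (\<Sum>i\<in>I. (x \<bullet> u i)\<^sup>2) = (norm x)\<^sup>2"
    and u: "\<And>i. i \<in> I \<Longrightarrow> u i \<noteq> 0"
    and cont: "\<And>i x. i \<in> I \<Longrightarrow> isCont (g i) x" and nn: "\<And>i x. i \<in> I \<Longrightarrow> 0 \<le> g i x"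
    and M: "\<And>i. i \<in> I \<Longrightarrow> (\<integral>\<^sup>+x. ennreal (g i x) \<partial>lborel) = ennreal (M i)" "\<And>i. i \<in> I \<Longrightarrow> 0 < M i"
    and pos: "\<And>i a b. i \<in> I \<Longrightarrow> a < b \<Longrightarrow> \<exists>x\<in>{a<..<b}. 0 < g i x"
  shows "(\<integral>\<^sup>+y. ennreal (\<Prod>i\<in>I. g i ((y \<bullet> u i) / norm (u i)) powr (norm (u i))\<^sup>2) \<partial>lborel)
    \<le> ennreal (\<Prod>i\<in>I. M i powr (norm (u i))\<^sup>2)"
proof -
  have "\<exists>T T'. (\<forall>x. (T has_real_derivative T' x) (at x)) \<and> (\<forall>x. 0 \<le> T' x) \<and> strict_mono T \<and>
    (\<forall>x. T' x * std_normal_density (T x) = g i x / M i)" if "i \<in> I" for i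
    by (rule monotone_transport_to_gauss[OF cont nn M pos]) (use that in blast)+
  then obtain T T' where T: "\<And>i x. i \<in> I \<Longrightarrow> (T i has_real_derivative T' i x) (at x)"
    "\<And>i x. i \<in> I \<Longrightarrow> 0 \<le> T' i x" "\<And>i. i \<in> I \<Longrightarrow> strict_mono (T i)"
    "\<And>i x. i \<in> I \<Longrightarrow> T' i x * std_normal_density (T i x) = g i x / M i"
    by metis
  define r where "r i = norm (u i)" for i
  have r: "0 < r i" if "i \<in> I" for i using u[OF that] by (simp add: r_def)
  define s where "s i y = (y \<bullet> u i) / r i" for i and y :: "real^'m::_"
  \<comment> \<open>The factor \<open>r i\<close> compensates the division by \<open>r i\<close> in
    \<open>s i\<close>, so that the derivative is exactly the frame operator with weights
    \<open>T' i (s i y)\<close>.\<close>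
  define \<Theta> where "\<Theta> y = (\<Sum>i\<in>I. (r i * T i (s i y)) *\<^sub>R u i)" for y
  define D where "D y h = (\<Sum>i\<in>I. (T' i (s i y) * (h \<bullet> u i)) *\<^sub>R u i)" for y h
  let ?M = "\<Prod>i\<in>I. M i powr (r i)\<^sup>2"
  have der: "(\<Theta> has_derivative D y) (at y)" for y
  proof -
    have "((\<lambda>y. (r i * T i (s i y)) *\<^sub>R u i) has_derivative (\<lambda>h. (T' i (s i y) * (h \<bullet> u i)) *\<^sub>R u i)) (at y)"
      if i: "i \<in> I" for i
    proof -
      have "(s i has_derivative (\<lambda>h. (h \<bullet> u i) / r i)) (at y)"
      proof -
        have "((\<lambda>y. (1 / r i) * (y \<bullet> u i)) has_derivative (\<lambda>h. (1 / r i) * (h \<bullet> u i))) (at y)"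
          by (intro has_derivative_mult_right has_derivative_inner_left has_derivative_ident)
        then show ?thesis by (simp add: s_def[abs_def])
      qed
      from DERIV_compose_FDERIV[OF T(1)[OF i] this]
      have "((\<lambda>y. T i (s i y)) has_derivative (\<lambda>h. (h \<bullet> u i) / r i * T' i (s i y))) (at y)" .
      from has_derivative_scaleR_left[OF has_derivative_mult_right[OF this, of "r i"], of "u i"]
      show ?thesis using r[OF i] by (auto simp: mult.commute)
    qed
    then show ?thesis unfolding \<Theta>_def[abs_def] D_def[abs_def] by (intro has_derivative_sum)
  qed
  \<comment> \<open>Strict monotonicity of the \<open>T i\<close> makes the inner product of
    \<Theta> y - \<Theta> z with y - z positive, because by the Parseval identity some
    \<open>u j\<close> is not orthogonal to y - z.\<close>
  have inj: "inj \<Theta>"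
  proof (rule injI, rule ccontr)
    fix y z assume e: "\<Theta> y = \<Theta> z" and n: "y \<noteq> z"
    let ?w = "y - z"
    have "(\<Sum>i\<in>I. (?w \<bullet> u i)\<^sup>2) \<noteq> 0" using n by (simp add: pars)
    moreover have "(\<Sum>i\<in>I. (?w \<bullet> u i)\<^sup>2) = 0" if "\<forall>j\<in>I. ?w \<bullet> u j = 0"
      using that by (intro sum.neutral) simp
    ultimately obtain j where j: "j \<in> I" "?w \<bullet> u j \<noteq> 0" by blast
    have trm: "0 \<le> (r i * (T i (s i y) - T i (s i z))) * (?w \<bullet> u i)"
      "?w \<bullet> u i \<noteq> 0 \<Longrightarrow> 0 < (r i * (T i (s i y) - T i (s i z))) * (?w \<bullet> u i)" if i: "i \<in> I" for i
    proof -
      have w: "?w \<bullet> u i = r i * (s i y - s i z)"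
        using r[OF i] by (simp add: s_def inner_diff_left field_simps)
      have "s i y < s i z \<Longrightarrow> T i (s i y) < T i (s i z)" "s i z < s i y \<Longrightarrow> T i (s i z) < T i (s i y)"
        using T(3)[OF i] by (auto simp: strict_mono_def)
      then have st: "0 < (T i (s i y) - T i (s i z)) * (s i y - s i z)" if "s i y \<noteq> s i z"
        using that by (cases "s i y < s i z") (auto simp: zero_less_mult_iff)
      show "0 < (r i * (T i (s i y) - T i (s i z))) * (?w \<bullet> u i)" if "?w \<bullet> u i \<noteq> 0"
      proof -
        have "0 < (r i * r i) * ((T i (s i y) - T i (s i z)) * (s i y - s i z))"
          using r[OF i] that w by (intro mult_pos_pos st) auto
        then show ?thesis unfolding w by (simp only: mult_ac)
      qed
      then show "0 \<le> (r i * (T i (s i y) - T i (s i z))) * (?w \<bullet> u i)"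
        by (cases "?w \<bullet> u i = 0") auto
    qed
    have "0 = (\<Theta> y - \<Theta> z) \<bullet> ?w" using e by simp
    also have "\<dots> = (\<Sum>i\<in>I. (r i * (T i (s i y) - T i (s i z))) * (?w \<bullet> u i))"
      unfolding \<Theta>_def sum_subtractf[symmetric] inner_sum_left
      by (intro sum.cong refl) (simp add: algebra_simps inner_commute)
    also have "\<dots> > 0" using trm j fin by (intro sum_pos2[OF fin j(1)]) auto
    finally show False by simp
  qed
  let ?h = "\<lambda>y. \<bar>det (matrix (D y))\<bar> * gauss (\<Theta> y)"
  let ?G = "gauss :: real^'m::_ \<Rightarrow> real"
  have q: "(\<Sum>i\<in>I. (r i)\<^sup>2) = CARD('m)" using frame_norm_sum[OF pars] by (simp add: r_def)
  \<comment> \<open>If some weight \<open>T' i (s i y)\<close> vanishes, so does the left-hand side;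
    otherwise all weights are positive, as the determinant inequality demands.\<close>
  have pt: "(\<Prod>i\<in>I. (g i (s i y) / M i) powr (r i)\<^sup>2) \<le> ?h y" for y
  proof (cases "\<exists>i\<in>I. T' i (s i y) = 0")
    case True
    then obtain i where i: "i \<in> I" "T' i (s i y) = 0" by blast
    then have "(g i (s i y) / M i) powr (r i)\<^sup>2 = 0" using T(4)[OF i(1), of "s i y"] by simp
    then have "(\<Prod>i\<in>I. (g i (s i y) / M i) powr (r i)\<^sup>2) = 0" using i fin by (auto intro: prod_zero)
    then show ?thesis using gauss_pos[of "\<Theta> y"] by simp
  next
    case False
    then have T'pos: "0 < T' i (s i y)" if "i \<in> I" for i using T(2)[OF that, of "s i y"] that by (auto simp: less_le)
    have "(\<Prod>i\<in>I. (g i (s i y) / M i) powr (r i)\<^sup>2)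
       = (\<Prod>i\<in>I. T' i (s i y) powr (r i)\<^sup>2) * (\<Prod>i\<in>I. std_normal_density (T i (s i y)) powr (r i)\<^sup>2)"
      unfolding prod.distrib[symmetric]
      by (intro prod.cong refl) (simp add: T(4)[symmetric] powr_mult T(2))
    also have "\<dots> \<le> det (matrix (D y)) * ?G (\<Theta> y)"
    proof (rule mult_mono)
      show "(\<Prod>i\<in>I. T' i (s i y) powr (r i)\<^sup>2) \<le> det (matrix (D y))"
        unfolding r_def D_def[abs_def] by (rule det_frame_ge[OF fin pars T'pos])
      then show "0 \<le> det (matrix (D y))" by (rule order_trans[rotated]) (auto intro: prod_nonneg)
      have "(\<Prod>i\<in>I. std_normal_density (T i (s i y)) powr (r i)\<^sup>2)
        = (\<Prod>i\<in>I. (1 / sqrt (2 * pi)) powr (r i)\<^sup>2 * exp (- ((r i * T i (s i y))\<^sup>2) / 2))"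
        by (intro prod.cong refl)
           (simp add: normal_density_def powr_mult powr_divide exp_powr_real power_mult_distrib mult_ac)
      also have "\<dots> = (1 / sqrt (2 * pi)) powr (\<Sum>i\<in>I. (r i)\<^sup>2) * exp (- (\<Sum>i\<in>I. (r i * T i (s i y))\<^sup>2) / 2)"
        by (simp add: prod.distrib powr_sum exp_sum[OF fin, symmetric] sum_negf sum_divide_distrib)
      \<comment> \<open>The synthesis map is a contraction, so \<Theta> y has at most the norm of
        the coefficient vector and the Gaussian is no smaller there. The powers of the normalising
        constant agree because the \<open>(r i)^2\<close> sum to the dimension.\<close>
      also have "\<dots> \<le> ?G (\<Theta> y)"
        unfolding q gauss_def \<Theta>_def using frame_sum_norm_le[OF pars, of "\<lambda>i. r i * T i (s i y)"]
        by (auto simp: powr_realpow intro!: mult_left_mono)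
      finally show "(\<Prod>i\<in>I. std_normal_density (T i (s i y)) powr (r i)\<^sup>2) \<le> ?G (\<Theta> y)" .
    qed (auto intro: prod_nonneg)
    also have "\<dots> \<le> ?h y" using gauss_pos[of "\<Theta> y"] by (intro mult_right_mono) auto
    finally show ?thesis .
  qed
  have M0: "0 \<le> ?M" by (intro prod_nonneg) auto
  have "(\<integral>\<^sup>+y. ennreal (\<Prod>i\<in>I. g i (s i y) powr (r i)\<^sup>2) \<partial>lborel)
    \<le> (\<integral>\<^sup>+y. ennreal (?M * ?h y) \<partial>lborel)"
  proof (rule nn_integral_mono)
    fix y
    have "(\<Prod>i\<in>I. g i (s i y) powr (r i)\<^sup>2) = (\<Prod>i\<in>I. M i powr (r i)\<^sup>2 * (g i (s i y) / M i) powr (r i)\<^sup>2)"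
    proof (intro prod.cong refl)
      fix i assume i: "i \<in> I"
      show "g i (s i y) powr (r i)\<^sup>2 = M i powr (r i)\<^sup>2 * (g i (s i y) / M i) powr (r i)\<^sup>2"
        using M(2)[OF i] nn[OF i] by (simp add: powr_divide)
    qed
    also have "\<dots> \<le> ?M * ?h y"
      unfolding prod.distrib using M0 by (intro mult_left_mono pt)
    finally show "ennreal (\<Prod>i\<in>I. g i (s i y) powr (r i)\<^sup>2) \<le> ennreal (?M * ?h y)"
      by (rule ennreal_leI)
  qed
  also have "\<dots> \<le> ennreal ?M"
    by (rule gauss_change_of_variables_le[OF der inj M0])
  finally show ?thesis unfolding s_def r_def by simp
qed

section \<open>Lebesgue measure in orthonormal coordinates\<close>

text \<open>A well-ordered copy of a finite index type, as the change of variables formula of the library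
  is only available for such index types.\<close>

typedef ('n::finite) idx = "{..<CARD('n)}"
  by (rule exI[of _ 0]) simp

instantiation idx :: (finite) wellorder
begin

definition less_eq_idx :: "'a idx \<Rightarrow> 'a idx \<Rightarrow> bool" where "x \<le> y \<longleftrightarrow> Rep_idx x \<le> Rep_idx y"
definition less_idx :: "'a idx \<Rightarrow> 'a idx \<Rightarrow> bool" where "x < y \<longleftrightarrow> Rep_idx x < Rep_idx y"

instance
proof
  fix P :: "'a idx \<Rightarrow> bool" and a :: "'a idx"
  assume step: "\<And>x. (\<And>y. y < x \<Longrightarrow> P y) \<Longrightarrow> P x"
  have "\<forall>a. Rep_idx a = k \<longrightarrow> P a" for k
  proof (induction k rule: less_induct)
    case (less k)
    show ?case
    proof (intro allI impI, rule step)
      fix x y :: "'a idx" assume "Rep_idx x = k" "y < x"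
      then show "P y" using less[of "Rep_idx y"] by (simp add: less_idx_def)
    qed
  qed
  then show "P a" by blast
qed (auto simp: less_eq_idx_def less_idx_def Rep_idx_inject)

end

instance idx :: (finite) finite
proof
  have "finite ((Abs_idx :: nat \<Rightarrow> 'a idx) ` {..<CARD('a)})" by simp
  then show "finite (UNIV :: 'a idx set)"
    by (simp only: type_definition.Abs_image[OF type_definition_idx])
qed

lemma card_idx [simp]: "CARD('n::finite idx) = CARD('n)"
  by (subst type_definition.card[OF type_definition_idx]) simp

text \<open>The map only renames coordinates, so the preimage of a box is a box with the same side
  lengths.\<close>

lemma distr_lborel_Basis_bij:
  fixes g :: "'a::euclidean_space \<Rightarrow> 'b::euclidean_space"
  assumes "linear g" and bij: "bij_betw g Basis Basis"
  shows "distr lborel borel g = lborel"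
proof (rule lborel_eqI[symmetric])
  interpret linear g by fact
  have [measurable]: "g \<in> borel_measurable borel"
    by (intro borel_measurable_continuous_onI linear_continuous_on) (simp add: linear_linear \<open>linear g\<close>)
  have gB: "g e \<in> Basis" if "e \<in> Basis" for e using bij that by (auto simp: bij_betw_def)
  have ge: "g x \<bullet> g e = x \<bullet> e" if e: "e \<in> Basis" for x e
  proof -
    have "g x = g (\<Sum>b\<in>Basis. (x \<bullet> b) *\<^sub>R b)" by (simp add: euclidean_representation)
    also have "\<dots> = (\<Sum>b\<in>Basis. (x \<bullet> b) *\<^sub>R g b)" by (simp add: sum scale)
    finally have "g x \<bullet> g e = (\<Sum>b\<in>Basis. (x \<bullet> b) * (g b \<bullet> g e))" by (simp add: inner_sum_left)
    also have "\<dots> = (\<Sum>b\<in>Basis. (x \<bullet> b) * (if b = e then 1 else 0))"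
    proof (intro sum.cong refl)
      fix b :: 'a assume b: "b \<in> Basis"
      have "g b = g e \<longleftrightarrow> b = e" using bij b e by (auto simp: bij_betw_def inj_on_def)
      then show "(x \<bullet> b) * (g b \<bullet> g e) = (x \<bullet> b) * (if b = e then 1 else 0)"
        using gB[OF b] gB[OF e] by (simp add: inner_Basis)
    qed
    also have "\<dots> = x \<bullet> e" using e by (simp add: if_distrib cong: if_cong)
    finally show ?thesis .
  qed
  fix l u :: 'b assume lu: "\<And>b. b \<in> Basis \<Longrightarrow> l \<bullet> b \<le> u \<bullet> b"
  define k where "k z = (\<Sum>e\<in>Basis. (z \<bullet> g e) *\<^sub>R e)" for z
  have ke: "k z \<bullet> e = z \<bullet> g e" if "e \<in> Basis" for z e
    using that by (simp add: k_def inner_sum_left inner_Basis if_distrib cong: if_cong)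
  have img: "Basis = g ` (Basis :: 'a set)" using bij by (simp add: bij_betw_def)
  have "g -` box l u = box (k l) (k u)"
    by (auto simp: box_def img ge ke)
  then have "emeasure (distr lborel borel g) (box l u) = emeasure lborel (box (k l) (k u))"
    by (subst emeasure_distr) auto
  also have "\<dots> = (\<Prod>e\<in>Basis. (k u - k l) \<bullet> e)"
    using lu gB by (subst emeasure_lborel_box) (auto simp: ke)
  also have "(\<Prod>e\<in>Basis. (k u - k l) \<bullet> e) = (\<Prod>e\<in>Basis. (u - l) \<bullet> g e)"
    by (intro prod.cong refl) (simp add: inner_diff_left ke)
  also have "\<dots> = (\<Prod>b\<in>Basis. (u - l) \<bullet> b)" by (rule prod.reindex_bij_betw[OF bij])
  finally show "emeasure (distr lborel borel g) (box l u) = (\<Prod>b\<in>Basis. (u - l) \<bullet> b)" .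
qed simp

lemma distr_lborel_orthogonal:
  fixes f :: "real^'n::{finite,wellorder} \<Rightarrow> real^'n::_"
  assumes f: "orthogonal_transformation f"
  shows "distr lborel borel f = lborel"
proof (rule lborel_eqI[symmetric])
  have lin: "linear f" using f by (rule orthogonal_transformation_linear)
  have [measurable]: "f \<in> borel_measurable borel"
    by (intro borel_measurable_continuous_onI linear_continuous_on) (simp add: linear_linear lin)
  fix l u :: "real^'n::_" assume lu: "\<And>b. b \<in> Basis \<Longrightarrow> l \<bullet> b \<le> u \<bullet> b"
  have inv: "orthogonal_transformation (inv f)" using f by (rule orthogonal_transformation_inv)
  have vi: "f -` box l u = inv f ` box l u"
    using orthogonal_transformation_bij[OF f] by (rule bij_vimage_eq_inv_image)
  have lm: "inv f ` box l u \<in> lmeasurable" by (rule measurable_orthogonal_image[OF inv]) simp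
  have bs: "inv f ` box l u \<in> sets borel" using measurable_sets[of f borel borel "box l u"] by (simp flip: vi)
  have "emeasure (distr lborel borel f) (box l u) = emeasure lborel (inv f ` box l u)"
    by (subst emeasure_distr) (auto simp: vi)
  also have "\<dots> = emeasure lebesgue (inv f ` box l u)" using bs by simp
  also have "\<dots> = ennreal (measure lebesgue (inv f ` box l u))"
    using lm by (intro emeasure_eq_ennreal_measure) (auto simp: fmeasurable_def top.not_eq_extremum)
  also have "measure lebesgue (inv f ` box l u) = measure lebesgue (box l u)"
    by (rule measure_orthogonal_image[OF inv]) simp
  also have "ennreal (measure lebesgue (box l u)) = emeasure lborel (box l u)"
    using lu by (simp add: measure_lborel_box_eq emeasure_lborel_box_eq)
  also have "\<dots> = (\<Prod>b\<in>Basis. (u - l) \<bullet> b)" by (rule emeasure_lborel_box[OF lu])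
  finally show "emeasure (distr lborel borel f) (box l u) = (\<Prod>b\<in>Basis. (u - l) \<bullet> b)" .
qed simp

text \<open>A bijection of the bases moves the domain into \<open>real^'n\<close>; what remains is
  an orthogonal map of that space into itself, and both factors preserve the measure.\<close>

lemma distr_lborel_isometry:
  fixes g :: "'a::euclidean_space \<Rightarrow> real^'n::{finite,wellorder}"
  assumes lin: "linear g" and iso: "\<And>x. norm (g x) = norm x" and dim: "DIM('a) = CARD('n)"
  shows "distr lborel borel g = lborel"
proof -
  obtain e where e: "bij_betw e (Basis :: 'a set) (Basis :: (real^'n::_) set)"
  proof -
    have "card (Basis :: 'a set) = card (Basis :: (real^'n::_) set)" using dim by simp
    from finite_same_card_bij[OF finite_Basis finite_Basis this] show ?thesis using that by blast
  qed
  define h where "h x = (\<Sum>b\<in>Basis. (x \<bullet> b) *\<^sub>R e b)" for x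
  define h' where "h' z = (\<Sum>b\<in>Basis. (z \<bullet> e b) *\<^sub>R b)" for z
  have linh: "linear h" unfolding h_def
    by (rule linearI) (simp_all add: inner_add_left scaleR_add_left sum.distrib scaleR_sum_right)
  have linh': "linear h'" unfolding h'_def
    by (rule linearI) (simp_all add: inner_add_left scaleR_add_left sum.distrib scaleR_sum_right)
  have he: "h b = e b" if "b \<in> Basis" for b
    using that by (simp add: h_def inner_Basis if_distrib[where f="\<lambda>x. x *\<^sub>R _"] cong: if_cong)
  have bij: "bij_betw h Basis Basis"
    using e by (rule bij_betw_cong[THEN iffD2, rotated]) (rule he)
  have h'e: "h' z \<bullet> b = z \<bullet> e b" if "b \<in> Basis" for z b
    using that by (simp add: h'_def inner_sum_left inner_Basis if_distrib cong: if_cong)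
  have norm_h': "norm (h' z) = norm z" for z
  proof -
    have "(norm (h' z))\<^sup>2 = (\<Sum>b\<in>Basis. (z \<bullet> e b)\<^sup>2)" by (simp add: norm_sq_Basis h'e)
    also have "\<dots> = (norm z)\<^sup>2" unfolding norm_sq_Basis[of z] by (rule sum.reindex_bij_betw[OF e])
    finally show ?thesis by simp
  qed
  have h'h: "h' (h x) = x" for x
  proof (rule euclidean_eqI)
    fix b :: 'a assume b: "b \<in> Basis"
    have "h x \<bullet> e b = (\<Sum>b'\<in>Basis. (x \<bullet> b') * (e b' \<bullet> e b))" by (simp add: h_def inner_sum_left)
    also have "\<dots> = (\<Sum>b'\<in>Basis. (x \<bullet> b') * (if b' = b then 1 else 0))"
    proof (intro sum.cong refl)
      fix b' :: 'a assume b': "b' \<in> Basis"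
      have "e b' = e b \<longleftrightarrow> b' = b" using e b b' by (auto simp: bij_betw_def inj_on_def)
      moreover have "e b \<in> Basis" "e b' \<in> Basis" using e b b' by (auto simp: bij_betw_def)
      ultimately show "(x \<bullet> b') * (e b' \<bullet> e b) = (x \<bullet> b') * (if b' = b then 1 else 0)"
        by (simp add: inner_Basis)
    qed
    finally show "h' (h x) \<bullet> b = x \<bullet> b" using b by (simp add: h'e if_distrib cong: if_cong)
  qed
  have orth: "orthogonal_transformation (g \<circ> h')"
    unfolding orthogonal_transformation using linear_compose[OF linh' lin] by (simp add: iso norm_h')
  have [measurable]: "g \<in> borel_measurable borel" "h \<in> borel_measurable borel" "h' \<in> borel_measurable borel"
    using lin linh linh' by (auto intro!: borel_measurable_continuous_onI linear_continuous_on simp: linear_linear)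
  have "distr lborel borel g = distr lborel borel ((g \<circ> h') \<circ> h)" by (simp add: o_def h'h)
  also have "\<dots> = distr (distr lborel borel h) borel (g \<circ> h')" by (subst distr_distr) auto
  also have "\<dots> = lborel" by (simp add: distr_lborel_Basis_bij[OF linh bij] distr_lborel_orthogonal[OF orth])
  finally show ?thesis .
qed

lemma nn_integral_isometry_prod:
  fixes g :: "'a::euclidean_space \<times> 'b::euclidean_space \<Rightarrow> real^'n::{finite,wellorder}"
  assumes lin: "linear g" and iso: "\<And>x. norm (g x) = norm x" and dim: "DIM('a) + DIM('b) = CARD('n)"
    and [measurable]: "f \<in> borel_measurable borel"
  shows "(\<integral>\<^sup>+z. f z \<partial>lborel) = (\<integral>\<^sup>+x. \<integral>\<^sup>+y. f (g (x, y)) \<partial>lborel \<partial>lborel)"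
proof -
  have [measurable]: "g \<in> borel_measurable borel"
    using lin by (auto intro!: borel_measurable_continuous_onI linear_continuous_on simp: linear_linear)
  have "(\<integral>\<^sup>+z. f z \<partial>lborel) = (\<integral>\<^sup>+p. f (g p) \<partial>lborel)"
    using distr_lborel_isometry[OF lin iso] dim
    by (subst nn_integral_distr[of g lborel borel f, symmetric]) auto
  also have "\<dots> = (\<integral>\<^sup>+p. f (g p) \<partial>(lborel \<Otimes>\<^sub>M lborel))" by (simp only: lborel_prod)
  also have "\<dots> = (\<integral>\<^sup>+x. \<integral>\<^sup>+y. f (g (x, y)) \<partial>lborel \<partial>lborel)"
    by (rule lborel.nn_integral_fst[symmetric]) (simp add: lborel_prod)
  finally show ?thesis .
qed

section \<open>Product integrals and the Fourier transform of the Gaussian\<close>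

lemma lborel_integral_prod_Basis:
  fixes f :: "'a::euclidean_space \<Rightarrow> real \<Rightarrow> complex"
  assumes int: "\<And>b. b \<in> Basis \<Longrightarrow> integrable lborel (f b)"
  shows "integrable lborel (\<lambda>x::'a. \<Prod>b\<in>Basis. f b (x \<bullet> b))"
    and "(\<integral>x. (\<Prod>b\<in>Basis. f b (x \<bullet> b)) \<partial>(lborel :: 'a measure)) = (\<Prod>b\<in>Basis. \<integral>x. f b x \<partial>lborel)"
proof -
  interpret product_sigma_finite "\<lambda>_::'a. lborel :: real measure" ..
  let ?P = "\<Pi>\<^sub>M b\<in>(Basis :: 'a set). (lborel :: real measure)"
  let ?s = "\<lambda>g. \<Sum>b\<in>(Basis :: 'a set). g b *\<^sub>R b"
  have lb: "(lborel :: 'a measure) = distr ?P borel ?s" by (rule lborel_eq)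
  have [measurable]: "f b \<in> borel_measurable borel" if "b \<in> Basis" for b
    using int[OF that] by (auto dest: borel_measurable_integrable)
  have [measurable]: "?s \<in> borel_measurable ?P" by measurable
  have m: "(\<lambda>x::'a. \<Prod>b\<in>Basis. f b (x \<bullet> b)) \<in> borel_measurable borel" by measurable
  have e: "(\<Prod>b\<in>Basis. f b (?s g \<bullet> b)) = (\<Prod>b\<in>Basis. f b (g b))" for g
    by (intro prod.cong refl) (simp add: inner_sum_left inner_Basis if_distrib cong: if_cong)
  show "integrable lborel (\<lambda>x::'a. \<Prod>b\<in>Basis. f b (x \<bullet> b))"
    unfolding lb using m product_integrable_prod[OF finite_Basis int]
    by (subst integrable_distr_eq) (auto simp: e)
  show "(\<integral>x. (\<Prod>b\<in>Basis. f b (x \<bullet> b)) \<partial>(lborel :: 'a measure)) = (\<Prod>b\<in>Basis. \<integral>x. f b x \<partial>lborel)"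
    unfolding lb using m product_integral_prod[OF finite_Basis int]
    by (subst integral_distr) (auto simp: e)
qed

lemma prod_Basis_cart: "(\<Prod>b\<in>(Basis :: (real^'n) set). h b) = (\<Prod>i\<in>UNIV. h (axis i 1))"
proof -
  have "bij_betw (\<lambda>i::'n. axis i (1::real)) UNIV Basis"
    by (auto simp: bij_betw_def inj_on_def axis_eq_axis Basis_vec_def)
  from prod.reindex_bij_betw[OF this, of h] show ?thesis by simp
qed

lemma lborel_integral_prod_cart:
  fixes f :: "'n::finite \<Rightarrow> real \<Rightarrow> complex"
  assumes int: "\<And>i. integrable lborel (f i)"
  shows "integrable lborel (\<lambda>x::real^'n. \<Prod>i\<in>UNIV. f i (x $ i))"
    and "(\<integral>x. (\<Prod>i\<in>UNIV. f i (x $ i)) \<partial>(lborel :: (real^'n) measure)) = (\<Prod>i\<in>UNIV. \<integral>x. f i x \<partial>lborel)"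
proof -
  define F where "F b = f (THE i. b = axis i 1)" for b :: "real^'n"
  have F: "F (axis i 1) = f i" for i by (simp add: F_def axis_eq_axis)
  have "integrable lborel (F b)" for b unfolding F_def by (rule int)
  from lborel_integral_prod_Basis[of F, OF this]
  show "integrable lborel (\<lambda>x::real^'n. \<Prod>i\<in>UNIV. f i (x $ i))"
    and "(\<integral>x. (\<Prod>i\<in>UNIV. f i (x $ i)) \<partial>(lborel :: (real^'n) measure)) = (\<Prod>i\<in>UNIV. \<integral>x. f i x \<partial>lborel)"
    by (simp_all add: prod_Basis_cart F inner_axis)
qed

text \<open>A rescaling of the characteristic function of the standard normal distribution. For
  small \<open>e\<close> the wide Gaussian in t turns into \<open>2 * pi\<close> times a narrow
  density, an approximate point mass at 0.\<close>

lemma gauss_Fourier_1: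
  assumes e: "0 < e"
  shows "integrable lborel (\<lambda>t. iexp (t * y) * complex_of_real (exp (- (e * t)\<^sup>2 / 2)))"
    and "(\<integral>t. iexp (t * y) * complex_of_real (exp (- (e * t)\<^sup>2 / 2)) \<partial>lborel)
      = complex_of_real (2 * pi * normal_density 0 e y)"
proof -
  have ie: "integrable lborel (\<lambda>x. std_normal_density x *\<^sub>R iexp (s * x))" for s
    by (rule Bochner_Integration.integrable_bound[OF integrable_normal_density[of 1 0]]) auto
  have F: "(\<integral>x. std_normal_density x *\<^sub>R iexp (s * x) \<partial>lborel) = complex_of_real (exp (- s\<^sup>2 / 2))" for s
  proof -
    have "char std_normal_distribution s = (\<integral>x. std_normal_density x *\<^sub>R iexp (s * x) \<partial>lborel)"
      unfolding char_def by (subst integral_density) auto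
    then show ?thesis by (simp add: char_std_normal_distribution)
  qed
  let ?f = "\<lambda>x. sqrt (2 * pi) *\<^sub>R (std_normal_density x *\<^sub>R iexp ((y / e) * x))"
  have eq: "?f (0 + e * t) = iexp (t * y) * complex_of_real (exp (- (e * t)\<^sup>2 / 2))" for t
    using e by (simp add: normal_density_def scaleR_conv_of_real mult.commute)
  have I: "integrable lborel ?f" by (intro integrable_scaleR_right ie)
  show "integrable lborel (\<lambda>t. iexp (t * y) * complex_of_real (exp (- (e * t)\<^sup>2 / 2)))"
    using lborel_integrable_real_affine[OF I, of e 0] e unfolding eq by simp
  have "(\<integral>x. ?f x \<partial>lborel) = \<bar>e\<bar> *\<^sub>R (\<integral>t. ?f (0 + e * t) \<partial>lborel)"
    using e by (intro lborel_integral_real_affine) simp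
  then have "(\<integral>t. iexp (t * y) * complex_of_real (exp (- (e * t)\<^sup>2 / 2)) \<partial>lborel) = (1 / e) *\<^sub>R (\<integral>x. ?f x \<partial>lborel)"
    unfolding eq using e by simp
  also have "(\<integral>x. ?f x \<partial>lborel) = sqrt (2 * pi) *\<^sub>R complex_of_real (exp (- (y / e)\<^sup>2 / 2))"
    unfolding integral_scaleR_right F ..
  also have "(1 / e) *\<^sub>R (sqrt (2 * pi) *\<^sub>R complex_of_real (exp (- (y / e)\<^sup>2 / 2)))
      = complex_of_real ((1 / e) * (sqrt (2 * pi) * exp (- (y / e)\<^sup>2 / 2)))"
    by (simp only: scaleR_conv_of_real of_real_mult)
  also have "(1 / e) * (sqrt (2 * pi) * exp (- (y / e)\<^sup>2 / 2)) = 2 * pi * normal_density 0 e y"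
  proof -
    have "sqrt (2 * pi * e\<^sup>2) = sqrt (2 * pi) * e" using e by (simp add: real_sqrt_mult)
    moreover have "exp (- (y - 0)\<^sup>2 / (2 * e\<^sup>2)) = exp (- (y / e)\<^sup>2 / 2)" by (simp add: power_divide)
    ultimately have "normal_density 0 e y = 1 / (sqrt (2 * pi) * e) * exp (- (y / e)\<^sup>2 / 2)"
      unfolding normal_density_def by simp
    then have "2 * pi * normal_density 0 e y = (2 * pi / sqrt (2 * pi)) * (1 / e) * exp (- (y / e)\<^sup>2 / 2)"
      by simp
    also have "2 * pi / sqrt (2 * pi) = sqrt (2 * pi)" by (rule real_div_sqrt) simp
    finally show ?thesis by simp
  qed
  finally show "(\<integral>t. iexp (t * y) * complex_of_real (exp (- (e * t)\<^sup>2 / 2)) \<partial>lborel)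
      = complex_of_real (2 * pi * normal_density 0 e y)" .
qed

section \<open>Fourier bound for sections\<close>

text \<open>Fourier inversion with the point mass at y = 0 replaced by a normal density of width
  \<open>e\<close>. Sending the pair x, y to the numbers
  \<open>x \<bullet> w i + y \<bullet> u i\<close> is an isometry onto the coordinate space, so the
  left-hand side is one integral over all coordinates. Writing the normal density as an integral
  over frequencies \<eta> and exchanging the integrals produces the transforms \<open>r i\<close>.
  The Gaussian factor in \<eta> is at most 1 and is dropped, which makes the bound independent of
  \<open>e\<close>.\<close>

lemma Fourier_bound:
  fixes w u :: "'b::{finite,wellorder} \<Rightarrow> real^'m" and \<rho> r :: "'b \<Rightarrow> real \<Rightarrow> real"
  assumes iso: "\<And>x y. (\<Sum>i\<in>UNIV. (x \<bullet> w i + y \<bullet> u i)\<^sup>2) = (norm x)\<^sup>2 + (norm y)\<^sup>2"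
    and dim: "CARD('b) = 2 * CARD('m)"
    and int: "\<And>i. integrable lborel (\<rho> i)" and nn: "\<And>i z. 0 \<le> \<rho> i z"
    and r: "\<And>i t. (\<integral>z. iexp (t * z) * complex_of_real (\<rho> i z) \<partial>lborel) = complex_of_real (r i t)"
    and rm[measurable]: "\<And>i. r i \<in> borel_measurable borel"
    and e: "0 < e"
  shows "(\<integral>\<^sup>+x. \<integral>\<^sup>+y. ennreal ((\<Prod>i\<in>UNIV. \<rho> i (x \<bullet> w i + y \<bullet> u i)) * (\<Prod>b\<in>Basis. normal_density 0 e (y \<bullet> b))) \<partial>lborel \<partial>lborel)
    \<le> ennreal ((1 / (2 * pi)) ^ CARD('m)) * (\<integral>\<^sup>+\<eta>. ennreal (\<Prod>i\<in>UNIV. \<bar>r i (\<eta> \<bullet> u i)\<bar>) \<partial>lborel)"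
proof -
  define n where "n = CARD('m)"
  let ?r = "\<lambda>\<eta>. \<Prod>i\<in>UNIV. r i (\<eta> \<bullet> u i)"
  let ?I = "(\<integral>\<^sup>+\<eta>. ennreal (\<Prod>i\<in>UNIV. \<bar>r i (\<eta> \<bullet> u i)\<bar>) \<partial>lborel)"
  have [measurable]: "\<rho> i \<in> borel_measurable borel" for i
    using int[of i] by (auto dest: borel_measurable_integrable)
  have [measurable]: "(\<lambda>z::real^'b::_. z $ i) \<in> borel_measurable borel" for i
    by (intro borel_measurable_continuous_onI continuous_intros)
  define g :: "(real^'m) \<times> (real^'m) \<Rightarrow> real^'b::_" where "g p = (\<chi> i. fst p \<bullet> w i + snd p \<bullet> u i)" for p
  have ling: "linear g"
    by (rule linearI) (simp_all add: g_def vec_eq_iff inner_add_left algebra_simps)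
  have normg: "norm (g p) = norm p" for p
  proof -
    have "(norm (g p))\<^sup>2 = (\<Sum>i\<in>UNIV. (fst p \<bullet> w i + snd p \<bullet> u i)\<^sup>2)"
      by (simp add: power2_norm_eq_inner inner_vec_def g_def) (simp add: power2_eq_square)
    also have "\<dots> = (norm p)\<^sup>2" by (simp add: iso norm_prod_def)
    finally show ?thesis by simp
  qed
  have innerg: "g p \<bullet> g q = p \<bullet> q" for p q
    unfolding dot_norm using normg by (simp add: linear_add[OF ling, symmetric])
  \<comment> \<open>The adjoint of the embedding of the complement; it recovers y from the
    coordinate vector.\<close>
  define U where "U z = (\<Sum>i\<in>UNIV. z $ i *\<^sub>R u i)" for z :: "real^'b::_"
  have [measurable]: "U \<in> borel_measurable borel"
    unfolding U_def[abs_def] by (intro borel_measurable_continuous_onI continuous_intros)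
  have Ug: "U (g (x, y)) = y" for x y
  proof (rule euclidean_eqI)
    fix b :: "real^'m"
    have "U (g (x, y)) \<bullet> b = g (x, y) \<bullet> g (0, b)"
    proof -
      have gi: "g (0, b) $ i = u i \<bullet> b" for i by (simp add: g_def inner_commute)
      have "g (x, y) \<bullet> g (0, b) = (\<Sum>i\<in>UNIV. g (x, y) $ i * g (0, b) $ i)"
        by (simp only: inner_vec_def inner_real_def)
      then show ?thesis by (simp add: gi U_def inner_sum_left)
    qed
    also have "\<dots> = y \<bullet> b" by (simp add: innerg)
    finally show "U (g (x, y)) \<bullet> b = y \<bullet> b" .
  qed
  define H where "H z = (\<Prod>i\<in>UNIV. \<rho> i (z $ i)) * (\<Prod>b\<in>Basis. normal_density 0 e (U z \<bullet> b))" for z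
  let ?IH = "(\<integral>z. H z \<partial>lborel)"
  have [measurable]: "H \<in> borel_measurable borel" unfolding H_def[abs_def] by measurable
  have H0: "0 \<le> H z" for z unfolding H_def using nn by (intro mult_nonneg_nonneg prod_nonneg) auto
  have lhs: "(\<integral>\<^sup>+x. \<integral>\<^sup>+y. ennreal ((\<Prod>i\<in>UNIV. \<rho> i (x \<bullet> w i + y \<bullet> u i)) * (\<Prod>b\<in>Basis. normal_density 0 e (y \<bullet> b))) \<partial>lborel \<partial>lborel)
    = (\<integral>\<^sup>+z. ennreal (H z) \<partial>lborel)"
    using dim by (subst nn_integral_isometry_prod[OF ling normg]) (auto simp: H_def Ug, simp add: g_def)
  define \<Gamma> :: "real^'m \<Rightarrow> complex" where "\<Gamma> \<eta> = (\<Prod>b\<in>Basis. complex_of_real (exp (- (e * (\<eta> \<bullet> b))\<^sup>2 / 2)))" for \<eta>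
  have normG: "norm (\<Gamma> \<eta>) \<le> 1" for \<eta>
    unfolding \<Gamma>_def prod_norm[symmetric] by (intro prod_le_1) auto
  have intG: "integrable lborel \<Gamma>"
    unfolding \<Gamma>_def[abs_def] using gauss_Fourier_1(1)[OF e, of 0]
    by (intro lborel_integral_prod_Basis(1)) simp
  have [measurable]: "\<Gamma> \<in> borel_measurable borel" unfolding \<Gamma>_def[abs_def] by measurable
  define R where "R z \<eta> = (\<Prod>i\<in>UNIV. iexp ((\<eta> \<bullet> u i) * z $ i) * complex_of_real (\<rho> i (z $ i)))" for z \<eta>
  have intR: "integrable lborel (\<lambda>z. R z \<eta>)" "(\<integral>z. R z \<eta> \<partial>lborel) = complex_of_real (?r \<eta>)" for \<eta>
  proof -
    have 1: "integrable lborel (\<lambda>z. iexp ((\<eta> \<bullet> u i) * z) * complex_of_real (\<rho> i z))" for i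
      by (rule Bochner_Integration.integrable_bound[OF int[of i]]) (auto simp: norm_mult)
    show "integrable lborel (\<lambda>z. R z \<eta>)"
      unfolding R_def by (rule lborel_integral_prod_cart(1)[OF 1])
    show "(\<integral>z. R z \<eta> \<partial>lborel) = complex_of_real (?r \<eta>)"
      unfolding R_def lborel_integral_prod_cart(2)[OF 1] r by simp
  qed
  have normR: "norm (R z \<eta>) = norm (R z 0)" for z \<eta>
    unfolding R_def prod_norm[symmetric] by (simp add: norm_mult)
  \<comment> \<open>Integrating over the frequency first gives a multiple of \<open>H\<close>, over
    the coordinates first the product of the transforms; Fubini equates the two.\<close>
  have intK: "(\<integral>\<eta>. R z \<eta> * \<Gamma> \<eta> \<partial>lborel) = complex_of_real ((2 * pi) ^ n * H z)" for z
  proof -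
    let ?f = "\<lambda>b t. iexp (t * (U z \<bullet> b)) * complex_of_real (exp (- (e * t)\<^sup>2 / 2))"
    have "R z \<eta> * \<Gamma> \<eta> = complex_of_real (\<Prod>i\<in>UNIV. \<rho> i (z $ i)) * (\<Prod>b\<in>Basis. ?f b (\<eta> \<bullet> b))" for \<eta>
    proof -
      have "(\<Prod>i\<in>UNIV. iexp ((\<eta> \<bullet> u i) * z $ i)) = iexp (\<Sum>i\<in>UNIV. (\<eta> \<bullet> u i) * z $ i)"
        by (simp add: exp_sum sum_distrib_left)
      also have "(\<Sum>i\<in>UNIV. (\<eta> \<bullet> u i) * z $ i) = \<eta> \<bullet> U z"
        by (simp add: U_def inner_sum_right mult.commute)
      also have "\<eta> \<bullet> U z = (\<Sum>b\<in>Basis. (\<eta> \<bullet> b) * (U z \<bullet> b))" by (rule euclidean_inner)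
      also have "iexp \<dots> = (\<Prod>b\<in>Basis. iexp ((\<eta> \<bullet> b) * (U z \<bullet> b)))"
        by (simp add: exp_sum sum_distrib_left)
      finally have "(\<Prod>i\<in>UNIV. iexp ((\<eta> \<bullet> u i) * z $ i)) = (\<Prod>b\<in>Basis. iexp ((\<eta> \<bullet> b) * (U z \<bullet> b)))" .
      then show ?thesis
        unfolding R_def \<Gamma>_def prod.distrib of_real_prod by (simp only: mult_ac)
    qed
    then have "(\<integral>\<eta>. R z \<eta> * \<Gamma> \<eta> \<partial>lborel)
       = complex_of_real (\<Prod>i\<in>UNIV. \<rho> i (z $ i)) * (\<integral>\<eta>. (\<Prod>b\<in>Basis. ?f b (\<eta> \<bullet> b)) \<partial>lborel)"
      by (simp only: integral_mult_right_zero)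
    also have "(\<integral>\<eta>. (\<Prod>b\<in>Basis. ?f b (\<eta> \<bullet> b)) \<partial>(lborel :: (real^'m) measure))
        = (\<Prod>b\<in>Basis. complex_of_real (2 * pi * normal_density 0 e (U z \<bullet> b)))"
      by (subst lborel_integral_prod_Basis(2)[OF gauss_Fourier_1(1)[OF e]]) (simp only: gauss_Fourier_1(2)[OF e])
    also have "\<dots> = complex_of_real ((2 * pi) ^ n * (\<Prod>b\<in>Basis. normal_density 0 e (U z \<bullet> b)))"
      by (simp only: of_real_prod[symmetric] prod.distrib prod_constant n_def) simp
    finally show ?thesis by (simp add: H_def)
  qed
  have measK: "(\<lambda>(z, \<eta>). R z \<eta> * \<Gamma> \<eta>) \<in> borel_measurable (lborel \<Otimes>\<^sub>M lborel)"
    unfolding R_def by measurable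
  have KI: "integrable (lborel \<Otimes>\<^sub>M lborel) (\<lambda>(z, \<eta>). R z \<eta> * \<Gamma> \<eta>)"
  proof (rule lborel_pair.Fubini_integrable[OF measK])
    have nm: "norm (R z \<eta> * \<Gamma> \<eta>) = norm (R z 0) * norm (\<Gamma> \<eta>)" for z \<eta>
      unfolding norm_mult normR[of z \<eta>] ..
    have "integrable lborel (\<lambda>z. norm (R z 0) * (\<integral>\<eta>. norm (\<Gamma> \<eta>) \<partial>lborel))"
      by (intro integrable_mult_left impI integrable_norm intR(1))
    then show "integrable lborel (\<lambda>z. \<integral>\<eta>. norm (case (z, \<eta>) of (z, \<eta>) \<Rightarrow> R z \<eta> * \<Gamma> \<eta>) \<partial>lborel)"
      unfolding prod.case nm by simp
    have "integrable lborel (\<lambda>\<eta>. R z \<eta> * \<Gamma> \<eta>)" for z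
    proof (rule Bochner_Integration.integrable_bound[of _ "\<lambda>\<eta>. R z 0 * \<Gamma> \<eta>"])
      show "integrable lborel (\<lambda>\<eta>. R z 0 * \<Gamma> \<eta>)" using intG by (intro integrable_mult_right impI)
      show "(\<lambda>\<eta>. R z \<eta> * \<Gamma> \<eta>) \<in> borel_measurable lborel" unfolding R_def by measurable
      show "AE \<eta> in lborel. norm (R z \<eta> * \<Gamma> \<eta>) \<le> norm (R z 0 * \<Gamma> \<eta>)"
      proof (rule AE_I2)
        fix \<eta>
        show "norm (R z \<eta> * \<Gamma> \<eta>) \<le> norm (R z 0 * \<Gamma> \<eta>)"
          unfolding norm_mult normR[of z \<eta>] by (rule order_refl)
      qed
    qed
    then show "AE z in lborel. integrable lborel (\<lambda>\<eta>. case (z, \<eta>) of (z, \<eta>) \<Rightarrow> R z \<eta> * \<Gamma> \<eta>)"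
      unfolding prod.case by (intro AE_I2)
  qed
  have swap: "(\<integral>z. \<integral>\<eta>. R z \<eta> * \<Gamma> \<eta> \<partial>lborel \<partial>lborel) = (\<integral>\<eta>. \<integral>z. R z \<eta> * \<Gamma> \<eta> \<partial>lborel \<partial>lborel)"
    by (rule lborel_pair.Fubini_integral[OF KI, symmetric])
  \<comment> \<open>Integrability of \<open>H\<close> is a by-product of Fubini.\<close>
  have "integrable lborel (\<lambda>z. \<integral>\<eta>. R z \<eta> * \<Gamma> \<eta> \<partial>lborel)"
    by (rule lborel_pair.integrable_fst[OF KI])
  then have "integrable lborel (\<lambda>z. (2 * pi) ^ n * H z)"
    unfolding intK complex_of_real_integrable_eq .
  then have HI: "integrable lborel H" by simp
  have "complex_of_real ((2 * pi) ^ n * ?IH) = (\<integral>z. complex_of_real ((2 * pi) ^ n * H z) \<partial>lborel)"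
    by (simp only: integral_complex_of_real integral_mult_right_zero)
  also have "\<dots> = (\<integral>\<eta>. complex_of_real (?r \<eta>) * \<Gamma> \<eta> \<partial>lborel)"
    unfolding intK[symmetric] swap by (simp add: intR(2))
  finally have eq: "complex_of_real ((2 * pi) ^ n * ?IH) = (\<integral>\<eta>. complex_of_real (?r \<eta>) * \<Gamma> \<eta> \<partial>lborel)" .
  have IH0: "0 \<le> ?IH" using H0 by simp
  \<comment> \<open>In the non-integrable case the Bochner integral is 0 by convention, and the
    claim is trivial.\<close>
  have le: "ennreal ((2 * pi) ^ n * ?IH) \<le> ?I"
  proof (cases "integrable lborel (\<lambda>\<eta>. complex_of_real (?r \<eta>) * \<Gamma> \<eta>)")
    case True
    have "(2 * pi) ^ n * ?IH = norm (complex_of_real ((2 * pi) ^ n * ?IH))"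
      unfolding norm_of_real using IH0 by simp
    then have "ennreal ((2 * pi) ^ n * ?IH)
      \<le> (\<integral>\<^sup>+\<eta>. ennreal (norm (complex_of_real (?r \<eta>) * \<Gamma> \<eta>)) \<partial>lborel)"
      using integral_norm_bound_ennreal[OF True] unfolding eq by simp
    also have "\<dots> \<le> ?I"
    proof (intro nn_integral_mono ennreal_leI)
      fix \<eta>
      have "norm (complex_of_real (?r \<eta>) * \<Gamma> \<eta>) \<le> norm (complex_of_real (?r \<eta>)) * 1"
        unfolding norm_mult by (intro mult_left_mono normG) simp
      then show "norm (complex_of_real (?r \<eta>) * \<Gamma> \<eta>) \<le> (\<Prod>i\<in>UNIV. \<bar>r i (\<eta> \<bullet> u i)\<bar>)"
        unfolding norm_of_real abs_prod by simp
    qed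
    finally show ?thesis .
  next
    case False
    then have "complex_of_real ((2 * pi) ^ n * ?IH) = 0"
      unfolding eq by (rule not_integrable_integral_eq)
    then show ?thesis by (simp only: of_real_eq_0_iff ennreal_0 zero_le)
  qed
  have "(\<integral>\<^sup>+z. ennreal (H z) \<partial>lborel) = ennreal ?IH"
    using HI H0 by (intro nn_integral_eq_integral) auto
  also have "\<dots> = ennreal ((1 / (2 * pi)) ^ n) * ennreal ((2 * pi) ^ n * ?IH)"
    by (subst ennreal_mult'[symmetric]) (simp_all add: power_divide)
  also have "\<dots> \<le> ennreal ((1 / (2 * pi)) ^ n) * ?I"
    by (intro mult_left_mono le) simp
  finally show ?thesis unfolding lhs n_def .
qed

lemma nn_integral_lborel_scale:
  fixes f :: "'a::euclidean_space \<Rightarrow> ennreal"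
  assumes [measurable]: "f \<in> borel_measurable borel" and c: "0 < c"
  shows "(\<integral>\<^sup>+x. f x \<partial>lborel) = ennreal (c ^ DIM('a)) * (\<integral>\<^sup>+x. f (c *\<^sub>R x) \<partial>lborel)"
proof -
  have "(lborel :: 'a measure) = density (distr lborel borel (\<lambda>x. 0 + c *\<^sub>R x)) (\<lambda>_. \<bar>c\<bar> ^ DIM('a))"
    using c by (intro lborel_affine) simp
  then have "(\<integral>\<^sup>+x. f x \<partial>lborel) = (\<integral>\<^sup>+x. f x \<partial>density (distr lborel borel (\<lambda>x. c *\<^sub>R x)) (\<lambda>_. \<bar>c\<bar> ^ DIM('a)))"
    by simp
  also have "\<dots> = ennreal (c ^ DIM('a)) * (\<integral>\<^sup>+x. f (c *\<^sub>R x) \<partial>lborel)"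
    using c by (simp add: nn_integral_density nn_integral_distr nn_integral_cmult)
  finally show ?thesis .
qed

lemma prod_normal_density_scale:
  fixes y :: "'a::euclidean_space"
  assumes "0 < e"
  shows "e ^ DIM('a) * (\<Prod>b\<in>Basis. normal_density 0 e ((e *\<^sub>R y) \<bullet> b)) = gauss y"
proof -
  have "e * normal_density 0 e (e * t) = std_normal_density t" for t
    using assms by (simp add: normal_density_def real_sqrt_mult power_mult_distrib)
  then have "(\<Prod>b\<in>(Basis :: 'a set). e * normal_density 0 e (e * (y \<bullet> b))) = gauss y"
    by (simp add: gauss_eq_prod)
  then show ?thesis by (simp add: prod.distrib)
qed

text \<open>Substituting e y for y fixes the Gaussian weight and moves the smoothing into the
  argument of \<open>\<rho> i\<close>, where it disappears as e tends to 0. Fatou's lemma asks only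
  for a lower bound of the limit inferior. Where the product vanishes, 0 is such a bound; so
  continuity is asked for at points with \<open>\<rho> i z \<noteq> 0\<close>, which admits
  indicators of open intervals.\<close>

lemma Fourier_section_bound:
  fixes w u :: "'b::{finite,wellorder} \<Rightarrow> real^'m" and \<rho> r :: "'b \<Rightarrow> real \<Rightarrow> real"
  assumes iso: "\<And>x y. (\<Sum>i\<in>UNIV. (x \<bullet> w i + y \<bullet> u i)\<^sup>2) = (norm x)\<^sup>2 + (norm y)\<^sup>2"
    and dim: "CARD('b) = 2 * CARD('m)"
    and int: "\<And>i. integrable lborel (\<rho> i)" and nn: "\<And>i z. 0 \<le> \<rho> i z"
    and cont: "\<And>i z. \<rho> i z \<noteq> 0 \<Longrightarrow> isCont (\<rho> i) z"
    and r: "\<And>i t. (\<integral>z. iexp (t * z) * complex_of_real (\<rho> i z) \<partial>lborel) = complex_of_real (r i t)"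
    and rm: "\<And>i. r i \<in> borel_measurable borel"
  shows "(\<integral>\<^sup>+x. ennreal (\<Prod>i\<in>UNIV. \<rho> i (x \<bullet> w i)) \<partial>lborel)
    \<le> ennreal ((1 / (2 * pi)) ^ CARD('m)) * (\<integral>\<^sup>+\<eta>. ennreal (\<Prod>i\<in>UNIV. \<bar>r i (\<eta> \<bullet> u i)\<bar>) \<partial>lborel)"
    (is "_ \<le> ?B")
proof -
  have [measurable]: "\<rho> i \<in> borel_measurable borel" for i
    using int[of i] by (auto dest: borel_measurable_integrable)
  have [measurable]: "(gauss :: real^'m \<Rightarrow> real) \<in> borel_measurable borel"
    by (intro borel_measurable_continuous_onI continuous_gauss)
  define e where "e k = 1 / (real k + 1)" for k :: nat
  have e: "0 < e k" for k by (simp add: e_def)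
  have e0: "e \<longlonglongrightarrow> 0" unfolding e_def[abs_def] by real_asymp
  let ?P = "\<lambda>x. \<Prod>i\<in>UNIV. \<rho> i (x \<bullet> w i)"
  define h where "h k p = ennreal ((\<Prod>i\<in>UNIV. \<rho> i (fst p \<bullet> w i + (e k *\<^sub>R snd p) \<bullet> u i)) * gauss (snd p))" for k p
  have [measurable]: "h k \<in> borel_measurable (lborel \<Otimes>\<^sub>M lborel)" for k
    unfolding h_def[abs_def] by measurable
  have hB: "(\<integral>\<^sup>+p. h k p \<partial>(lborel \<Otimes>\<^sub>M lborel)) \<le> ?B" for k
  proof -
    let ?f = "\<lambda>x y. ennreal ((\<Prod>i\<in>UNIV. \<rho> i (x \<bullet> w i + y \<bullet> u i)) * (\<Prod>b\<in>Basis. normal_density 0 (e k) (y \<bullet> b)))"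
    have "(\<integral>\<^sup>+y. ?f x y \<partial>lborel)
      = (\<integral>\<^sup>+y. h k (x, y) \<partial>lborel)" for x :: "real^'m"
    proof -
      have "(\<integral>\<^sup>+y. ?f x y \<partial>lborel)
        = ennreal (e k ^ DIM(real^'m)) * (\<integral>\<^sup>+y. ?f x (e k *\<^sub>R y) \<partial>lborel)"
        by (rule nn_integral_lborel_scale[OF _ e]) measurable
      also have "\<dots> = (\<integral>\<^sup>+y. ennreal (e k ^ DIM(real^'m)) * ?f x (e k *\<^sub>R y) \<partial>lborel)"
        by (rule nn_integral_cmult[symmetric]) measurable
      also have "\<dots> = (\<integral>\<^sup>+y. h k (x, y) \<partial>lborel)"
      proof (rule nn_integral_cong)
        fix y :: "real^'m"
        show "ennreal (e k ^ DIM(real^'m)) * ?f x (e k *\<^sub>R y) = h k (x, y)"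
          unfolding h_def fst_conv snd_conv prod_normal_density_scale[OF e[of k], of y, symmetric]
          using e[of k] by (subst ennreal_mult'[symmetric]) (auto simp: mult_ac)
      qed
      finally show ?thesis .
    qed
    then have "(\<integral>\<^sup>+x. \<integral>\<^sup>+y. h k (x, y) \<partial>lborel \<partial>lborel) \<le> ?B"
      using Fourier_bound[where w = w and u = u and \<rho> = \<rho> and r = r, OF iso dim int nn r rm e[of k]]
      by (simp only:)
    then show ?thesis by (subst lborel.nn_integral_fst[symmetric]) auto
  qed
  have lim: "ennreal ((?P (fst p)) * gauss (snd p)) \<le> liminf (\<lambda>k. h k p)" for p
  proof (cases "(?P (fst p)) = 0")
    case False
    then have nz: "\<rho> i (fst p \<bullet> w i) \<noteq> 0" for i by simp
    have "(\<lambda>k. \<rho> i (fst p \<bullet> w i + (e k *\<^sub>R snd p) \<bullet> u i)) \<longlonglongrightarrow> \<rho> i (fst p \<bullet> w i)" for i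
    proof (rule isCont_tendsto_compose[OF cont[OF nz]])
      have "(\<lambda>k. fst p \<bullet> w i + (e k *\<^sub>R snd p) \<bullet> u i) \<longlonglongrightarrow> fst p \<bullet> w i + (0 *\<^sub>R snd p) \<bullet> u i"
        by (intro tendsto_intros e0)
      then show "(\<lambda>k. fst p \<bullet> w i + (e k *\<^sub>R snd p) \<bullet> u i) \<longlonglongrightarrow> fst p \<bullet> w i" by simp
    qed
    then have "(\<lambda>k. h k p) \<longlonglongrightarrow> ennreal ((?P (fst p)) * gauss (snd p))"
      unfolding h_def by (intro tendsto_ennrealI tendsto_mult tendsto_prod tendsto_const)
    then show ?thesis by (simp add: lim_imp_Liminf)
  next
    case True
    then show ?thesis by (simp only: mult_zero_left ennreal_0 zero_le)
  qed
  have "(\<integral>\<^sup>+x. ennreal (?P x) \<partial>lborel)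
    = (\<integral>\<^sup>+x. \<integral>\<^sup>+y. ennreal ((?P x) * gauss (y :: real^'m)) \<partial>lborel \<partial>lborel)"
  proof (rule nn_integral_cong)
    fix x :: "real^'m"
    have "0 \<le> (?P x)" using nn by (intro prod_nonneg) auto
    then have "(\<integral>\<^sup>+y. ennreal ((?P x) * gauss (y :: real^'m)) \<partial>lborel)
      = ennreal (?P x) * (\<integral>\<^sup>+y. ennreal (gauss (y :: real^'m)) \<partial>lborel)"
      by (simp add: ennreal_mult' nn_integral_cmult)
    then show "ennreal (?P x) = (\<integral>\<^sup>+y. ennreal ((?P x) * gauss (y :: real^'m)) \<partial>lborel)"
      by (simp add: nn_integral_gauss)
  qed
  also have "\<dots> = (\<integral>\<^sup>+p. ennreal ((?P (fst p)) * gauss (snd p :: real^'m)) \<partial>(lborel \<Otimes>\<^sub>M lborel))"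
    by (subst lborel.nn_integral_fst[symmetric]) auto
  also have "\<dots> \<le> (\<integral>\<^sup>+p. liminf (\<lambda>k. h k p) \<partial>(lborel \<Otimes>\<^sub>M lborel))"
    by (intro nn_integral_mono lim)
  also have "\<dots> \<le> liminf (\<lambda>k. \<integral>\<^sup>+p. h k p \<partial>(lborel \<Otimes>\<^sub>M lborel))"
    by (rule nn_integral_liminf) measurable
  also have "\<dots> \<le> liminf (\<lambda>k::nat. ?B)"
    by (intro Liminf_mono always_eventually allI hB)
  also have "\<dots> = ?B" by (simp add: Liminf_const)
  finally show ?thesis .
qed

text \<open>Naimark dilation: a Parseval frame is the projection of an orthonormal basis, and the
  \<open>u i\<close> are the projections of this basis onto the complement. With twice as many
  vectors as dimensions the complement has the same dimension and hence fits the same type.\<close>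

lemma frame_complement:
  fixes w :: "'b::{finite,wellorder} \<Rightarrow> real^'m"
  assumes pars: "\<And>x. (\<Sum>i\<in>UNIV. (x \<bullet> w i)\<^sup>2) = (norm x)\<^sup>2" and dim: "CARD('b) = 2 * CARD('m)"
  obtains u :: "'b \<Rightarrow> real^'m"
  where "\<And>x y. (\<Sum>i\<in>UNIV. (x \<bullet> w i + y \<bullet> u i)\<^sup>2) = (norm x)\<^sup>2 + (norm y)\<^sup>2"
    and "\<And>i. (norm (w i))\<^sup>2 + (norm (u i))\<^sup>2 = 1"
proof -
  have norm_cart: "(norm z)\<^sup>2 = (\<Sum>i\<in>UNIV. (z $ i)\<^sup>2)" for z :: "real^'b::_"
    by (simp only: power2_norm_eq_inner inner_vec_def inner_real_def) (simp only: power2_eq_square)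
  define T where "T x = (\<chi> i. x \<bullet> w i)" for x
  have linT: "linear T" by (rule linearI) (simp_all add: T_def vec_eq_iff inner_add_left)
  have normT: "norm (T x) = norm x" for x
  proof -
    have "(norm (T x))\<^sup>2 = (norm x)\<^sup>2" unfolding norm_cart by (simp add: T_def pars)
    then show ?thesis by simp
  qed
  have injT: "inj T"
  proof (rule injI)
    fix x y assume "T x = T y"
    then have "T (x - y) = 0" by (simp add: linear_diff[OF linT])
    then have "norm (x - y) = 0" using normT[of "x - y"] by simp
    then show "x = y" by simp
  qed
  have dimT: "dim (range T) = CARD('m)" using dim_image_eq[OF linT, of UNIV] injT by simp
  define E where "E = {z. \<forall>t\<in>range T. orthogonal t z}"
  have subE: "subspace E" unfolding E_def by (rule subspace_orthogonal_to_vectors)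
  have "dim {z \<in> UNIV. \<forall>t\<in>range T. orthogonal t z} + dim (range T) = dim (UNIV :: (real^'b::_) set)"
    by (rule dim_subspace_orthogonal_to_vectors[OF linear_subspace_image[OF linT subspace_UNIV] subspace_UNIV subset_UNIV])
  then have "dim E = CARD('m)" unfolding E_def using dim dimT by simp
  then have d: "dim (UNIV :: (real^'m) set) = dim E" by simp
  obtain S :: "real^'m \<Rightarrow> real^'b::_"
    where S: "linear S" "range S = E" and "\<And>y. y \<in> UNIV \<Longrightarrow> norm (S y) = norm y"
    by (rule isometry_subspaces[OF subspace_UNIV subE d], rule that)
  then have normS: "norm (S y) = norm y" for y by simp
  define u where "u i = (\<chi> j. S (axis j 1) $ i)" for i
  have yu: "y \<bullet> u i = S y $ i" for y i
  proof -
    have "y = (\<Sum>j\<in>UNIV. (y $ j) *\<^sub>R axis j 1)"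
      by (simp only: scalar_mult_eq_scaleR[symmetric] basis_expansion)
    then have "S y = S (\<Sum>j\<in>UNIV. (y $ j) *\<^sub>R axis j 1)" by (rule arg_cong)
    also have "\<dots> = (\<Sum>j\<in>UNIV. (y $ j) *\<^sub>R S (axis j 1))"
      by (simp only: linear_sum[OF S(1)] linear_cmul[OF S(1)])
    finally have "S y = (\<Sum>j\<in>UNIV. (y $ j) *\<^sub>R S (axis j 1))" .
    then show ?thesis by (simp add: u_def inner_vec_def)
  qed
  have iso: "(\<Sum>i\<in>UNIV. (x \<bullet> w i + y \<bullet> u i)\<^sup>2) = (norm x)\<^sup>2 + (norm y)\<^sup>2" for x y
  proof -
    have "S y \<in> E" using S(2) by blast
    then have "orthogonal (T x) (S y)" by (auto simp: E_def)
    then have "(norm (T x + S y))\<^sup>2 = (norm (T x))\<^sup>2 + (norm (S y))\<^sup>2" by (rule norm_add_Pythagorean)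
    then show ?thesis unfolding normT normS by (simp add: norm_cart T_def yu)
  qed
  \<comment> \<open>These form a Parseval frame with as many vectors as dimensions: each norm is at
    most 1 and the squared norms sum to the number of vectors, so all norms are 1.\<close>
  define p where "p i = (w i, u i)" for i
  have parsp: "(\<Sum>i\<in>UNIV. (q \<bullet> p i)\<^sup>2) = (norm q)\<^sup>2" for q
    using iso[of "fst q" "snd q"] by (simp add: p_def inner_prod_def norm_prod_def)
  have le1: "(norm (p i))\<^sup>2 \<le> 1" for i
  proof -
    have "(p i \<bullet> p i)\<^sup>2 \<le> (\<Sum>i'\<in>UNIV. (p i \<bullet> p i')\<^sup>2)"
      by (rule member_le_sum) auto
    then have le: "(p i \<bullet> p i) * (p i \<bullet> p i) \<le> p i \<bullet> p i"
      unfolding parsp by (simp only: power2_norm_eq_inner power2_eq_square[of "p i \<bullet> p i"])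
    show ?thesis
    proof (rule ccontr)
      assume "\<not> ?thesis"
      then have "1 < p i \<bullet> p i" by (simp add: power2_norm_eq_inner)
      then have "(p i \<bullet> p i) * 1 < (p i \<bullet> p i) * (p i \<bullet> p i)" by (intro mult_strict_left_mono) auto
      with le show False by simp
    qed
  qed
  have "(\<Sum>i\<in>UNIV. (norm (p i))\<^sup>2) = real (DIM((real^'m) \<times> (real^'m)))"
    by (rule frame_norm_sum[OF parsp])
  then have "(\<Sum>i\<in>UNIV. 1 - (norm (p i))\<^sup>2) = 0" using dim by (simp add: sum_subtractf)
  then have "1 - (norm (p i))\<^sup>2 = 0" for i
    using le1 by (subst (asm) sum_nonneg_eq_0_iff) auto
  then have "(norm (w i))\<^sup>2 + (norm (u i))\<^sup>2 = 1" for i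
    by (simp add: p_def norm_prod_def)
  with iso show thesis by (rule that)
qed

section \<open>Volume of slabs\<close>

text \<open>The open interval suits the continuity condition of the section bound; the integral is
  evaluated over the closed one, which differs by two points.\<close>

lemma Fourier_indicator:
  assumes a: "0 < a"
  shows "(\<integral>z. iexp (t * z) * complex_of_real (indicator {-a<..<a} z) \<partial>lborel) = complex_of_real (2 * a * sincr (a * t))"
proof -
  have "has_bochner_integral lborel (\<lambda>z. indicator {-a..a} z *\<^sub>R iexp (t * z)) (complex_of_real (2 * a * sincr (a * t)))"
  proof (cases "t = 0")
    case True
    have "has_bochner_integral lborel (\<lambda>z. indicator {-a..a} z *\<^sub>R (1::complex)) (complex_of_real a - complex_of_real (-a))"
      using a by (intro has_bochner_integral_FTC_Icc) (auto intro!: derivative_eq_intros)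
    then show ?thesis using True by (simp add: sincr_def)
  next
    case False
    let ?F = "\<lambda>z. iexp (t * z) / (\<i> * complex_of_real t)"
    have "has_bochner_integral lborel (\<lambda>z. indicator {-a..a} z *\<^sub>R iexp (t * z)) (?F a - ?F (-a))"
    proof (rule has_bochner_integral_FTC_Icc)
      fix z
      have "((\<lambda>z. exp (\<i> * (complex_of_real t * z)) / (\<i> * complex_of_real t)) has_field_derivative
         exp (\<i> * (complex_of_real t * complex_of_real z))) (at (complex_of_real z))"
        using False by (auto intro!: derivative_eq_intros) (simp add: mult_ac)
      from has_vector_derivative_real_field[OF this, of "{-a..a}"]
      show "(?F has_vector_derivative iexp (t * z)) (at z within {-a..a})" by simp
    qed (use a in \<open>auto intro!: continuous_intros\<close>)
    moreover have "?F a - ?F (-a) = complex_of_real (2 * a * sincr (a * t))"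
    proof -
      have "iexp (t * a) - iexp (t * (-a)) = 2 * \<i> * sin (complex_of_real (a * t))"
        by (simp add: sin_exp_eq mult_ac)
      also have "\<dots> = 2 * \<i> * complex_of_real (sin (a * t))" by (simp only: sin_of_real)
      finally have "iexp (t * a) - iexp (t * (-a)) = 2 * \<i> * complex_of_real (sin (a * t))" .
      then show ?thesis using False a by (simp add: diff_divide_distrib[symmetric] sincr_def)
    qed
    ultimately show ?thesis by simp
  qed
  then have "(\<integral>z. indicator {-a..a} z *\<^sub>R iexp (t * z) \<partial>lborel) = complex_of_real (2 * a * sincr (a * t))"
    by (rule has_bochner_integral_integral_eq)
  moreover have "(\<integral>z. iexp (t * z) * complex_of_real (indicator {-a<..<a} z) \<partial>lborel) = (\<integral>z. indicator {-a..a} z *\<^sub>R iexp (t * z) \<partial>lborel)"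
    using AE_lborel_singleton[of a] AE_lborel_singleton[of "-a"]
    by (intro integral_cong_AE) (auto elim!: eventually_elim2 simp: indicator_def)
  ultimately show ?thesis by simp
qed

lemma nn_integral_pos:
  fixes g :: "real \<Rightarrow> real"
  assumes "isCont g x" "0 < g x" "g \<in> borel_measurable borel"
  shows "0 < (\<integral>\<^sup>+x. ennreal (g x) \<partial>lborel)"
proof -
  have "\<forall>\<^sub>F y in nhds x. g x / 2 < g y"
    using assms(1,2) by (intro order_tendstoD(1)[of g "g x"]) (auto simp: isCont_def tendsto_at_iff_tendsto_nhds)
  then obtain d where d: "0 < d" "\<And>y. dist y x < d \<Longrightarrow> g x / 2 < g y"
    by (auto simp: eventually_nhds_metric)
  have "0 < ennreal (g x / 2) * emeasure lborel {x..x + d / 2}"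
    using assms(2) d(1) by (simp add: ennreal_zero_less_mult_iff)
  also have "\<dots> = (\<integral>\<^sup>+y. ennreal (g x / 2) * indicator {x..x + d / 2} y \<partial>lborel)"
    by (simp add: nn_integral_cmult_indicator)
  also have "\<dots> \<le> (\<integral>\<^sup>+y. ennreal (g y) \<partial>lborel)"
    using d by (intro nn_integral_mono) (auto simp: indicator_def dist_real_def intro!: ennreal_leI less_imp_le[OF d(2)])
  finally show ?thesis .
qed

text \<open>The zeros of the sine are countable, so they cannot fill an open interval.\<close>

lemma sinc_nonzero_dense:
  fixes c a b :: real
  assumes "c \<noteq> 0" "a < b"
  shows "\<exists>x\<in>{a<..<b}. sincr (c * x) \<noteq> 0"
proof (rule ccontr)
  assume n: "\<not> ?thesis"
  have z: "sin (c * x) = 0" if "x \<in> {a<..<b}" for x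
  proof -
    have "sincr (c * x) = 0" using n that by blast
    then show ?thesis by (simp add: sincr_def split: if_splits)
  qed
  have "{a<..<b} \<subseteq> range (\<lambda>i::int. of_int i * pi / c)"
  proof
    fix x assume "x \<in> {a<..<b}"
    then obtain i :: int where "c * x = of_int i * pi" using z sin_zero_iff_int2 by blast
    then have "x = of_int i * pi / c" using assms(1) by (simp add: field_simps)
    then show "x \<in> range (\<lambda>i::int. of_int i * pi / c)" by blast
  qed
  then have "countable {a<..<b}" by (rule countable_subset) simp
  then show False using uncountable_open_interval[of a b] assms(2) by simp
qed

lemma ennreal_mult3:
  "0 \<le> a \<Longrightarrow> 0 \<le> b \<Longrightarrow> 0 \<le> c \<Longrightarrow> ennreal a * (ennreal b * ennreal c) = ennreal (a * (b * c))"
  by (simp add: ennreal_mult)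

text \<open>The bound on \<open>s\<close> puts the exponent p = 1 / s^2 into the range of Ball's
  inequality. The factor 1 / s of the substitution cancels against sqrt (2 / p) = s * sqrt 2, so
  \<open>s\<close> survives only in the power of \<open>2 * a\<close>.\<close>

lemma nn_integral_sinc_scaled:
  assumes a: "0 < a" and s: "0 < s" "s\<^sup>2 \<le> 1/2"
  shows "(\<integral>\<^sup>+x. ennreal (\<bar>2 * a * sincr (a * (s * x))\<bar> powr (1 / s\<^sup>2)) \<partial>lborel) \<le> ennreal ((2 * a) powr (1 / s\<^sup>2) * (pi * sqrt 2 / a))"
proof -
  let ?p = "1 / s\<^sup>2"
  have p: "2 \<le> ?p" using s by (simp add: field_simps)
  have "(\<integral>\<^sup>+x. ennreal (\<bar>sincr x\<bar> powr ?p) \<partial>lborel) = ennreal (a * s) * (\<integral>\<^sup>+x. ennreal (\<bar>sincr (0 + a * s * x)\<bar> powr ?p) \<partial>lborel)"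
    using a s nn_integral_real_affine[of "\<lambda>x. ennreal (\<bar>sincr x\<bar> powr ?p)" "a * s" 0] by simp
  then have 1: "ennreal (1 / (a * s)) * (\<integral>\<^sup>+x. ennreal (\<bar>sincr x\<bar> powr ?p) \<partial>lborel) = (\<integral>\<^sup>+x. ennreal (\<bar>sincr (a * (s * x))\<bar> powr ?p) \<partial>lborel)"
    using a s by (simp add: mult.assoc[symmetric] flip: ennreal_mult' del: abs_divide)
  have "(\<integral>\<^sup>+x. ennreal (\<bar>2 * a * sincr (a * (s * x))\<bar> powr ?p) \<partial>lborel)
    = (\<integral>\<^sup>+x. ennreal ((2 * a) powr ?p) * ennreal (\<bar>sincr (a * (s * x))\<bar> powr ?p) \<partial>lborel)"
    using a by (intro nn_integral_cong) (simp add: abs_mult powr_mult flip: ennreal_mult' del: abs_divide)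
  also have "\<dots> = ennreal ((2 * a) powr ?p) * (\<integral>\<^sup>+x. ennreal (\<bar>sincr (a * (s * x))\<bar> powr ?p) \<partial>lborel)"
    by (rule nn_integral_cmult) measurable
  also have "\<dots> = ennreal ((2 * a) powr ?p) * (ennreal (1 / (a * s)) * (\<integral>\<^sup>+x. ennreal (\<bar>sincr x\<bar> powr ?p) \<partial>lborel))"
    unfolding 1 ..
  also have "\<dots> \<le> ennreal ((2 * a) powr ?p) * (ennreal (1 / (a * s)) * ennreal (pi * sqrt (2 / ?p)))"
    by (intro mult_left_mono Ball_integral_inequality p) auto
  also have "\<dots> = ennreal ((2 * a) powr ?p * (1 / (a * s) * (pi * sqrt (2 / ?p))))"
    using a s by (intro ennreal_mult3) auto
  also have "1 / (a * s) * (pi * sqrt (2 / ?p)) = pi * sqrt 2 / a"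
    using a s by (simp add: real_sqrt_mult)
  finally show ?thesis .
qed

text \<open>A family of vectors indexed by \<open>J\<close> is padded by zero vectors to twice the dimension; the padded
  indices carry Gaussian weights, whose contribution cancels against the factor \<open>1 / (2 * pi)\<close> of the
  Fourier inversion.\<close>

lemma frame_Fourier_product_bound:
  fixes u :: "'b::{finite,wellorder} \<Rightarrow> real^'m::{finite,wellorder}" and a :: "'b \<Rightarrow> real"
  assumes pars: "\<And>y. (\<Sum>i\<in>UNIV. (y \<bullet> u i)\<^sup>2) = (norm y)\<^sup>2"
    and uJ: "\<And>i. i \<in> J \<Longrightarrow> (norm (u i))\<^sup>2 \<le> 1/2" and uX: "\<And>i. i \<notin> J \<Longrightarrow> norm (u i) = 1"
    and a: "\<And>i. i \<in> J \<Longrightarrow> 0 < a i"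
  defines "r \<equiv> \<lambda>i t. if i \<in> J then 2 * a i * sincr (a i * t) else 2 * pi * std_normal_density t"
  defines "B \<equiv> \<lambda>i. if i \<in> J then 2 * a i * (pi * sqrt 2 / a i) powr (norm (u i))\<^sup>2 else 2 * pi"
  shows "(\<integral>\<^sup>+y. ennreal (\<Prod>i\<in>UNIV. \<bar>r i (y \<bullet> u i)\<bar>) \<partial>lborel) \<le> ennreal (\<Prod>i\<in>UNIV. B i)"
proof -
  \<comment> \<open>For \<open>u i = 0\<close> the exponent \<open>1 / (norm (u i))^2\<close> is
    meaningless; such factors are constant and are taken out of the integral.\<close>
  define I where "I = {i. u i \<noteq> 0}"
  \<comment> \<open>The power undoes the exponent that the Brascamp-Lieb inequality puts on each
    factor.\<close>
  define g where "g i s = \<bar>r i (norm (u i) * s)\<bar> powr (1 / (norm (u i))\<^sup>2)" for i s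
  let ?R = "\<lambda>y. (\<Prod>i\<in>UNIV. \<bar>r i (y \<bullet> u i)\<bar>)"
  let ?q = "\<lambda>i. (norm (u i))\<^sup>2"
  let ?G = "\<lambda>i. (\<integral>\<^sup>+x. ennreal (g i x) \<partial>lborel)"
  let ?h = "\<lambda>i y. g i ((y \<bullet> u i) / norm (u i)) powr ?q i"
  have rm [measurable]: "r i \<in> borel_measurable borel" for i unfolding r_def by (cases "i \<in> J") simp_all
  have rcont: "isCont (r i) t" for i t
    unfolding r_def by (cases "i \<in> J") (auto simp: normal_density_def intro!: continuous_intros isCont_o2[OF _ isCont_sincr])
  have parsI: "(\<Sum>i\<in>I. (y \<bullet> u i)\<^sup>2) = (norm y)\<^sup>2" for y
    unfolding pars[symmetric] by (rule sum.mono_neutral_left) (auto simp: I_def)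
  have gcont: "isCont (g i) s" if "i \<in> I" for i s
  proof -
    have "isCont (\<lambda>s. r i (norm (u i) * s)) s"
      by (rule isCont_o2[OF _ rcont]) (intro continuous_intros)
    from tendsto_powr'[OF tendsto_rabs[OF this[unfolded isCont_def]] tendsto_const, of "1 / ?q i"]
    show ?thesis unfolding isCont_def g_def using that by (simp add: I_def)
  qed
  have gm [measurable]: "g i \<in> borel_measurable borel" for i unfolding g_def[abs_def] by measurable
  have gpos: "\<exists>x\<in>{b<..<c}. 0 < g i x" if i: "i \<in> I" and bc: "b < c" for i b c
  proof -
    have "\<exists>x\<in>{b<..<c}. r i (norm (u i) * x) \<noteq> 0"
    proof (cases "i \<in> J")
      case True
      then obtain x where "x \<in> {b<..<c}" "sincr ((a i * norm (u i)) * x) \<noteq> 0"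
        using sinc_nonzero_dense[of "a i * norm (u i)" b c] a[of i] i bc by (auto simp: I_def)
      then show ?thesis using True a[of i] by (intro bexI[of _ x]) (auto simp: r_def mult.assoc)
    next
      case False
      obtain x where "b < x" "x < c" using bc dense by blast
      then show ?thesis using False normal_density_pos[of 1 0 "norm (u i) * x"]
        by (intro bexI[of _ x]) (auto simp: r_def)
    qed
    then show ?thesis by (auto simp: g_def)
  qed
  define M where "M i = enn2real (?G i)" for i
  have Mle: "(?G i) \<le> ennreal (B i powr (1 / ?q i))" if i: "i \<in> I" for i
  proof (cases "i \<in> J")
    case True
    have u0: "0 < norm (u i)" using i by (simp add: I_def)
    have "(?G i) \<le> ennreal ((2 * a i) powr (1 / ?q i) * (pi * sqrt 2 / a i))"
      using nn_integral_sinc_scaled[OF a[OF True] u0 uJ[OF True]] True by (simp add: g_def r_def)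
    also have "(2 * a i) powr (1 / ?q i) * (pi * sqrt 2 / a i) = B i powr (1 / ?q i)"
      using a[OF True] u0 True by (simp add: B_def powr_mult powr_powr)
    finally show ?thesis .
  next
    case False
    have "(?G i) = (\<integral>\<^sup>+x. ennreal (2 * pi) * ennreal (std_normal_density x) \<partial>lborel)"
      using False uX[OF False] by (intro nn_integral_cong) (simp add: g_def r_def abs_mult flip: ennreal_mult')
    also have "\<dots> = ennreal (2 * pi) * (\<integral>\<^sup>+x. ennreal (std_normal_density x) \<partial>lborel)"
      by (rule nn_integral_cmult) simp
    also have "(\<integral>\<^sup>+x. ennreal (std_normal_density x) \<partial>lborel) = 1"
      using prob_space.emeasure_space_1[OF prob_space_normal_density[of 1 0]] by (simp add: emeasure_density)
    finally show ?thesis using False uX[OF False] by (simp add: B_def)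
  qed
  have B0: "0 \<le> B i" for i
    unfolding B_def using a[of i] by (cases "i \<in> J") (auto simp: zero_le_mult_iff)
  have M1: "(?G i) = ennreal (M i)" if "i \<in> I" for i
  proof -
    have "(?G i) < \<top>" using Mle[OF that] by (rule le_less_trans) simp
    then show ?thesis by (simp add: M_def)
  qed
  have M2: "0 < M i" if i: "i \<in> I" for i
  proof -
    obtain x where "0 < g i x" using gpos[OF i, of 0 1] by auto
    from nn_integral_pos[OF gcont[OF i] this gm] show ?thesis unfolding M1[OF i] by simp
  qed
  have M3: "M i powr ?q i \<le> B i" if i: "i \<in> I" for i
  proof -
    have "M i \<le> B i powr (1 / ?q i)"
      using Mle[OF i] unfolding M1[OF i] by (subst (asm) ennreal_le_iff) auto
    then have "M i powr ?q i \<le> (B i powr (1 / ?q i)) powr ?q i"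
      using M2[OF i] by (intro powr_mono2) auto
    also have "\<dots> = B i" using i B0[of i] by (simp add: powr_powr I_def)
    finally show ?thesis .
  qed
  have split: "(\<Prod>i\<in>UNIV. f i) = (\<Prod>i\<in>I. f i) * (\<Prod>i\<in>-I. f i)" for f :: "'b \<Rightarrow> real"
    by (subst prod.union_disjoint[symmetric]) auto
  \<comment> \<open>The transform at 0 is the length \<open>2 * a i\<close> of the interval, and
    \<open>B i\<close> has the same value because its exponent is 0.\<close>
  have notI: "\<bar>r i (y \<bullet> u i)\<bar> = B i" if "i \<in> -I" for i y
  proof -
    have u0: "u i = 0" using that by (simp add: I_def)
    then have J: "i \<in> J" using uX[of i] by force
    show ?thesis using u0 J a[OF J] by (simp add: r_def B_def sincr_def)
  qed
  have BL: "(\<integral>\<^sup>+y. ennreal (\<Prod>i\<in>I. ?h i y) \<partial>lborel)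
    \<le> ennreal (\<Prod>i\<in>I. M i powr ?q i)"
  proof (rule geometric_Brascamp_Lieb[OF _ parsI])
    show "u i \<noteq> 0" if "i \<in> I" for i using that by (simp add: I_def)
    show "0 \<le> g i x" for i x by (simp add: g_def)
  qed (use gcont gpos M1 M2 in auto)
  have "(\<integral>\<^sup>+y. ennreal (?R y) \<partial>lborel)
    = (\<integral>\<^sup>+y. ennreal (\<Prod>i\<in>-I. B i) * ennreal (\<Prod>i\<in>I. ?h i y) \<partial>lborel)"
  proof (rule nn_integral_cong)
    fix y
    have "\<bar>r i (y \<bullet> u i)\<bar> = ?h i y" if "i \<in> I" for i
      using that by (simp add: g_def powr_powr I_def)
    then have "(?R y) = (\<Prod>i\<in>-I. B i) * (\<Prod>i\<in>I. ?h i y)"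
      unfolding split using notI by (simp add: mult.commute)
    then show "ennreal (?R y) = ennreal (\<Prod>i\<in>-I. B i) * ennreal (\<Prod>i\<in>I. ?h i y)"
      using B0 by (simp add: ennreal_mult' prod_nonneg)
  qed
  also have "\<dots> = ennreal (\<Prod>i\<in>-I. B i) * (\<integral>\<^sup>+y. ennreal (\<Prod>i\<in>I. ?h i y) \<partial>lborel)"
    by (rule nn_integral_cmult) measurable
  also have "\<dots> \<le> ennreal (\<Prod>i\<in>-I. B i) * ennreal (\<Prod>i\<in>I. M i powr ?q i)"
    by (intro mult_left_mono BL) simp
  also have "\<dots> \<le> ennreal (\<Prod>i\<in>-I. B i) * ennreal (\<Prod>i\<in>I. B i)"
    by (intro mult_left_mono ennreal_leI prod_mono) (auto intro: M3)
  also have "\<dots> = ennreal (\<Prod>i\<in>UNIV. B i)"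
    unfolding split[of B] using B0 by (simp add: ennreal_mult' prod_nonneg mult.commute)
  finally show ?thesis .
qed

text \<open>The section bound is applied to indicators of intervals. At padded indices
  \<open>w i = 0\<close>, where the unnormalised Gaussian weight takes the value 1, so that the
  padding leaves the indicator of the slab unchanged.\<close>

lemma frame_slab_volume_open:
  fixes w :: "'b::{finite,wellorder} \<Rightarrow> real^'m::{finite,wellorder}" and a :: "'b \<Rightarrow> real"
  assumes pars: "\<And>x. (\<Sum>i\<in>UNIV. (x \<bullet> w i)\<^sup>2) = (norm x)\<^sup>2" and dim: "CARD('b) = 2 * CARD('m)"
    and w0: "\<And>i. i \<notin> J \<Longrightarrow> w i = 0" and half: "\<And>i. i \<in> J \<Longrightarrow> 1/2 \<le> (norm (w i))\<^sup>2"
    and a: "\<And>i. i \<in> J \<Longrightarrow> 0 < a i"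
  shows "emeasure lborel {x. \<forall>i\<in>J. \<bar>x \<bullet> w i\<bar> < a i}
    \<le> ennreal (2 ^ CARD('m) * 2 powr ((real (card J) - real CARD('m)) / 2) * (\<Prod>i\<in>J. a i powr (norm (w i))\<^sup>2))"
proof -
  obtain u :: "'b \<Rightarrow> real^'m::_" where iso: "\<And>x y. (\<Sum>i\<in>UNIV. (x \<bullet> w i + y \<bullet> u i)\<^sup>2) = (norm x)\<^sup>2 + (norm y)\<^sup>2"
    and wu: "\<And>i. (norm (w i))\<^sup>2 + (norm (u i))\<^sup>2 = 1"
    using frame_complement[OF pars dim] by blast
  define n where "n = CARD('m)"
  define N where "N = card J"
  define \<rho> where "\<rho> i z = (if i \<in> J then indicator {-a i<..<a i} z else exp (- z\<^sup>2 / 2))" for i and z :: real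
  define r where "r = (\<lambda>i t. if i \<in> J then 2 * a i * sincr (a i * t) else 2 * pi * std_normal_density t)"
  define B where "B = (\<lambda>i. if i \<in> J then 2 * a i * (pi * sqrt 2 / a i) powr (norm (u i))\<^sup>2 else 2 * pi)"
  let ?F = "(\<integral>\<^sup>+x. ennreal (\<Prod>i\<in>UNIV. \<rho> i (x \<bullet> w i)) \<partial>lborel)"
  let ?S = "{x. \<forall>i\<in>J. \<bar>x \<bullet> w i\<bar> < a i}"
  let ?I = "(\<integral>\<^sup>+\<eta>. ennreal (\<Prod>i\<in>UNIV. \<bar>r i (\<eta> \<bullet> u i)\<bar>) \<partial>lborel)"
  let ?r = "\<lambda>i. (norm (w i))\<^sup>2"
  let ?q = "\<lambda>i. (norm (u i))\<^sup>2"
  let ?a = "(\<Prod>i\<in>J. a i powr ?r i)"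
  have gauss0: "(\<integral>z. iexp (t * z) * complex_of_real (exp (- z\<^sup>2 / 2)) \<partial>lborel) = complex_of_real (2 * pi * std_normal_density t)" for t
    using gauss_Fourier_1(2)[of 1 t] by (simp add: mult.commute)
  have intg: "integrable lborel (\<lambda>z::real. exp (- z\<^sup>2 / 2))"
  proof -
    have "integrable lborel (\<lambda>z. sqrt (2 * pi) * std_normal_density z)" by simp
    then show ?thesis by (simp add: normal_density_def)
  qed
  have "?F
    \<le> ennreal ((1 / (2 * pi)) ^ CARD('m)) * ?I"
  proof (rule Fourier_section_bound[OF iso dim])
    show "integrable lborel (\<rho> i)" for i
    proof (cases "i \<in> J")
      case True
      have "integrable lborel (indicator {-a i<..<a i} :: real \<Rightarrow> real)"
        using a[OF True] by (intro integrable_real_indicator) auto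
      then show ?thesis unfolding \<rho>_def using True by simp
    next
      case False
      then show ?thesis unfolding \<rho>_def using intg by simp
    qed
    show "0 \<le> \<rho> i z" for i z by (simp add: \<rho>_def)
    show "r i \<in> borel_measurable borel" for i unfolding r_def by (cases "i \<in> J") simp_all
    show "(\<integral>z. iexp (t * z) * complex_of_real (\<rho> i z) \<partial>lborel) = complex_of_real (r i t)" for i t
      using Fourier_indicator[OF a, of i t] gauss0[of t] by (cases "i \<in> J") (simp_all add: \<rho>_def r_def)
    show "isCont (\<rho> i) z" if "\<rho> i z \<noteq> 0" for i z
    proof (cases "i \<in> J")
      case True
      then have z: "z \<in> {-a i<..<a i}" using that by (auto simp: \<rho>_def indicator_def split: if_splits)
      have "\<forall>\<^sub>F x in nhds z. \<rho> i x = 1"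
        using eventually_nhds_in_open[OF open_greaterThanLessThan z] True
        by (auto simp: \<rho>_def elim!: eventually_mono)
      then have "isCont (\<rho> i) z \<longleftrightarrow> isCont (\<lambda>_. 1 :: real) z" by (rule isCont_cong)
      then show ?thesis by simp
    next
      case False
      then show ?thesis unfolding \<rho>_def by (auto intro!: continuous_intros)
    qed
  qed
  also have "\<dots> \<le> ennreal ((1 / (2 * pi)) ^ CARD('m)) * ennreal (\<Prod>i\<in>UNIV. B i)"
  proof (intro mult_left_mono)
    have "?q i \<le> 1/2" if "i \<in> J" for i using wu[of i] half[OF that] by linarith
    moreover have "norm (u i) = 1" if "i \<notin> J" for i 
      using wu[of i] w0[OF that] power2_eq_imp_eq[of "norm (u i)" 1] by simp
    moreover have "(\<Sum>i\<in>UNIV. (y \<bullet> u i)\<^sup>2) = (norm y)\<^sup>2" for y using iso[of 0 y] by simp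
    ultimately show "?I \<le> ennreal (\<Prod>i\<in>UNIV. B i)"
      unfolding r_def B_def by (intro frame_Fourier_product_bound a)
  qed simp
  also have "\<dots> = ennreal ((1 / (2 * pi)) ^ n * (\<Prod>i\<in>UNIV. B i))"
    by (simp add: ennreal_mult' n_def)
  \<comment> \<open>The exponents of \<open>pi\<close> cancel: - n + (N - n) + (2 n - N) = 0. The
    explicit factors 2 leave 2 ^ n, and \<open>sqrt 2\<close> to the power N - n gives the
    rest.\<close>
  also have "(1 / (2 * pi)) ^ n * (\<Prod>i\<in>UNIV. B i) = 2 ^ n * 2 powr ((real N - real n) / 2) * ?a"
  proof -
    have NJ: "card (-J) + N = 2 * n"
      using dim card_Un_disjoint[of J "-J"] by (simp add: N_def n_def)
    have sumw: "(\<Sum>i\<in>J. ?r i) = real n"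
    proof -
      have "(\<Sum>i\<in>J. ?r i) = (\<Sum>i\<in>UNIV. ?r i)"
        using w0 by (intro sum.mono_neutral_left) auto
      then show ?thesis using frame_norm_sum[OF pars] by (simp add: n_def)
    qed
    have sumu: "(\<Sum>i\<in>J. ?q i) = real N - real n"
    proof -
      have "(\<Sum>i\<in>J. ?q i) = (\<Sum>i\<in>J. 1 - ?r i)"
        by (intro sum.cong refl) (use wu in \<open>simp add: algebra_simps\<close>)
      then show ?thesis by (simp add: sum_subtractf sumw N_def)
    qed
    have "(\<Prod>i\<in>J. B i) = (\<Prod>i\<in>J. 2 * ((pi * sqrt 2) powr ?q i * a i powr ?r i))"
    proof (intro prod.cong refl)
      fix i assume i: "i \<in> J"
      have "a i / a i powr ?q i = a i powr (1 - ?q i)" using a[OF i] by (simp add: powr_diff)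
      also have "1 - ?q i = ?r i" using wu[of i] by simp
      finally have e1: "a i / a i powr ?q i = a i powr ?r i" .
      have e2: "(pi * sqrt 2 / a i) powr ?q i = (pi * sqrt 2) powr ?q i / a i powr ?q i"
        using a[OF i] by (simp add: powr_divide)
      show "B i = 2 * ((pi * sqrt 2) powr ?q i * a i powr ?r i)"
        unfolding B_def if_P[OF i] e2 e1[symmetric] by simp
    qed
    also have "\<dots> = 2 ^ N * ((pi * sqrt 2) powr (real N - real n) * ?a)"
      by (simp add: prod.distrib N_def powr_sum[symmetric] sumu[unfolded N_def])
    finally have BJ: "(\<Prod>i\<in>J. B i) = 2 ^ N * ((pi * sqrt 2) powr (real N - real n) * ?a)" .
    have BX: "(\<Prod>i\<in>-J. B i) = (2 * pi) ^ card (-J)" by (simp add: B_def)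
    have "(\<Prod>i\<in>UNIV. B i) = (\<Prod>i\<in>J. B i) * (\<Prod>i\<in>-J. B i)"
      using prod.union_disjoint[of J "-J" B] by simp
    then have "(1 / (2 * pi)) ^ n * (\<Prod>i\<in>UNIV. B i)
       = ((1 / (2 * pi)) ^ n * 2 ^ N * (pi * sqrt 2) powr (real N - real n) * (2 * pi) ^ card (-J)) * ?a"
      unfolding BJ BX by (simp only: mult_ac)
    also have "(1 / (2 * pi)) ^ n * 2 ^ N * (pi * sqrt 2) powr (real N - real n) * (2 * pi) ^ card (-J)
        = 2 ^ n * 2 powr ((real N - real n) / 2)" (is "?L = ?R")
    proof -
      have c: "real (card (-J)) = 2 * real n - real N" using NJ by linarith
      have L0: "0 < ?L" by simp
      have "ln ?L = - real n * ln (2 * pi) + real N * ln 2 + (real N - real n) * ln (pi * sqrt 2) + real (card (-J)) * ln (2 * pi)"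
        by (simp add: ln_mult ln_realpow ln_powr ln_div algebra_simps)
      also have "\<dots> = real n * ln 2 + (real N - real n) / 2 * ln 2"
        unfolding c by (simp add: ln_mult ln_sqrt field_simps)
      also have "\<dots> = ln ?R" by (simp add: ln_mult ln_realpow ln_powr)
      finally have "ln ?L = ln ?R" .
      moreover have "0 < ?R" by simp
      ultimately show ?thesis using L0 ln_inj_iff by blast
    qed
    finally show ?thesis .
  qed
  finally have bound: "?F
    \<le> ennreal (2 ^ n * 2 powr ((real N - real n) / 2) * ?a)" .
  have meas: "?S \<in> sets lborel" by measurable
  have "emeasure lborel ?S = (\<integral>\<^sup>+x. indicator ?S x \<partial>lborel)"
    using meas by simp
  also have "\<dots> \<le> ?F"
  proof (intro nn_integral_mono)
    fix x
    have "(\<Prod>i\<in>UNIV. \<rho> i (x \<bullet> w i)) = 1" if x: "\<forall>i\<in>J. \<bar>x \<bullet> w i\<bar> < a i"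
    proof (intro prod.neutral ballI)
      fix i
      show "\<rho> i (x \<bullet> w i) = 1"
        using x w0[of i] by (cases "i \<in> J") (auto simp: \<rho>_def abs_less_iff indicator_def)
    qed
    then show "indicator ?S x \<le> ennreal (\<Prod>i\<in>UNIV. \<rho> i (x \<bullet> w i))"
      by (auto simp: indicator_def)
  qed
  also note bound
  finally show ?thesis by (simp add: n_def N_def)
qed

text \<open>The closed slab lies in open slabs whose bounds are enlarged by a factor tending to 1,
  and the estimate depends continuously on this factor.\<close>

lemma frame_slab_volume:
  fixes w :: "'b::{finite,wellorder} \<Rightarrow> real^'m::{finite,wellorder}" and a :: "'b \<Rightarrow> real"
  assumes pars: "\<And>x. (\<Sum>i\<in>UNIV. (x \<bullet> w i)\<^sup>2) = (norm x)\<^sup>2" and dim: "CARD('b) = 2 * CARD('m)"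
    and w0: "\<And>i. i \<notin> J \<Longrightarrow> w i = 0" and half: "\<And>i. i \<in> J \<Longrightarrow> 1/2 \<le> (norm (w i))\<^sup>2"
    and a: "\<And>i. i \<in> J \<Longrightarrow> 0 < a i"
  shows "emeasure lborel {x. \<forall>i\<in>J. \<bar>x \<bullet> w i\<bar> \<le> a i}
    \<le> ennreal (2 ^ CARD('m) * 2 powr ((real (card J) - real CARD('m)) / 2) * (\<Prod>i\<in>J. a i powr (norm (w i))\<^sup>2))"
proof -
  define e where "e k = 1 + 1 / (real k + 1)" for k :: nat
  have e: "1 < e k" for k by (simp add: e_def)
  have e1: "e \<longlonglongrightarrow> 1" unfolding e_def[abs_def] by real_asymp
  let ?C = "\<lambda>b. 2 ^ CARD('m) * 2 powr ((real (card J) - real CARD('m)) / 2) * (\<Prod>i\<in>J. b i powr (norm (w i))\<^sup>2)"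
  let ?S = "{x. \<forall>i\<in>J. \<bar>x \<bullet> w i\<bar> \<le> a i}"
  have le: "emeasure lborel ?S \<le> ennreal (?C (\<lambda>i. e k * a i))" for k
  proof -
    have "0 < e k * a i" if "i \<in> J" for i using a[OF that] e[of k] by simp
    from frame_slab_volume_open[OF pars dim w0 half this]
    have "emeasure lborel {x. \<forall>i\<in>J. \<bar>x \<bullet> w i\<bar> < e k * a i} \<le> ennreal (?C (\<lambda>i. e k * a i))" by simp
    moreover have "a i < e k * a i" if "i \<in> J" for i using a[OF that] e[of k] by simp
    then have "?S \<subseteq> {x. \<forall>i\<in>J. \<bar>x \<bullet> w i\<bar> < e k * a i}" by force
    then have "emeasure lborel ?S \<le> emeasure lborel {x. \<forall>i\<in>J. \<bar>x \<bullet> w i\<bar> < e k * a i}"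
      by (rule emeasure_mono) measurable
    ultimately show ?thesis by (rule order_trans[rotated])
  qed
  have "(\<lambda>k. ?C (\<lambda>i. e k * a i)) \<longlonglongrightarrow> ?C (\<lambda>i. 1 * a i)"
    by (intro tendsto_mult tendsto_const tendsto_prod tendsto_powr' e1) (use a in \<open>force+\<close>)
  then have "(\<lambda>k. ennreal (?C (\<lambda>i. e k * a i))) \<longlonglongrightarrow> ennreal (?C a)" by (intro tendsto_ennrealI) simp
  then show ?thesis by (rule LIMSEQ_le_const) (use le in auto)
qed

text \<open>The squared norms sum to the dimension and are at least 1/2, so \<open>J\<close> has at
  most twice as many elements as the dimension. It therefore embeds into an index type of exactly
  that size, with zero vectors at the remaining indices.\<close>

theorem frame_slab_volume_general:
  fixes w :: "'i \<Rightarrow> real^'m::{finite,wellorder}" and a :: "'i \<Rightarrow> real"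
  assumes fin: "finite J" and pars: "\<And>x. (\<Sum>i\<in>J. (x \<bullet> w i)\<^sup>2) = (norm x)\<^sup>2"
    and half: "\<And>i. i \<in> J \<Longrightarrow> 1/2 \<le> (norm (w i))\<^sup>2" and a: "\<And>i. i \<in> J \<Longrightarrow> 0 < a i"
  shows "emeasure lborel {x. \<forall>i\<in>J. \<bar>x \<bullet> w i\<bar> \<le> a i}
    \<le> ennreal (2 ^ CARD('m) * 2 powr ((real (card J) - real CARD('m)) / 2) * (\<Prod>i\<in>J. a i powr (norm (w i))\<^sup>2))"
proof -
  have "real (card J) * (1/2) \<le> (\<Sum>i\<in>J. (norm (w i))\<^sup>2)"
    using half by (intro sum_bounded_below) auto
  then have "card J \<le> card (UNIV :: ('m + 'm) idx set)" using frame_norm_sum[OF pars] by simp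
  from card_le_inj[OF fin finite this] obtain f :: "'i \<Rightarrow> ('m + 'm) idx" where f: "inj_on f J"
    by blast
  define g where "g = the_inv_into J f"
  have gf: "g (f i) = i" if "i \<in> J" for i unfolding g_def using f that by (rule the_inv_into_f_f)
  define w' where "w' k = (if k \<in> f ` J then w (g k) else 0)" for k
  have w': "w' (f i) = w i" if "i \<in> J" for i using that by (simp add: w'_def gf)
  have "emeasure lborel {x. \<forall>k\<in>f ` J. \<bar>x \<bullet> w' k\<bar> \<le> a (g k)}
    \<le> ennreal (2 ^ CARD('m) * 2 powr ((real (card (f ` J)) - real CARD('m)) / 2) * (\<Prod>k\<in>f ` J. a (g k) powr (norm (w' k))\<^sup>2))"
  proof (rule frame_slab_volume)
    fix x
    have "(\<Sum>k\<in>UNIV. (x \<bullet> w' k)\<^sup>2) = (\<Sum>k\<in>f ` J. (x \<bullet> w' k)\<^sup>2)"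
      by (rule sum.mono_neutral_right) (auto simp: w'_def)
    also have "\<dots> = (norm x)\<^sup>2" unfolding sum.reindex[OF f] using w' pars[of x] by simp
    finally show "(\<Sum>k\<in>UNIV. (x \<bullet> w' k)\<^sup>2) = (norm x)\<^sup>2" .
  next
    show "CARD(('m + 'm) idx) = 2 * CARD('m)" by simp
  next
    show "w' k = 0" if "k \<notin> f ` J" for k using that by (simp add: w'_def)
  next
    show "1/2 \<le> (norm (w' k))\<^sup>2" if "k \<in> f ` J" for k using that half w' by auto
  next
    show "0 < a (g k)" if "k \<in> f ` J" for k using that a gf by auto
  qed
  also have "{x. \<forall>k\<in>f ` J. \<bar>x \<bullet> w' k\<bar> \<le> a (g k)} = {x. \<forall>i\<in>J. \<bar>x \<bullet> w i\<bar> \<le> a i}"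
    by (auto simp: w' gf)
  also have "(\<Prod>k\<in>f ` J. a (g k) powr (norm (w' k))\<^sup>2) = (\<Prod>i\<in>J. a i powr (norm (w i))\<^sup>2)"
    unfolding prod.reindex[OF f] by (simp add: w' gf)
  also have "card (f ` J) = card J" using f by (rule card_image)
  finally show ?thesis .
qed

section \<open>Passage to linear subspaces\<close>

lemma distr_PiM_lborel_cart:
  fixes e :: "'m::finite \<Rightarrow> 'k"
  assumes bij: "bij_betw e UNIV K"
  shows "distr (\<Pi>\<^sub>M k\<in>K. lborel) borel (\<lambda>f. \<chi> i. f (e i)) = (lborel :: (real^'m) measure)"
proof (rule lborel_eqI[symmetric])
  interpret product_sigma_finite "\<lambda>_::'k. lborel :: real measure" ..
  let ?P = "\<Pi>\<^sub>M k\<in>K. (lborel :: real measure)"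
  let ?h = "\<lambda>f. (\<chi> i. f (e i)) :: real^'m"
  have fin: "finite K" using bij_betw_finite[OF bij] by simp
  have eK: "e i \<in> K" for i using bij by (auto simp: bij_betw_def)
  have h [measurable]: "?h \<in> ?P \<rightarrow>\<^sub>M borel"
  proof (rule borel_measurable_euclidean_space[THEN iffD2], rule ballI)
    fix b :: "real^'m" assume "b \<in> Basis"
    then obtain i where b: "b = axis i 1" by (auto simp: Basis_vec_def)
    have "(\<lambda>f. f (e i)) \<in> borel_measurable ?P" using eK[of i] by measurable
    then show "(\<lambda>f. ?h f \<bullet> b) \<in> borel_measurable ?P" by (simp add: b inner_axis)
  qed
  fix l u :: "real^'m" assume lu: "\<And>b. b \<in> Basis \<Longrightarrow> l \<bullet> b \<le> u \<bullet> b"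
  have le: "l $ i \<le> u $ i" for i
  proof -
    have "axis i 1 \<in> (Basis :: (real^'m) set)" by (auto simp: Basis_vec_def)
    from lu[OF this] show ?thesis by (simp add: inner_axis)
  qed
  define e' where "e' = inv e"
  have e'e: "e' (e i) = i" for i using bij by (simp add: e'_def bij_betw_def)
  have "?h -` box l u \<inter> space ?P = (\<Pi>\<^sub>E k\<in>K. {l $ e' k<..<u $ e' k})"
  proof (intro set_eqI iffI)
    fix f assume "f \<in> ?h -` box l u \<inter> space ?P"
    then show "f \<in> (\<Pi>\<^sub>E k\<in>K. {l $ e' k<..<u $ e' k})"
      using bij by (auto simp: mem_box_cart space_PiM PiE_def Pi_def bij_betw_def e'e)
  next
    fix f assume f: "f \<in> (\<Pi>\<^sub>E k\<in>K. {l $ e' k<..<u $ e' k})"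
    have "f k \<in> {l $ e' k<..<u $ e' k}" if "k \<in> K" for k
      using that f by (auto simp: PiE_def Pi_def)
    note f' = this[OF eK]
    have "f \<in> space ?P" using f by (auto simp: space_PiM PiE_def)
    then show "f \<in> ?h -` box l u \<inter> space ?P"
      using f' by (auto simp: mem_box_cart e'e)
  qed
  then have "emeasure (distr ?P borel ?h) (box l u) = (\<Prod>k\<in>K. emeasure lborel {l $ e' k<..<u $ e' k})"
    using emeasure_PiM[OF fin, of "\<lambda>k. {l $ e' k<..<u $ e' k}"] by (subst emeasure_distr) auto
  also have "\<dots> = (\<Prod>k\<in>K. ennreal (u $ e' k - l $ e' k))" by (simp add: le)
  also have "\<dots> = (\<Prod>i\<in>UNIV. ennreal (u $ i - l $ i))"
    using prod.reindex_bij_betw[OF bij, of "\<lambda>k. ennreal (u $ e' k - l $ e' k)"] by (simp add: e'e)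
  also have "\<dots> = (\<Prod>b\<in>Basis. ennreal ((u - l) \<bullet> b))"
  proof -
    have "bij_betw (\<lambda>i::'m. axis i (1::real)) UNIV Basis"
      by (auto simp: bij_betw_def inj_on_def axis_eq_axis Basis_vec_def)
    from prod.reindex_bij_betw[OF this, of "\<lambda>b. ennreal ((u - l) \<bullet> b)"]
    show ?thesis by (simp add: inner_axis)
  qed
  also have "\<dots> = ennreal (\<Prod>b\<in>Basis. (u - l) \<bullet> b)"
    by (rule prod_ennreal) (use lu in \<open>simp add: inner_diff_left\<close>)
  finally show "emeasure (distr ?P borel ?h) (box l u) = ennreal (\<Prod>b\<in>Basis. (u - l) \<bullet> b)" .
qed simp

lemma measurable_sum_scaleR_PiM:
  fixes B :: "'a::euclidean_space set"
  shows "(\<lambda>f. \<Sum>b\<in>B. f b *\<^sub>R b) \<in> (\<Pi>\<^sub>M b\<in>B. (lborel :: real measure)) \<rightarrow>\<^sub>M borel"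
  by measurable

text \<open>The slab in \<open>H\<close> times the cube on an orthonormal basis \<open>C\<close> of
  the orthogonal complement is a slab of the whole space: the vectors of \<open>C\<close>, with norm
  1 and bound 1, complete the frame. This multiplies the volume by 2 ^ card C and leaves the
  difference between the number of vectors and the dimension unchanged.\<close>

theorem subspace_slab_volume:
  fixes H :: "(real^'n) set" and w :: "'i \<Rightarrow> real^'n" and a :: "'i \<Rightarrow> real"
  assumes H: "subspace H" and fin: "finite J" and wH: "\<And>j. j \<in> J \<Longrightarrow> w j \<in> H"
    and pars: "\<And>x. x \<in> H \<Longrightarrow> (\<Sum>j\<in>J. (x \<bullet> w j)\<^sup>2) = (norm x)\<^sup>2"
    and half: "\<And>j. j \<in> J \<Longrightarrow> 1/2 \<le> (norm (w j))\<^sup>2" and a: "\<And>j. j \<in> J \<Longrightarrow> 0 < a j"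
  shows "emeasure (subspace_lborel H) {x\<in>H. \<forall>j\<in>J. \<bar>x \<bullet> w j\<bar> \<le> a j}
    \<le> ennreal (2 ^ dim H * 2 powr ((real (card J) - real (dim H)) / 2) * (\<Prod>j\<in>J. a j powr (norm (w j))\<^sup>2))"
proof -
  let ?a = "(\<Prod>j\<in>J. a j powr (norm (w j))\<^sup>2)"
  define B where "B = some_orthonormal_basis H"
  have B: "B \<subseteq> H" "pairwise orthogonal B" "\<And>b. b \<in> B \<Longrightarrow> norm b = 1" "span B = H"
    using some_orthonormal_basis[OF H] by (auto simp: orthonormal_basis_def B_def)
  define H' where "H' = {y. \<forall>x\<in>H. orthogonal x y}"
  have H': "subspace H'" unfolding H'_def by (rule subspace_orthogonal_to_vectors)
  obtain C where C: "C \<subseteq> H'" "pairwise orthogonal C" "\<And>c. c \<in> C \<Longrightarrow> norm c = 1" "span C = H'"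
    using orthonormal_basis_subspace[OF H'] by metis
  have finB: "finite B" and finC: "finite C" using B(2) C(2) by (auto intro: pairwise_orthogonal_imp_finite)
  have cardB: "card B = dim H" using orthonormal_card[OF B(2,3)] B(4) by simp
  have HC: "x \<bullet> c = 0" if "x \<in> H" "c \<in> C" for x c
    using that C(1) by (auto simp: H'_def orthogonal_def)
  have CH: "c \<bullet> x = 0" if "x \<in> H" "c \<in> C" for x c
    using HC[OF that] by (simp add: inner_commute)
  have disj: "B \<inter> C = {}"
  proof (rule ccontr)
    assume "\<not> ?thesis"
    then obtain b where "b \<in> B" "b \<in> C" by blast
    then have "b \<bullet> b = 0" using HC B(1) by blast
    then show False using B(3)[OF \<open>b \<in> B\<close>] by simp
  qed
  have orth: "pairwise orthogonal (B \<union> C)"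
    using B(1,2) C(2) HC CH unfolding pairwise_def orthogonal_def by blast
  have nrm: "norm b = 1" if "b \<in> B \<union> C" for b using that B(3) C(3) by auto
  have spn: "span (B \<union> C) = UNIV"
  proof -
    have "y \<in> span (B \<union> C)" for y
    proof -
      have "y - orth_proj H y \<in> H'" using orth_proj(2)[OF H] by (auto simp: H'_def orthogonal_commute)
      then have "y - orth_proj H y \<in> span (B \<union> C)" using C(4) span_mono[of C "B \<union> C"] by blast
      moreover have "orth_proj H y \<in> span (B \<union> C)"
        using orth_proj(1)[OF H, of y] B(4) span_mono[of B "B \<union> C"] by blast
      ultimately show ?thesis using span_add[of "y - orth_proj H y"] by fastforce
    qed
    then show ?thesis by blast
  qed
  have cardBC: "card (B \<union> C) = CARD('n)" using orthonormal_card[OF orth nrm] spn by simp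
  then have cardC: "card C = CARD('n) - dim H" "dim H + card C = CARD('n)"
    using card_Un_disjoint[OF finB finC disj] cardB by auto
  have "card (UNIV :: 'n idx set) = card (B \<union> C)" using cardBC by simp
  then obtain e :: "'n idx \<Rightarrow> real^'n" where e: "bij_betw e UNIV (B \<union> C)"
    using finite_same_card_bij[OF finite finite_UnI[OF finB finC]] by blast
  have eBC: "e i \<in> B \<union> C" for i using e by (auto simp: bij_betw_def)
  define X where "X z = (\<Sum>i\<in>UNIV. z $ i *\<^sub>R e i)" for z :: "real^'n idx"
  define Q where "Q y = (\<chi> i. y \<bullet> e i)" for y :: "real^'n"
  have XQ: "z \<bullet> Q y = X z \<bullet> y" for z y
  proof -
    have "z \<bullet> Q y = (\<Sum>i\<in>UNIV. z $ i * Q y $ i)" by (simp only: inner_vec_def inner_real_def)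
    also have "\<dots> = (\<Sum>i\<in>UNIV. z $ i * (e i \<bullet> y))" by (simp add: Q_def inner_commute)
    also have "\<dots> = X z \<bullet> y" by (simp only: X_def inner_sum_left inner_scaleR_left)
    finally show ?thesis .
  qed
  have sume: "(\<Sum>i\<in>UNIV. h (e i)) = (\<Sum>b\<in>B \<union> C. h b)" for h :: "real^'n \<Rightarrow> real"
    by (rule sum.reindex_bij_betw[OF e])
  have norm_cart: "(norm z)\<^sup>2 = (\<Sum>i\<in>UNIV. (z $ i)\<^sup>2)" for z :: "real^'n idx"
    by (simp only: power2_norm_eq_inner inner_vec_def inner_real_def) (simp only: power2_eq_square)
  have normBC: "(norm y)\<^sup>2 = (\<Sum>b\<in>B \<union> C. (y \<bullet> b)\<^sup>2)" for y
    using orthonormal_norm_sq(2)[OF orth nrm] spn by simp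
  have normQ: "norm (Q y) = norm y" for y
  proof -
    have "(norm (Q y))\<^sup>2 = (\<Sum>i\<in>UNIV. (y \<bullet> e i)\<^sup>2)" unfolding norm_cart by (simp add: Q_def)
    also have "\<dots> = (norm y)\<^sup>2" unfolding normBC by (rule sume)
    finally show ?thesis by simp
  qed
  have Xe: "X z \<bullet> e i = z $ i" for z i
  proof -
    have ee: "e j \<bullet> e i = (if j = i then 1 else 0)" for j
    proof (cases "j = i")
      case True
      then show ?thesis using nrm[OF eBC] by (simp add: norm_eq_1)
    next
      case False
      then have "e j \<noteq> e i" using e by (auto simp: bij_betw_def inj_on_def)
      then show ?thesis using False orth eBC by (auto simp: pairwise_def orthogonal_def)
    qed
    have "X z \<bullet> e i = (\<Sum>j\<in>UNIV. z $ j * (if j = i then 1 else 0))"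
      by (simp only: X_def inner_sum_left inner_scaleR_left ee)
    then show ?thesis by (simp add: if_distrib cong: if_cong)
  qed
  have normX: "(norm (X z))\<^sup>2 = (norm z)\<^sup>2" for z
    unfolding normBC sume[symmetric] Xe norm_cart ..
  let ?J = "J <+> C"
  define W where "W k = (case k of Inl j \<Rightarrow> Q (w j) | Inr c \<Rightarrow> Q c)" for k
  define A where "A k = (case k of Inl j \<Rightarrow> a j | Inr c \<Rightarrow> 1)" for k :: "'i + real^'n"
  let ?Z = "{z. \<forall>k\<in>?J. \<bar>z \<bullet> W k\<bar> \<le> A k}"
  have core: "emeasure lborel ?Z
    \<le> ennreal (2 ^ CARD('n idx) * 2 powr ((real (card ?J) - real CARD('n idx)) / 2) * (\<Prod>k\<in>?J. A k powr (norm (W k))\<^sup>2))"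
  proof (rule frame_slab_volume_general)
    show "finite ?J" using fin finC by simp
    show "1/2 \<le> (norm (W k))\<^sup>2" if "k \<in> ?J" for k using that half C(3) by (auto simp: W_def normQ)
    show "0 < A k" if "k \<in> ?J" for k using that a by (auto simp: A_def)
    fix z :: "real^'n idx"
    define x where "x = X z"
    \<comment> \<open>The orthogonal projection of \<open>x\<close> onto \<open>H\<close>: the
      vectors \<open>w j\<close> see only \<open>p\<close>, and those of \<open>C\<close> only the
      rest.\<close>
    define p where "p = (\<Sum>b\<in>B. (x \<bullet> b) *\<^sub>R b)"
    have pH: "p \<in> H" unfolding p_def using B(1) H by (intro subspace_sum subspace_scale) auto
    have "x = (\<Sum>b\<in>B \<union> C. (x \<bullet> b) *\<^sub>R b)" using orthonormal_norm_sq(1)[OF orth nrm] spn by simp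
    also have "\<dots> = p + (\<Sum>c\<in>C. (x \<bullet> c) *\<^sub>R c)" unfolding p_def by (rule sum.union_disjoint[OF finB finC disj])
    finally have xp: "x = p + (\<Sum>c\<in>C. (x \<bullet> c) *\<^sub>R c)" .
    have xh: "x \<bullet> h = p \<bullet> h" if "h \<in> H" for h
    proof -
      have "(\<Sum>c\<in>C. (x \<bullet> c) *\<^sub>R c) \<bullet> h = 0" using CH[OF that] by (simp add: inner_sum_left)
      then show ?thesis using arg_cong[OF xp, of "\<lambda>x. x \<bullet> h"] by (simp add: inner_add_left)
    qed
    have "(\<Sum>k\<in>?J. (z \<bullet> W k)\<^sup>2) = (\<Sum>j\<in>J. (x \<bullet> w j)\<^sup>2) + (\<Sum>c\<in>C. (x \<bullet> c)\<^sup>2)"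
      using fin finC by (simp add: sum.Plus W_def XQ x_def)
    also have "(\<Sum>j\<in>J. (x \<bullet> w j)\<^sup>2) = (norm p)\<^sup>2" using pars[OF pH] wH xh by simp
    also have "(norm p)\<^sup>2 = (\<Sum>b\<in>B. (p \<bullet> b)\<^sup>2)" using orthonormal_norm_sq(2)[OF B(2,3)] pH B(4) by simp
    also have "\<dots> = (\<Sum>b\<in>B. (x \<bullet> b)\<^sup>2)" using xh B(1) by (intro sum.cong refl) auto
    also have "(\<Sum>b\<in>B. (x \<bullet> b)\<^sup>2) + (\<Sum>c\<in>C. (x \<bullet> c)\<^sup>2) = (norm x)\<^sup>2"
      unfolding normBC by (rule sum.union_disjoint[OF finB finC disj, symmetric])
    also have "\<dots> = (norm z)\<^sup>2" unfolding x_def by (rule normX)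
    finally show "(\<Sum>k\<in>?J. (z \<bullet> W k)\<^sup>2) = (norm z)\<^sup>2" .
  qed
  have prodA: "(\<Prod>k\<in>?J. A k powr (norm (W k))\<^sup>2) = ?a"
    using fin finC by (simp add: prod.Plus A_def W_def normQ)
  have cardJ: "card ?J = card J + card C" using fin finC by (rule card_Plus)
  let ?p = "2 powr ((real (card J + card C) - real CARD('n)) / 2)"
  let ?E = "(\<Pi>\<^sub>E c\<in>C. {-1..1})"
  interpret product_sigma_finite "\<lambda>_::real^'n. lborel :: real measure" ..
  let ?PB = "\<Pi>\<^sub>M b\<in>B. (lborel :: real measure)" and ?PC = "\<Pi>\<^sub>M b\<in>C. (lborel :: real measure)"
    and ?PBC = "\<Pi>\<^sub>M b\<in>B \<union> C. (lborel :: real measure)"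
  let ?s = "\<lambda>f. \<Sum>b\<in>B. f b *\<^sub>R b"
  define S where "S = {x\<in>H. \<forall>j\<in>J. \<bar>x \<bullet> w j\<bar> \<le> a j}"
  let ?V = "emeasure (subspace_lborel H) S"
  let ?h = "\<lambda>f. (\<chi> i. f (e i)) :: real^'n idx"
  have Sb [measurable]: "S \<in> sets borel"
  proof -
    have "closed S"
    proof -
      have "closed (H \<inter> (\<Inter>j\<in>J. {x. \<bar>x \<bullet> w j\<bar> \<le> a j}))"
        using closed_subspace[OF H] by (intro closed_Int closed_INT ballI closed_Collect_le continuous_intros)
      also have "H \<inter> (\<Inter>j\<in>J. {x. \<bar>x \<bullet> w j\<bar> \<le> a j}) = S" by (auto simp: S_def)
      finally show ?thesis .
    qed
    then show ?thesis by (rule borel_closed)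
  qed
  have sm [measurable]: "?s \<in> ?PB \<rightarrow>\<^sub>M borel" by (rule measurable_sum_scaleR_PiM)
  have sm' [measurable]: "?s \<in> ?PBC \<rightarrow>\<^sub>M borel"
  proof -
    have "(\<lambda>f. f b) \<in> borel_measurable ?PBC" if "b \<in> B" for b
      using measurable_component_singleton[of b "B \<union> C" "\<lambda>_. lborel :: real measure"] that by simp
    then show ?thesis by (intro borel_measurable_sum borel_measurable_scaleR borel_measurable_const) auto
  qed
  \<comment> \<open>Slab times cube in coordinates with respect to \<open>B \<union> C\<close>; its
    measure factorises by Fubini, and the first factor is the volume in \<open>H\<close> by the
    definition of \<open>subspace_lborel\<close>.\<close>
  let ?T = "{f \<in> space ?PBC. ?s f \<in> S \<and> (\<forall>c\<in>C. f c \<in> {-1..1})}"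
  have Tm [measurable]: "?T \<in> sets ?PBC"
  proof -
    have "(\<lambda>f. f c) \<in> ?PBC \<rightarrow>\<^sub>M borel" if "c \<in> C" for c
      using measurable_component_singleton[of c "B \<union> C" "\<lambda>_. lborel :: real measure"] that by simp
    then have "Measurable.pred ?PBC (\<lambda>f. f c \<in> {-1..1})" if "c \<in> C" for c
      using that by (intro pred_sets2[of _ borel]) auto
    moreover have "Measurable.pred ?PBC (\<lambda>f. ?s f \<in> S)" by (intro pred_sets2[OF Sb sm'])
    ultimately have "Measurable.pred ?PBC (\<lambda>f. ?s f \<in> S \<and> (\<forall>c\<in>C. f c \<in> {-1..1}))"
      using finC by (intro pred_intros_logic pred_intros_finite) auto
    then show ?thesis by (simp add: pred_def)
  qed
  have "?V * ennreal (2 ^ card C) = emeasure ?PBC ?T"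
  proof -
    have m: "?s (merge B C (f, g)) = ?s f" for f g
      by (intro sum.cong refl) (simp add: merge_def)
    have mC: "(\<forall>c\<in>C. merge B C (f, g) c \<in> {-1..1}) \<longleftrightarrow> (\<forall>c\<in>C. g c \<in> {-1..1})" for f g
      using disj by (auto simp: merge_def)
    have "emeasure ?PBC ?T = (\<integral>\<^sup>+f. indicator ?T f \<partial>?PBC)" using Tm by simp
    also have "\<dots> = (\<integral>\<^sup>+f. \<integral>\<^sup>+g. indicator ?T (merge B C (f, g)) \<partial>?PC \<partial>?PB)"
      by (rule product_nn_integral_fold[OF disj finB finC]) measurable
    also have "\<dots> = (\<integral>\<^sup>+f. \<integral>\<^sup>+g. indicator S (?s f) * indicator ?E g \<partial>?PC \<partial>?PB)"
    proof (intro nn_integral_cong)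
      fix f g assume "f \<in> space ?PB" "g \<in> space ?PC"
      then have "merge B C (f, g) \<in> space ?PBC" and g: "g \<in> extensional C"
        by (auto simp: space_PiM PiE_def)
      then have "merge B C (f, g) \<in> ?T \<longleftrightarrow> ?s f \<in> S \<and> g \<in> ?E"
        unfolding mem_Collect_eq[of _ "\<lambda>f. f \<in> space ?PBC \<and> ?s f \<in> S \<and> (\<forall>c\<in>C. f c \<in> {-1..1})"] m mC
        by (auto simp: PiE_def Pi_def)
      then show "indicator ?T (merge B C (f, g)) = (indicator S (?s f) * indicator ?E g :: ennreal)"
        by (simp add: indicator_def)
    qed
    also have "\<dots> = (\<integral>\<^sup>+f. indicator S (?s f) * (\<integral>\<^sup>+g. indicator ?E g \<partial>?PC) \<partial>?PB)"
      using finC by (intro nn_integral_cong nn_integral_cmult) (auto intro!: sets_PiM_I_finite)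
    also have "(\<integral>\<^sup>+g. indicator ?E g \<partial>?PC) = emeasure ?PC ?E"
      using finC by (intro nn_integral_indicator) (auto intro!: sets_PiM_I_finite)
    also have "\<dots> = (\<Prod>c\<in>C. emeasure lborel {-1..1::real})"
      by (rule emeasure_PiM[OF finC]) auto
    also have "\<dots> = ennreal (2 ^ card C)" using ennreal_power[of 2 "card C"] by simp
    also have "(\<integral>\<^sup>+f. indicator S (?s f) * ennreal (2 ^ card C) \<partial>?PB) = (\<integral>\<^sup>+f. indicator S (?s f) \<partial>?PB) * ennreal (2 ^ card C)"
      by (rule nn_integral_multc) measurable
    also have "(\<integral>\<^sup>+f. indicator S (?s f) \<partial>?PB) = (\<integral>\<^sup>+x. indicator S x \<partial>distr ?PB borel ?s)"
      by (rule nn_integral_distr[symmetric]) measurable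
    also have "\<dots> = ?V"
      using Sb by (simp add: subspace_lborel_def B_def Let_def)
    finally show ?thesis ..
  qed
  also have "emeasure ?PBC ?T \<le> emeasure lborel ?Z"
  proof -
    have hm: "?h \<in> ?PBC \<rightarrow>\<^sub>M borel"
    proof (rule borel_measurable_euclidean_space[THEN iffD2], rule ballI)
      fix b :: "real^'n idx" assume "b \<in> Basis"
      then obtain i where b: "b = axis i 1" by (auto simp: Basis_vec_def)
      show "(\<lambda>f. ?h f \<bullet> b) \<in> borel_measurable ?PBC"
        using measurable_component_singleton[OF eBC[of i], of "\<lambda>_. lborel :: real measure"] by (simp add: b inner_axis)
    qed
    have Zm: "?Z \<in> sets borel"
    proof -
      have "closed (\<Inter>k\<in>?J. {z. \<bar>z \<bullet> W k\<bar> \<le> A k})"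
        by (intro closed_INT ballI closed_Collect_le continuous_intros)
      also have "(\<Inter>k\<in>?J. {z. \<bar>z \<bullet> W k\<bar> \<le> A k}) = ?Z" by auto
      finally show ?thesis by (rule borel_closed)
    qed
    have "?T \<subseteq> ?h -` ?Z \<inter> space ?PBC"
    proof
      fix f assume f: "f \<in> ?T"
      define x where "x = X (?h f)"
      have "x = (\<Sum>i\<in>UNIV. f (e i) *\<^sub>R e i)" by (simp add: x_def X_def)
      also have "\<dots> = (\<Sum>b\<in>B \<union> C. f b *\<^sub>R b)" by (rule sum.reindex_bij_betw[OF e])
      also have "\<dots> = ?s f + (\<Sum>c\<in>C. f c *\<^sub>R c)" by (rule sum.union_disjoint[OF finB finC disj])
      finally have x: "x = ?s f + (\<Sum>c\<in>C. f c *\<^sub>R c)" .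
      have "\<bar>?h f \<bullet> W k\<bar> \<le> A k" if "k \<in> ?J" for k
      proof -
        from that consider j where "k = Inl j" "j \<in> J" | c where "k = Inr c" "c \<in> C" by auto
        then show ?thesis
        proof cases
          case 1
          have "x \<bullet> w j = ?s f \<bullet> w j"
          proof -
            have "(\<Sum>c\<in>C. f c *\<^sub>R c) \<bullet> w j = 0" using CH[OF wH[OF 1(2)]] by (simp add: inner_sum_left)
            then show ?thesis using arg_cong[OF x, of "\<lambda>x. x \<bullet> w j"] by (simp add: inner_add_left)
          qed
          then show ?thesis using f 1 by (simp add: W_def A_def XQ x_def S_def)
        next
          case 2
          obtain i where i: "c = e i" using e 2(2) by (auto simp: bij_betw_def)
          have "x \<bullet> c = f c" unfolding i x_def by (simp add: Xe)
          moreover have "f c \<in> {-1..1}" using f 2(2) by blast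
          ultimately show ?thesis using 2 by (simp add: W_def A_def XQ x_def abs_le_iff)
        qed
      qed
      then show "f \<in> ?h -` ?Z \<inter> space ?PBC" using f by blast
    qed
    then have "emeasure ?PBC ?T \<le> emeasure ?PBC (?h -` ?Z \<inter> space ?PBC)"
      by (rule emeasure_mono) (rule measurable_sets[OF hm Zm])
    also have "\<dots> = emeasure (distr ?PBC borel ?h) ?Z"
      by (rule emeasure_distr[OF hm Zm, symmetric])
    also have "distr ?PBC borel ?h = lborel" by (rule distr_PiM_lborel_cart[OF e])
    finally show ?thesis .
  qed
  also note core
  finally have fin_le: "?V * ennreal (2 ^ card C)
    \<le> ennreal (2 ^ CARD('n) * ?p * ?a)"
    unfolding prodA cardJ card_idx .
  have nk: "real CARD('n) = real (dim H) + real (card C)" using cardC(2) by linarith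
  have "?V = ?V * ennreal (2 ^ card C) * ennreal (1 / 2 ^ card C)"
    by (simp add: mult.assoc flip: ennreal_mult')
  also have "\<dots> \<le> ennreal (2 ^ CARD('n) * ?p * ?a) * ennreal (1 / 2 ^ card C)"
    by (intro mult_right_mono fin_le) simp
  also have "\<dots> = ennreal (2 ^ CARD('n) * ?p * ?a * (1 / 2 ^ card C))"
    by (rule ennreal_mult''[symmetric]) simp
  also have "2 ^ CARD('n) * ?p * ?a * (1 / 2 ^ card C)
    = 2 ^ dim H * 2 powr ((real (card J) - real (dim H)) / 2) * ?a"
    unfolding nk by (simp add: cardC(2)[symmetric] power_add)
  finally show ?thesis unfolding S_def .
qed

section \<open>The second estimate\<close>

text \<open>Write \<open>t\<close> as a convex combination of its extreme values \<open>1/2\<close> and \<open>c\<close>, where the inequality is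
  elementary, and use the superadditivity of \<open>(d, r) \<mapsto> d * ln (r / d)\<close>.\<close>

lemma weighted_ln_le:
  fixes c t :: real
  assumes c: "0 < c" "c \<le> 1" and t: "1/2 \<le> t" "t \<le> c" "t < 1"
  shows "t * ln c \<le> (1 - t) * ln (1 - (1 - c) / (2 * (1 - t)))"
proof (cases "c = 1/2")
  case True
  then have t2: "t = 1/2" using t by simp
  show ?thesis unfolding True t2 by simp
next
  case False
  then have c2: "1/2 < c" using t by simp
  define \<theta> where "\<theta> = (c - t) / (c - 1/2)"
  have th: "0 \<le> \<theta>" "\<theta> \<le> 1" using t c2 by (auto simp: \<theta>_def field_simps)
  have "\<theta> * (c - 1/2) = c - t" using c2 by (simp add: \<theta>_def)
  then have tt: "t = \<theta> / 2 + (1 - \<theta>) * c" by (simp add: algebra_simps)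
  have d: "1 - t = \<theta> / 2 + (1 - \<theta>) * (1 - c)" by (simp add: tt algebra_simps)
  have d0: "0 < 1 - t" using t by simp
  \<comment> \<open>On the right-hand side, t = 1/2 has weight 1/2 and argument c, while t = c has
    weight 1 - c and argument 1/2. These are the shares of the two cases in the weight 1 -
    t.\<close>
  let ?a = "(\<theta> / 2) / (1 - t)" and ?b = "((1 - \<theta>) * (1 - c)) / (1 - t)"
  have ab: "?a + ?b = 1"
    unfolding add_divide_distrib[symmetric] d[symmetric] using d0 by simp
  have nn: "0 \<le> ?a" "0 \<le> ?b" using th c d0 by auto
  have "p * ln y + q * ln z \<le> ln (p * y + q * z)"
    if "0 \<le> p" "0 \<le> q" "p + q = 1" "0 < y" "0 < z" for p q y z :: real
    using ln_concave that by (simp add: concave_on_iff)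
  from this[OF nn ab] have "?a * ln c + ?b * ln (1/2) \<le> ln (?a * c + ?b * (1/2))"
    using c(1) by (simp only: zero_less_divide_1_iff zero_less_numeral)
  moreover have "?a * c + ?b * (1/2) = 1 - (1 - c) / (2 * (1 - t))"
  proof -
    have "?a * c + ?b * (1/2) = (\<theta> / 2 * c + (1 - \<theta>) * (1 - c) / 2) / (1 - t)"
      by (simp add: add_divide_distrib)
    also have "\<theta> / 2 * c + (1 - \<theta>) * (1 - c) / 2 = (1 - t) - (1 - c) / 2"
      by (simp add: d algebra_simps add_divide_distrib diff_divide_distrib)
    also have "((1 - t) - (1 - c) / 2) / (1 - t) = 1 - (1 - c) / (2 * (1 - t))"
      unfolding diff_divide_distrib[of "1 - t"] using d0 by (simp only: divide_self[OF less_imp_neq[OF d0, symmetric]] divide_divide_eq_left)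
    finally show ?thesis .
  qed
  ultimately have "(1 - t) * (?a * ln c + ?b * ln (1/2)) \<le> (1 - t) * ln (1 - (1 - c) / (2 * (1 - t)))"
    using d0 by (intro mult_left_mono) auto
  moreover have "(1 - t) * (?a * ln c + ?b * ln (1/2)) = \<theta> / 2 * ln c + (1 - \<theta>) * ((1 - c) * ln (1/2))"
  proof -
    have "(1 - t) * (p / (1 - t) * y + q / (1 - t) * z) = p * y + q * z" for p q y z
      using d0 by (simp add: distrib_left)
    then show ?thesis by (simp only: mult.assoc)
  qed
  \<comment> \<open>This is the extreme case t = c: the function x ln x is convex, and (1 - c) * ln
    (1/2) is its chord between 1/2 and 1.\<close>
  moreover have "(1 - \<theta>) * (c * ln c) \<le> (1 - \<theta>) * ((1 - c) * ln (1/2))"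
  proof (intro mult_left_mono)
    have cv: "convex_on {0<..} (\<lambda>x::real. x * ln x)"
    proof (rule f''_ge0_imp_convex[of _ _ "\<lambda>x. ln x + 1" "\<lambda>x. 1 / x"])
      show "((\<lambda>x. x * ln x) has_real_derivative ln x + 1) (at x)" if "x \<in> {0<..}" for x :: real
        using that by (auto intro!: derivative_eq_intros)
      show "((\<lambda>x. ln x + 1) has_real_derivative 1 / x) (at x)" if "x \<in> {0<..}" for x :: real
        using that by (auto intro!: derivative_eq_intros)
    qed auto
    define s where "s = 2 * (1 - c)"
    have s: "0 \<le> s" "s \<le> 1" using c c2 by (auto simp: s_def)
    have "(s * (1/2) + (1 - s) * 1) * ln (s * (1/2) + (1 - s) * 1) \<le> s * (1/2 * ln (1/2)) + (1 - s) * (1 * ln 1)"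
      using convex_onD[OF cv, of "1 - s" "1/2" 1] s by simp
    moreover have "s * (1/2) + (1 - s) * 1 = c" by (simp add: s_def algebra_simps)
    moreover have "s * (1/2 * ln (1/2)) + (1 - s) * (1 * ln 1) = (1 - c) * ln (1/2)" by (simp add: s_def)
    ultimately show "c * ln c \<le> (1 - c) * ln (1/2)" by (simp only:)
  qed (use th in simp)
  moreover have "t * ln c = \<theta> / 2 * ln c + (1 - \<theta>) * (c * ln c)" by (simp add: tt algebra_simps)
  ultimately show ?thesis by linarith
qed

text \<open>Jensen's inequality for ln with weights \<open>1 - t j\<close> of total
  \<open>D\<close>. The arguments \<open>x j\<close> come from \<open>weighted_ln_le\<close>; their
  weighted sum is at most \<open>S\<close>, which makes \<open>S / D\<close> the point at which the
  tangent of ln is taken.\<close>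

lemma prod_powr_le:
  fixes c t :: "'i \<Rightarrow> real" and k n :: real
  assumes fin: "finite J" and c: "\<And>j. j \<in> J \<Longrightarrow> 0 < c j \<and> c j \<le> 1"
    and t: "\<And>j. j \<in> J \<Longrightarrow> 1/2 \<le> t j \<and> t j \<le> c j"
    and sumt: "(\<Sum>j\<in>J. t j) = k" and sumc: "(\<Sum>j\<in>J. c j) \<le> n" and less: "k < card J"
  shows "2 powr ((card J - k) / 2) * (\<Prod>j\<in>J. c j powr (t j / 2))
    \<le> ((card J + n - 2 * k) / (card J - k)) powr ((card J - k) / 2)"
proof -
  define D where "D = card J - k"
  define S where "S = (card J + n - 2 * k) / 2"
  have D: "0 < D" using less by (simp add: D_def)
  have sumd: "(\<Sum>j\<in>J. 1 - t j) = D" by (simp add: sum_subtractf sumt D_def)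
  define x where "x j = 1 - (1 - c j) / (2 * (1 - t j))" for j
  have x0: "0 < x j" if "j \<in> J" "t j < 1" for j
    using c[OF that(1)] t[OF that(1)] that(2) by (simp add: x_def field_simps)
  have xs: "(1 - t j) * x j \<le> (1 + c j) / 2 - t j" if "j \<in> J" for j
    using c[OF that] t[OF that] by (cases "t j = 1") (auto simp: x_def field_simps)
  have S: "(\<Sum>j\<in>J. (1 + c j) / 2 - t j) \<le> S"
    using sumc by (simp add: sum_subtractf sum.distrib sumt S_def sum_divide_distrib[symmetric])
  have S0: "0 < S"
  proof -
    obtain j where j: "j \<in> J" "0 < 1 - t j"
      using sumd D sum_nonpos[of J "\<lambda>j. 1 - t j"] by (meson not_le)
    have "0 < (\<Sum>j\<in>J. (1 + c j) / 2 - t j)"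
    proof (rule sum_pos2[OF fin j(1)])
      show "0 < (1 + c j) / 2 - t j" using c[OF j(1)] t[OF j(1)] j(2) by auto
      show "0 \<le> (1 + c i) / 2 - t i" if "i \<in> J" for i using c[OF that] t[OF that] by auto
    qed
    then show ?thesis using S by simp
  qed
  have "(\<Sum>j\<in>J. t j * ln (c j)) \<le> (\<Sum>j\<in>J. (1 - t j) * (ln (S / D) - 1) + ((1 + c j) / 2 - t j) / (S / D))"
  proof (intro sum_mono)
    fix j assume j: "j \<in> J"
    show "t j * ln (c j) \<le> (1 - t j) * (ln (S / D) - 1) + ((1 + c j) / 2 - t j) / (S / D)"
    proof (cases "t j < 1")
      \<comment> \<open>Weight 0 occurs only for \<open>t j = c j = 1\<close>, where both sides
        vanish.\<close>
      case False
      then have "t j = 1" "c j = 1" using c[OF j] t[OF j] by auto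
      then show ?thesis by simp
    next
      case True
      have "t j * ln (c j) \<le> (1 - t j) * ln (x j)"
        unfolding x_def using c[OF j] t[OF j] True by (intro weighted_ln_le) auto
      also have "\<dots> \<le> (1 - t j) * (ln (S / D) + (x j / (S / D) - 1))"
      proof (intro mult_left_mono)
        have "ln (x j / (S / D)) \<le> x j / (S / D) - 1"
          using x0[OF j True] S0 D by (intro ln_le_minus_one) auto
        moreover have "ln (x j / (S / D)) = ln (x j) - ln (S / D)"
        proof -
          have "ln (y / q) = ln y - ln q" if "0 < y" "0 < q" for y q :: real
            using that by (simp add: ln_div)
          then show ?thesis using x0[OF j True] S0 D by (meson divide_pos_pos)
        qed
        ultimately show "ln (x j) \<le> ln (S / D) + (x j / (S / D) - 1)" by linarith
      qed (use True in simp)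
      also have "\<dots> = (1 - t j) * (ln (S / D) - 1) + (1 - t j) * x j / (S / D)"
        by (simp add: algebra_simps)
      also have "\<dots> \<le> (1 - t j) * (ln (S / D) - 1) + ((1 + c j) / 2 - t j) / (S / D)"
        using xs[OF j] S0 D by (intro add_left_mono divide_right_mono) auto
      finally show ?thesis .
    qed
  qed
  also have "\<dots> = D * (ln (S / D) - 1) + (\<Sum>j\<in>J. (1 + c j) / 2 - t j) / (S / D)"
    by (simp only: sum.distrib sum_distrib_right[symmetric] sum_divide_distrib[symmetric] sumd)
  also have "\<dots> \<le> D * (ln (S / D) - 1) + S / (S / D)"
    using S S0 D by (intro add_left_mono divide_right_mono) auto
  also have "\<dots> = D * ln (S / D)" using S0 D by (simp add: algebra_simps)
  finally have main: "(\<Sum>j\<in>J. t j * ln (c j)) \<le> D * ln (S / D)" .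
  let ?L = "2 powr (D / 2) * (\<Prod>j\<in>J. c j powr (t j / 2))"
  let ?R = "(2 * S / D) powr (D / 2)"
  have cpos: "0 < c j powr (t j / 2)" if "j \<in> J" for j using c[OF that] by simp
  have P0: "0 < (\<Prod>j\<in>J. c j powr (t j / 2))" using cpos by (intro prod_pos)
  have lnP: "ln (\<Prod>j\<in>J. c j powr (t j / 2)) = (\<Sum>j\<in>J. t j * ln (c j)) / 2"
  proof -
    have "ln (\<Prod>j\<in>J. c j powr (t j / 2)) = (\<Sum>j\<in>J. ln (c j powr (t j / 2)))"
      using cpos by (intro ln_prod fin) auto
    also have "\<dots> = (\<Sum>j\<in>J. t j * ln (c j) / 2)"
      using c by (intro sum.cong refl) (auto simp: ln_powr)
    finally show ?thesis by (simp add: sum_divide_distrib)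
  qed
  have "ln ?L = D / 2 * ln 2 + (\<Sum>j\<in>J. t j * ln (c j)) / 2"
    using P0 by (subst ln_mult) (auto simp: lnP ln_powr)
  also have "\<dots> \<le> D / 2 * ln 2 + D * ln (S / D) / 2" using main by simp
  also have "\<dots> = ln ?R"
  proof -
    have "ln (2 * S / D) = ln 2 + ln (S / D)" using S0 D by (simp add: ln_mult ln_div)
    then show ?thesis using S0 D by (simp add: ln_powr algebra_simps)
  qed
  finally have "ln ?L \<le> ln ?R" .
  moreover have "0 < ?L" using P0 by simp
  moreover have "0 < ?R" using S0 D by simp
  ultimately have "?L \<le> ?R" by (simp only: ln_le_cancel_iff)
  moreover have "2 * S = card J + n - 2 * k" by (simp add: S_def)
  ultimately show ?thesis by (simp only: D_def)
qed

section \<open>Sections of bodies in John position\<close>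

text \<open>A supporting hyperplane of \<open>K\<close> at \<open>v\<close> also supports the unit
  ball there, and the ball has only its tangent hyperplane, so the normal is a multiple of
  \<open>v\<close>. Symmetry then gives the absolute value.\<close>

lemma contact_point_slab:
  fixes K :: "'a::euclidean_space set"
  assumes K: "convex_body K" and sym: "centrally_symmetric K" and ball: "cball 0 1 \<subseteq> K"
    and v: "v \<in> frontier K" "norm v = 1" and x: "x \<in> K"
  shows "\<bar>x \<bullet> v\<bar> \<le> 1"
proof -
  have cv: "convex K" and cl: "closed K" and int: "interior K \<noteq> {}"
    using K by (auto simp: convex_body_def compact_imp_closed)
  have vK: "v \<in> K" "v \<notin> rel_interior K"
    using v(1) cl rel_interior_nonempty_interior[OF int] by (auto simp: frontier_def)
  obtain a where a: "a \<noteq> 0" "\<And>y. y \<in> K \<Longrightarrow> a \<bullet> v \<le> a \<bullet> y"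
    using supporting_hyperplane_rel_boundary[OF cv vK] by metis
  \<comment> \<open>The minimiser of \<open>a \<bullet> y\<close> over the ball. It forces equality
    in the Cauchy-Schwarz inequality, which then shows that \<open>a + norm a *\<^sub>R v\<close>
    has norm 0.\<close>
  have "- (1 / norm a) *\<^sub>R a \<in> cball 0 1" using a(1) by simp
  then have "a \<bullet> v \<le> a \<bullet> (- (1 / norm a) *\<^sub>R a)" using a(2) ball by blast
  also have "\<dots> = - norm a" using a(1) by (simp add: power2_norm_eq_inner[symmetric] power2_eq_square)
  finally have av: "a \<bullet> v \<le> - norm a" .
  have "(a + r *\<^sub>R v) \<bullet> (a + r *\<^sub>R v) = a \<bullet> a + 2 * r * (a \<bullet> v) + r\<^sup>2 * (v \<bullet> v)" for r
    by (simp add: inner_add_left inner_add_right inner_commute power2_eq_square algebra_simps)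
  from this[of "norm a"]
  have "(a + norm a *\<^sub>R v) \<bullet> (a + norm a *\<^sub>R v) = (norm a)\<^sup>2 + 2 * norm a * (a \<bullet> v) + (norm a)\<^sup>2 * (norm v)\<^sup>2"
    by (simp only: power2_norm_eq_inner)
  also have "\<dots> \<le> (norm a)\<^sup>2 + 2 * norm a * (- norm a) + (norm a)\<^sup>2"
    using mult_left_mono[OF av, of "2 * norm a"] v(2) by simp
  also have "\<dots> = 0" by (simp add: power2_eq_square)
  finally have "(a + norm a *\<^sub>R v) \<bullet> (a + norm a *\<^sub>R v) = 0" by (intro antisym inner_ge_zero)
  then have "a + norm a *\<^sub>R v = 0" by (simp only: inner_eq_zero_iff)
  then have av': "a = - norm a *\<^sub>R v" by (simp add: eq_neg_iff_add_eq_0)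
  have le: "y \<bullet> v \<le> 1" if "y \<in> K" for y
  proof -
    have "- norm a \<le> a \<bullet> v" using norm_cauchy_schwarz[of "-a" v] v(2) by simp
    also have "a \<bullet> v \<le> a \<bullet> y" by (rule a(2)[OF that])
    also have "a \<bullet> y = - norm a * (y \<bullet> v)" by (subst av') (simp add: inner_commute)
    finally show ?thesis using a(1) by simp
  qed
  have "- x \<in> K" using sym x by (auto simp: centrally_symmetric_def)
  from le[OF x] le[OF this] show ?thesis by (simp add: abs_le_iff)
qed

text \<open>Both sides of the decomposition are applied to x and paired with x.\<close>

lemma identity_decomposition_parseval:
  fixes v :: "nat \<Rightarrow> real^'n"
  assumes "mat 1 = (\<Sum>j=1..m. c j *\<^sub>R tensor (v j) (v j))"
  shows "(norm x)\<^sup>2 = (\<Sum>j=1..m. c j * (x \<bullet> v j)\<^sup>2)"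
proof -
  have tv: "tensor u u *v x = (x \<bullet> u) *\<^sub>R u" for u :: "real^'n"
  proof -
    have "(tensor u u *v x) $ i = ((x \<bullet> u) *\<^sub>R u) $ i" for i
      by (simp add: tensor_def matrix_vector_mult_def inner_vec_def sum_distrib_left mult_ac)
    then show ?thesis by (simp add: vec_eq_iff)
  qed
  have sumv: "(\<Sum>j\<in>S. M j) *v x = (\<Sum>j\<in>S. M j *v x)" if "finite S" for S and M :: "nat \<Rightarrow> real^'n^'n"
    using that by induction (simp_all add: matrix_vector_mult_add_rdistrib)
  have "x = mat 1 *v x" by simp
  also have "\<dots> = (\<Sum>j=1..m. (c j * (x \<bullet> v j)) *\<^sub>R v j)"
    unfolding assms sumv[OF finite_atLeastAtMost] by (simp add: scaleR_matrix_vector_assoc[symmetric] tv)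
  finally have "x = (\<Sum>j=1..m. (c j * (x \<bullet> v j)) *\<^sub>R v j)" .
  from arg_cong[OF this, of "\<lambda>y. x \<bullet> y"] show ?thesis
    unfolding power2_norm_eq_inner by (simp add: inner_sum_right power2_eq_square mult.assoc)
qed

text \<open>The trace identity of Parseval frames, computed in an orthonormal basis of
  \<open>H\<close>.\<close>

lemma subspace_frame_norm_sum:
  fixes w :: "'i \<Rightarrow> 'a::euclidean_space"
  assumes H: "subspace H" and w: "\<And>j. j \<in> J \<Longrightarrow> w j \<in> H"
    and pars: "\<And>x. x \<in> H \<Longrightarrow> (\<Sum>j\<in>J. (x \<bullet> w j)\<^sup>2) = (norm x)\<^sup>2"
  shows "(\<Sum>j\<in>J. (norm (w j))\<^sup>2) = dim H"
proof -
  obtain B where B: "B \<subseteq> H" "pairwise orthogonal B" "\<And>b. b \<in> B \<Longrightarrow> norm b = 1" "span B = H"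
    using orthonormal_basis_subspace[OF H] by metis
  have "(\<Sum>j\<in>J. (norm (w j))\<^sup>2) = (\<Sum>j\<in>J. \<Sum>b\<in>B. (w j \<bullet> b)\<^sup>2)"
    using orthonormal_norm_sq(2)[OF B(2,3)] B(4) w by (intro sum.cong refl) auto
  also have "\<dots> = (\<Sum>b\<in>B. \<Sum>j\<in>J. (b \<bullet> w j)\<^sup>2)"
    by (subst sum.swap) (simp add: inner_commute)
  also have "\<dots> = (\<Sum>b\<in>B. 1)"
    using pars B(1,3) by (intro sum.cong refl) auto
  finally show ?thesis using orthonormal_card[OF B(2,3)] B(4) by simp
qed

lemma vol_cube: "vol k (cube k) = 2 ^ k"
proof -
  interpret product_sigma_finite "\<lambda>_::nat. lborel :: real measure" ..
  have "emeasure (\<Pi>\<^sub>M i\<in>{..<k}. (lborel :: real measure)) (cube k) = (\<Prod>i<k. emeasure lborel {-1..1::real})"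
    unfolding cube_def by (rule emeasure_PiM) auto
  also have "\<dots> = ennreal (2 ^ k)" using ennreal_power[of 2 k] by simp
  finally show ?thesis by (simp add: vol_def measure_def)
qed

theorem corollary11:
  fixes K H :: "(real^'n) set"
    and c :: "nat \<Rightarrow> real"
    and v :: "nat \<Rightarrow> real^'n"
    and m k m0 n :: nat
    and J :: "nat set"
  assumes "n = CARD('n)"
    and "convex_body K"
    and "centrally_symmetric K"
    and "john_position K"
    and "identity_decomposition K m c v"
    and "subspace H"
    and "dim H = k"
    and "J = {j \<in> {1..m}. orth_proj H (v j) \<noteq> 0}"
    and "m0 = card J"
    and "\<forall>j\<in>J. c j * (norm (orth_proj H (v j)))\<^sup>2 \<ge> 1 / 2"
    and "m0 > n"
  shows "subspace_vol H (K \<inter> H)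
           \<le> 2 powr ((real m0 - real k) / 2) * vol k (cube k)
              * (\<Prod>j\<in>J. c j powr (c j * (norm (orth_proj H (v j)))\<^sup>2 / 2))
       \<and> 2 powr ((real m0 - real k) / 2) * vol k (cube k)
              * (\<Prod>j\<in>J. c j powr (c j * (norm (orth_proj H (v j)))\<^sup>2 / 2))
           \<le> ((real m0 + real n - 2 * real k) / (real m0 - real k)) powr ((real m0 - real k) / 2)
              * vol k (cube k)"
proof -
  have ball: "cball 0 1 \<subseteq> K" using assms(4) by (auto simp: john_position_def max_volume_ellipsoid_def)
  have c: "0 < c j" "c j \<le> 1" and vf: "v j \<in> frontier K" and v1: "norm (v j) = 1" if "j \<in> {1..m}" for j
    using assms(5) that by (auto simp: identity_decomposition_def)
  have id: "(norm x)\<^sup>2 = (\<Sum>j=1..m. c j * (x \<bullet> v j)\<^sup>2)" for x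
    using assms(5) by (intro identity_decomposition_parseval) (simp add: identity_decomposition_def)
  have finJ: "finite J" and Jm: "J \<subseteq> {1..m}" using assms(8) by auto
  define p where "p j = orth_proj H (v j)" for j
  have pH: "p j \<in> H" for j unfolding p_def by (rule orth_proj(1)[OF assms(6)])
  have vp: "x \<bullet> v j = x \<bullet> p j" if "x \<in> H" for x j
    using orth_proj(2)[OF assms(6) that, of "v j"]
    by (simp add: p_def orthogonal_def inner_diff_left inner_commute[of x])
  have p1: "norm (p j) \<le> 1" if "j \<in> {1..m}" for j
  proof -
    have "norm (p j) * norm (p j) = p j \<bullet> v j"
      using vp[OF pH, of j j] by (simp add: power2_norm_eq_inner[symmetric] power2_eq_square)
    also have "\<dots> \<le> norm (p j) * norm (v j)" by (rule norm_cauchy_schwarz)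
    finally have "norm (p j) * norm (p j) \<le> norm (p j) * 1" using v1[OF that] by simp
    then show ?thesis by (cases "p j = 0") (auto simp: mult_le_cancel_left)
  qed
  define t where "t j = c j * (norm (p j))\<^sup>2" for j
  \<comment> \<open>The root of the weight makes these vectors a Parseval frame of \<open>H\<close>
    and turns the contact condition \<open>\<bar>x \<bullet> v j\<bar> \<le> 1\<close> into the
    bound \<open>sqrt (c j)\<close>.\<close>
  define w where "w j = sqrt (c j) *\<^sub>R p j" for j
  have nw: "(norm (w j))\<^sup>2 = t j" if "j \<in> J" for j
    using c(1)[of j] Jm that by (auto simp: w_def t_def power_mult_distrib)
  have wH: "w j \<in> H" for j unfolding w_def using assms(6) pH by (rule subspace_scale)
  have pars: "(\<Sum>j\<in>J. (x \<bullet> w j)\<^sup>2) = (norm x)\<^sup>2" if x: "x \<in> H" for x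
  proof -
    have "(\<Sum>j\<in>J. (x \<bullet> w j)\<^sup>2) = (\<Sum>j\<in>J. c j * (x \<bullet> v j)\<^sup>2)"
    proof (intro sum.cong refl)
      fix j assume "j \<in> J"
      then have "0 < c j" using c(1) Jm by blast
      then show "(x \<bullet> w j)\<^sup>2 = c j * (x \<bullet> v j)\<^sup>2" by (simp add: w_def vp[OF x] power_mult_distrib)
    qed
    \<comment> \<open>Indices outside \<open>J\<close> contribute nothing, as their
      \<open>v j\<close> are orthogonal to \<open>H\<close>.\<close>
    also have "\<dots> = (\<Sum>j=1..m. c j * (x \<bullet> v j)\<^sup>2)"
      using Jm assms(8) by (intro sum.mono_neutral_left) (auto simp: vp[OF x] p_def)
    finally show ?thesis using id[of x] by simp
  qed
  have half: "1/2 \<le> t j" if "j \<in> J" for j using assms(10) that by (auto simp: t_def p_def)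
  have tc: "t j \<le> c j" if "j \<in> J" for j
  proof -
    have j: "j \<in> {1..m}" using that Jm by blast
    have "(norm (p j))\<^sup>2 \<le> 1" using p1[OF j] by (simp add: power_le_one)
    then show ?thesis using c(1)[OF j] by (simp add: t_def)
  qed
  have sumt: "(\<Sum>j\<in>J. t j) = real k"
    using subspace_frame_norm_sum[OF assms(6) wH pars] nw assms(7) by simp
  \<comment> \<open>The trace of the decomposition of the identity gives the sum n over all indices,
    and the omitted weights are positive.\<close>
  have sumc: "(\<Sum>j\<in>J. c j) \<le> real n"
  proof -
    have "(\<Sum>j=1..m. (x \<bullet> (sqrt (c j) *\<^sub>R v j))\<^sup>2) = (norm x)\<^sup>2" for x
      unfolding id[of x] using c(1) by (intro sum.cong refl) (simp add: power_mult_distrib less_imp_le)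
    from frame_norm_sum[OF this] have "(\<Sum>j=1..m. (norm (sqrt (c j) *\<^sub>R v j))\<^sup>2) = real n"
      using assms(1) by simp
    moreover have "(\<Sum>j=1..m. (norm (sqrt (c j) *\<^sub>R v j))\<^sup>2) = (\<Sum>j=1..m. c j)"
      using c(1) v1 by (intro sum.cong refl) (simp add: power_mult_distrib less_imp_le)
    moreover have "(\<Sum>j\<in>J. c j) \<le> (\<Sum>j=1..m. c j)"
      using Jm c(1) by (intro sum_mono2) (auto intro: less_imp_le)
    ultimately show ?thesis by simp
  qed
  \<comment> \<open>This makes m0 - k positive, which is the total weight in Jensen's inequality and
    the denominator of the second bound.\<close>
  have "k \<le> n" using dim_subset_UNIV[of H] assms(1,7) by simp
  then have km: "real k < real (card J)" using assms(9,11) by simp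
  let ?P = "\<Prod>j\<in>J. c j powr (t j / 2)"
  let ?S = "{x\<in>H. \<forall>j\<in>J. \<bar>x \<bullet> w j\<bar> \<le> sqrt (c j)}"
  have "K \<inter> H \<subseteq> ?S"
  proof (intro subsetI CollectI conjI ballI)
    fix x j assume x: "x \<in> K \<inter> H" and "j \<in> J"
    then have j: "j \<in> {1..m}" using Jm by blast
    have "\<bar>x \<bullet> v j\<bar> \<le> 1"
      using contact_point_slab[OF assms(2,3) ball vf[OF j] v1[OF j]] x by blast
    then have "sqrt (c j) * \<bar>x \<bullet> p j\<bar> \<le> sqrt (c j) * 1"
      using c(1)[OF j] x vp[of x j] by (intro mult_left_mono) auto
    then show "\<bar>x \<bullet> w j\<bar> \<le> sqrt (c j)" using c(1)[OF j] by (simp add: w_def abs_mult)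
  qed auto
  moreover have "?S \<in> sets (subspace_lborel H)"
  proof -
    have "closed (H \<inter> (\<Inter>j\<in>J. {x. \<bar>x \<bullet> w j\<bar> \<le> sqrt (c j)}))"
      using closed_subspace[OF assms(6)] by (intro closed_Int closed_INT ballI closed_Collect_le continuous_intros)
    also have "H \<inter> (\<Inter>j\<in>J. {x. \<bar>x \<bullet> w j\<bar> \<le> sqrt (c j)}) = ?S" by auto
    finally show ?thesis by (simp add: subspace_lborel_def Let_def borel_closed)
  qed
  ultimately have "emeasure (subspace_lborel H) (K \<inter> H) \<le> emeasure (subspace_lborel H) ?S"
    by (rule emeasure_mono)
  also have "\<dots> \<le> ennreal (2 ^ dim H * 2 powr ((real (card J) - real (dim H)) / 2) * (\<Prod>j\<in>J. sqrt (c j) powr (norm (w j))\<^sup>2))"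
    using c(1) Jm half nw by (intro subspace_slab_volume[OF assms(6) finJ wH pars]) auto
  \<comment> \<open>The square root halves the exponent, which accounts for the 1/2 in the exponents
    of the claim.\<close>
  also have "(\<Prod>j\<in>J. sqrt (c j) powr (norm (w j))\<^sup>2) = ?P"
  proof (intro prod.cong refl)
    fix j assume j: "j \<in> J"
    then have "0 < c j" using c(1) Jm by blast
    then show "sqrt (c j) powr (norm (w j))\<^sup>2 = c j powr (t j / 2)"
      by (simp add: nw[OF j] powr_half_sqrt[symmetric] powr_powr)
  qed
  finally have "subspace_vol H (K \<inter> H) \<le> 2 ^ k * 2 powr ((real m0 - real k) / 2) * ?P"
    unfolding subspace_vol_def measure_def assms(7,9)
    by (intro enn2real_leI) (auto intro!: mult_nonneg_nonneg prod_nonneg)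
  then have 1: "subspace_vol H (K \<inter> H) \<le> 2 powr ((real m0 - real k) / 2) * vol k (cube k) * ?P"
    by (simp add: vol_cube mult_ac)
  have "2 powr ((real (card J) - real k) / 2) * ?P
    \<le> ((real (card J) + real n - 2 * real k) / (real (card J) - real k)) powr ((real (card J) - real k) / 2)"
    using c Jm half tc by (intro prod_powr_le[OF finJ _ _ sumt sumc km]) auto
  then have "2 powr ((real m0 - real k) / 2) * ?P * vol k (cube k)
    \<le> ((real m0 + real n - 2 * real k) / (real m0 - real k)) powr ((real m0 - real k) / 2) * vol k (cube k)"
    unfolding assms(9) by (intro mult_right_mono) (simp_all add: vol_cube)
  then have 2: "2 powr ((real m0 - real k) / 2) * vol k (cube k) * ?P
    \<le> ((real m0 + real n - 2 * real k) / (real m0 - real k)) powr ((real m0 - real k) / 2) * vol k (cube k)"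
    by (simp only: mult_ac)
  show ?thesis using 1 2 unfolding t_def p_def by blast
qed

end
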